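(* Consider the system, observer, approximate predictor $\Phi_{l,m}$ and closed-loop system described in the context, with $r,\tau\ge0$, $r+\tau>0$. Let $Q\in\mathbb{R}^{n\times n}$ be a symmetric positive definite matrix that satisfies $Q(A+pc')+(A'+cp')Q+2qI\le0$ for a certain constant $q>0$ and a certain $p\in\mathbb{R}^n$. Let $P\in\mathbb{R}^{n\times n}$ be a symmetric positive definite matrix that satisfies $$x'P(A+e_nk')x+x'Pf(x)+x'P\,\mathrm{diag}(g_1(x,u),\dots,g_n(x,u))\,d\ \le\ -2\mu\,x'Px+\gamma|d|^2\quad\forall (x,d,u)\in\mathbb{R}^n\times\mathbb{R}^n\times\mathbb{R}$$ for certain constants $\mu,\gamma>0$ and a certain $k\in\mathbb{R}^n$. Let $l,m$ be positive integers, put $T=\frac{r+\tau}{m}$ and assume $(nL+1)T<1$, and let $\theta\ge1$, $T_1>0$, $T_2>0$ be constants such that $$4|Qp|(L+\theta)T_1\sqrt{\tfrac{|Q|}{a}}<q,\qquad \theta\ge\max\Big(1,\tfrac{2|Q|L\sqrt n}{q}\Big),$$ $$\Big((nL+1+|k|)\sqrt{\tfrac{e_n'Pe_n}{2K_1}}+\mu\Big)|k|\Big(T_2+K\frac{((nL+1)T)^{l+1}}{1-(nL+1)T}\Big)<\mu,$$ where $a>0$ is a constant satisfying $a|x|^2\le x'Qx$ for all $x\in\mathbb{R}^n$, $0<K_1\le K_2$ are constants satisfying $K_1|x|^2\le x'Px\le K_2|x|^2$ for all $x\in\mathbb{R}^n$, and $K>0$ is the predictor accuracy constant defined in the context. Then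 there exist constants $\Theta_i>0$ ($i=1,\dots,6$) and $\sigma>0$ such that for every $(x_0,u_0,z_0,w_0)\in C^0([-r,0];\mathbb{R}^n)\times L^\infty([-r-\tau,0);\mathbb{R})\times\mathbb{R}^n\times\mathbb{R}$ and every $(\xi,b,d)\in L^\infty_{loc}(\mathbb{R}_+;\mathbb{R}\times\mathbb{R}_+\times\mathbb{R}^n)$, the solution of the closed-loop system with initial condition $x=x_0$ on $[-r,0]$, $u=u_0$ on $[-r-\tau,0)$, $(z(0),w(0))=(z_0,w_0)$, corresponding to the inputs $(\xi,b,d)$, satisfies for all $t\ge0$ $$\begin{aligned}|z(t)|+|w(t)|+\|T_r(t)x\|_r+\|\breve T_{r+\tau}(t)u\|_{r+\tau}\ \le\ & e^{-\sigma t}M\Big(\sup_{0\le s\le jT_2+\tau}b(s)\Big)\big(\Theta_1|z_0|+\Theta_2|w_0|+\Theta_3\|x_0\|_r+\Theta_4\|u_0\|_{r+\tau}\big)\\&+M\Big(\sup_{0\le s\le jT_2+\tau}b(s)\Big)\Theta_5\sup_{0\le s\le t}\big(e^{-\sigma(t-s)}|\xi(s)|\big)\\&+M\Big(\sup_{0\le s\le jT_2+\tau}b(s)\Big)\Theta_6\sup_{0\le s\le t}\big(e^{-\sigma(t-s)}|d(s)|\big),\end{aligned}$$ where $j=\min\{j\in\mathbb{Z}^+: jT_2\ge r+T_1\}$, $$M(\rho):=\left(\frac{7(1+\Gamma)\exp(\beta T_2)}{\sqrt{1-\exp(-2\omega T_1\exp(-\rho))}}\right)^{g\left(j+\frac{\tau}{T_2}\right)}\quad\text{for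 all }\rho\ge0,$$ $g(t):=\min\{k\in\mathbb{Z}^+:t\le k\}$, $\omega:=\frac12\max\big(L(n+1)+2+2n\max_{i=1,\dots,n}(\theta^{2i}p_i^2),\,1+L^2\big)$, $\Gamma:=K\frac{((nL+1)T)^{l+1}}{1-(nL+1)T}+\exp\big(\frac{(n+1)L+3}{2}(r+\tau)\big)$ and $\beta:=\omega+\frac{(n+1)L+3}{2}$.
   Context: Notation. $\mathbb{Z}^+$: non-negative integers. Prime denotes transpose. $|\cdot|$: Euclidean norm of vectors and induced norm of matrices. $L^\infty(I;\cdot)$, $L^\infty_{loc}(I;\cdot)$: measurable and (locally) bounded functions; functions differing on null sets are not identified and all suprema are actual suprema. $\|T_r(t)x\|_r=\sup_{t-r\le s\le t}|x(s)|$, $\|\breve T_{r+\tau}(t)u\|_{r+\tau}=\sup_{t-r-\tau\le s<t}|u(s)|$, $\|x_0\|_r=\sup_{[-r,0]}|x_0|$, $\|u_0\|_{r+\tau}=\sup_{[-r-\tau,0)}|u_0|$; $\breve T_{r+\tau}(t)u$ is the function $s\mapsto u(t+s)$ on $[-r-\tau,0)$. System ($n\ge2$), with input delay $\tau\ge0$ and measurement delay $r\ge0$, $r+\tau>0$: $$\dot x_i(t)=f_i(x_1(t),\dots,x_i(t))+x_{i+1}(t)+g_i(x(t),u(t))d_i(t),\ i=1,\dots,n-1,$$ $$\dot x_n(t)=f_n(x(t))+g_n(x(t),u(t))d_n(t)+u(t-\tau),$$ with $x(t)\in\mathbb{R}^n$, $u(t)\in\mathbb{R}$, disturbance $d(t)\in\mathbb{R}^n$.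 Here $f_i:\mathbb{R}^i\to\mathbb{R}$ with $f_i(0)=0$ and $g_i:\mathbb{R}^n\times\mathbb{R}\to\mathbb{R}$ is locally Lipschitz, and there are constants $L,G\ge0$ with $|f_i(x_1,\dots,x_i)-f_i(z_1,\dots,z_i)|\le L|(x_1-z_1,\dots,x_i-z_i)|$ and $|g_i(x,u)|\le G$ for all arguments and all $i=1,\dots,n$. Put $f(x)=(f_1(x_1),\dots,f_n(x))'$; $A=\{a_{i,j}\}\in\mathbb{R}^{n\times n}$ with $a_{i,i+1}=1$ and all other entries $0$; $e_n=(0,\dots,0,1)'$; $c=(1,0,\dots,0)'$. Observer (gain vector $p=(p_1,\dots,p_n)'$, parameter $\theta\ge1$, maximum sampling period $T_1>0$): $$\dot z_i=f_i(z_1,\dots,z_i)+z_{i+1}+\theta^ip_i(c'z-w),\ i=1,\dots,n-1,\qquad \dot z_n=f_n(z)+\theta^np_n(c'z-w)+u(t-r-\tau),$$ $$\dot w(t)=f_1(z_1(t))+z_2(t)\ \text{ for }t\in[\tau_i,\tau_{i+1}),\qquad w(\tau_{i+1})=x_1(\tau_{i+1}-r)+\xi(\tau_{i+1}),$$ $$\tau_{i+1}=\tau_i+T_1\exp(-b(\tau_i)),\quad\tau_0=0,\quad i\in\mathbb{Z}^+,$$ where $\xi:\mathbb{R}_+\to\mathbb{R}$ is the measurement error and $b:\mathbb{R}_+\to\mathbb{R}_+$ is an arbitrary locally bounded function. Approximate predictor. For $S>0$ and $u\in L^\infty([0,S);\mathbb{R})$ define $P_{S,u}:C^0([0,S];\mathbb{R}^n)\to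 C^0([0,S];\mathbb{R}^n)$ by $(P_{S,u}x)(t)=x(0)+\int_0^t(f(x(s))+Ax(s)+e_nu(s))ds$. For $l\ge1$ and $x_0\in\mathbb{R}^n$, let $Q^l_{S,u}x_0:=(P_{S,u}^l\bar x_0)(S)$, where $P^l_{S,u}$ is the $l$-fold composition and $\bar x_0$ is the constant function $x_0$. For integers $l,m\ge1$, $T=\frac{r+\tau}{m}$ and $u\in L^\infty([0,r+\tau);\mathbb{R})$, let $P^u_{l,m}x:=Q^l_{T,u_m}\cdots Q^l_{T,u_1}x$, where $u_i(s)=u(s+(i-1)T)$ for $s\in[0,T)$. For $u\in L^\infty([-r-\tau,0);\mathbb{R})$ define $\Phi_{l,m}(x,u):=P^{\tilde u}_{l,m}x$ with $\tilde u(t)=u(t-r-\tau)$, $t\in[0,r+\tau)$. Predictor accuracy constant $K$. When $(nL+1)T<1$, $K=K(m)>0$ denotes a constant, independent of $l$, such that for all $l\ge 1$, $u\in L^\infty([0,r+\tau);\mathbb{R})$ and $x\in\mathbb{R}^n$: $|P^u_{l,m}x-\phi(r+\tau,x;u)|\le K\frac{((nL+1)T)^{l+1}}{1-(nL+1)T}\big(|x|+\sup_{0\le s<r+\tau}|u(s)|\big)$, where $\phi(t,x;u)$ is the solution at time $t$ of $\dot x=f(x)+Ax+e_nu(t)$ with initial state $x$. (Such a constant is known to exist.) Control law with holding period $T_2>0$: $u(t)=k'\Phi_{l,m}\big(z(iT_2),\breve T_{r+\tau}(iT_2)u\big)$ for $t\in[iT_2,(i+1)T_2)$, $i\in\mathbb{Z}^+$.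 The closed-loop system consists of the system, the observer and the control law. *)

theory Defs
  imports "HOL-Analysis.Analysis"
begin

section \<open>Function spaces, matrices\<close>

text \<open>\<open>'n rvec\<close> is \<open>real ^ 'n\<close> and \<open>'n rmat\<close> is \<open>real ^ 'n ^ 'n\<close>; the prefix form avoids the sort
  annotations that the infix notation requires at every occurrence.\<close>

type_synonym 'n rvec = "(real, 'n) vec"
type_synonym 'n rmat = "((real, 'n) vec, 'n) vec"

text \<open>Functions are total in HOL; membership in \<open>L\<^sup>\<infinity>(I)\<close> and \<open>L\<^sup>\<infinity>\<^sub>l\<^sub>o\<^sub>c(I)\<close> only constrains
  values on \<open>I\<close>. Functions are not identified almost everywhere, and boundedness is pointwise.\<close>

definition L_inf :: "real set \<Rightarrow> (real \<Rightarrow> 'a::euclidean_space) \<Rightarrow> bool" where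
  "L_inf I h \<longleftrightarrow> h \<in> borel_measurable (lebesgue_on I) \<and> bounded (h ` I)"

definition L_inf_loc :: "real set \<Rightarrow> (real \<Rightarrow> 'a::euclidean_space) \<Rightarrow> bool" where
  "L_inf_loc I h \<longleftrightarrow> h \<in> borel_measurable (lebesgue_on I) \<and>
     (\<forall>C\<subseteq>I. compact C \<longrightarrow> bounded (h ` C))"

definition sup_on :: "real set \<Rightarrow> (real \<Rightarrow> 'a::real_normed_vector) \<Rightarrow> real" where
  "sup_on I h = (SUP s\<in>I. norm (h s))"

definition shift :: "real \<Rightarrow> (real \<Rightarrow> 'a) \<Rightarrow> real \<Rightarrow> 'a" where
  "shift t h = (\<lambda>s. h (t + s))"

definition locally_Lipschitz :: "('a::metric_space \<Rightarrow> 'b::metric_space) \<Rightarrow> bool" where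
  "locally_Lipschitz h \<longleftrightarrow> (\<forall>x. \<exists>\<rho>>0. \<exists>C. C-lipschitz_on (ball x \<rho>) h)"

text \<open>The library's \<open>norm\<close> on \<open>real ^ 'n ^ 'n\<close> is the Frobenius norm, not the induced norm.\<close>

definition matrix_norm :: "real ^ 'n ^ 'n \<Rightarrow> real" where
  "matrix_norm B = onorm ((*v) B)"

definition outer :: "real ^ 'n \<Rightarrow> real ^ 'n \<Rightarrow> real ^ 'n ^ 'n" where
  "outer v w = (\<chi> i j. v $ i * w $ j)"

definition diag :: "real ^ 'n \<Rightarrow> real ^ 'n ^ 'n" where
  "diag v = (\<chi> i j. if i = j then v $ i else 0)"

definition sym_pos_def :: "real ^ 'n ^ 'n \<Rightarrow> bool" where
  "sym_pos_def B \<longleftrightarrow> transpose B = B \<and> (\<forall>x. x \<noteq> 0 \<longrightarrow> 0 < x \<bullet> (B *v x))"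

definition neg_semidef :: "real ^ 'n ^ 'n \<Rightarrow> bool" where
  "neg_semidef B \<longleftrightarrow> (\<forall>x. x \<bullet> (B *v x) \<le> 0)"

text \<open>\<open>least_nat t\<close> is \<open>min {k \<in> \<int>\<^sup>+. t \<le> k}\<close>.\<close>

definition least_nat :: "real \<Rightarrow> nat" where
  "least_nat t = (LEAST k. t \<le> real k)"

text \<open>Caratheodory solutions on an interval \<open>I\<close>: \<open>y\<close> is locally absolutely continuous on \<open>I\<close> with
  derivative \<open>h\<close> almost everywhere, expressed by the equivalent integral equation.
  For a differential equation, \<open>h\<close> is its right-hand side evaluated along \<open>y\<close>.\<close>

definition ac_derivative_on ::
  "real set \<Rightarrow> (real \<Rightarrow> 'a::euclidean_space) \<Rightarrow> (real \<Rightarrow> 'a) \<Rightarrow> bool" where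
  "ac_derivative_on I y h \<longleftrightarrow> (\<forall>s\<in>I. \<forall>t\<in>I. s \<le> t \<longrightarrow>
     h absolutely_integrable_on {s..t} \<and> y t = y s + integral {s..t} h)"


section \<open>The triangular system\<close>

text \<open>Coordinates are indexed by a finite linear order \<open>'n\<close>; \<open>idx\<close> enumerates it as \<open>1, \<dots>, n\<close>
  with \<open>n = CARD('n)\<close>.\<close>

definition idx :: "'n::{finite,linorder} \<Rightarrow> nat" where
  "idx i = card {..i}"

definition first_unit :: "('n::{finite,linorder}) rvec" where
  "first_unit = axis (Min UNIV) 1"

definition last_unit :: "('n::{finite,linorder}) rvec" where
  "last_unit = axis (Max UNIV) 1"

definition chain :: "('n::{finite,linorder}) rmat" where
  "chain = (\<chi> i j. if idx j = idx i + 1 then 1 else 0)"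

text \<open>\<open>\<real>\<^sup>i\<close> is identified with the vectors whose coordinates after the \<open>i\<close>-th vanish, and
  \<open>head i x\<close> stands for \<open>(x\<^sub>1, \<dots>, x\<^sub>i)\<close>. A map \<open>f i\<close> on \<open>\<real>\<^sup>i\<close> is represented by a function that is
  only ever applied to such vectors.\<close>

definition head :: "'n \<Rightarrow> 'n rvec \<Rightarrow> ('n::{finite,linorder}) rvec" where
  "head i x = (\<chi> j. if j \<le> i then x $ j else 0)"

definition fvec ::
  "('n \<Rightarrow> 'n rvec \<Rightarrow> real) \<Rightarrow> 'n rvec \<Rightarrow> ('n::{finite,linorder}) rvec" where
  "fvec f x = (\<chi> i. f i (head i x))"


section \<open>The approximate predictor\<close>

text \<open>\<open>P\<^bsub>S,u\<^esub>\<close> does not depend on \<open>S\<close> apart from its domain: the value at \<open>t\<close> only involves the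
  restrictions of \<open>x\<close> and \<open>u\<close> to \<open>[0,t)\<close> and \<open>x(0)\<close>.\<close>

definition picard :: "('n \<Rightarrow> 'n rvec \<Rightarrow> real) \<Rightarrow> (real \<Rightarrow> real) \<Rightarrow>
    (real \<Rightarrow> 'n rvec) \<Rightarrow> real \<Rightarrow> ('n::{finite,linorder}) rvec" where
  "picard f u x t =
     x 0 + integral {0..t} (\<lambda>s. fvec f (x s) + chain *v x s + u s *\<^sub>R last_unit)"

definition Q_pred :: "('n \<Rightarrow> 'n rvec \<Rightarrow> real) \<Rightarrow> nat \<Rightarrow> real \<Rightarrow> (real \<Rightarrow> real) \<Rightarrow>
    'n rvec \<Rightarrow> ('n::{finite,linorder}) rvec" where
  "Q_pred f l S u x0 = (picard f u ^^ l) (\<lambda>_. x0) S"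

text \<open>In the next two definitions \<open>h\<close> is the prediction horizon \<open>r + \<tau>\<close>.
  \<open>fold\<close> applies the factor with index \<open>1\<close> first.\<close>

definition P_pred :: "('n \<Rightarrow> 'n rvec \<Rightarrow> real) \<Rightarrow> nat \<Rightarrow> nat \<Rightarrow> real \<Rightarrow> (real \<Rightarrow> real) \<Rightarrow>
    'n rvec \<Rightarrow> ('n::{finite,linorder}) rvec" where
  "P_pred f l m h u x =
     (let T = h / real m
      in fold (\<lambda>i. Q_pred f l T (\<lambda>s. u (s + (real i - 1) * T))) [1..<Suc m] x)"

definition Phi_pred :: "('n \<Rightarrow> 'n rvec \<Rightarrow> real) \<Rightarrow> nat \<Rightarrow> nat \<Rightarrow> real \<Rightarrow> 'n rvec \<Rightarrow>
    (real \<Rightarrow> real) \<Rightarrow> ('n::{finite,linorder}) rvec" where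
  "Phi_pred f l m h x u = P_pred f l m h (\<lambda>t. u (t - h)) x"

definition nominal_solution :: "('n \<Rightarrow> 'n rvec \<Rightarrow> real) \<Rightarrow> real \<Rightarrow> (real \<Rightarrow> real) \<Rightarrow>
    'n rvec \<Rightarrow> (real \<Rightarrow> ('n::{finite,linorder}) rvec) \<Rightarrow> bool" where
  "nominal_solution f h u x \<phi> \<longleftrightarrow> \<phi> 0 = x \<and>
     ac_derivative_on {0..h} \<phi> (\<lambda>t. fvec f (\<phi> t) + chain *v \<phi> t + u t *\<^sub>R last_unit)"

definition predictor_accuracy_constant :: "('n::{finite,linorder} \<Rightarrow> 'n rvec \<Rightarrow> real) \<Rightarrow>
    real \<Rightarrow> nat \<Rightarrow> real \<Rightarrow> real \<Rightarrow> bool" where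
  "predictor_accuracy_constant f L m h K \<longleftrightarrow> K > 0 \<and>
     (let T = h / real m; \<kappa> = (real CARD('n) * L + 1) * T
      in \<forall>l\<ge>1. \<forall>u x \<phi>. L_inf {0..<h} u \<longrightarrow> nominal_solution f h u x \<phi> \<longrightarrow>
           norm (P_pred f l m h u x - \<phi> h)
             \<le> K * (\<kappa> ^ (l + 1) / (1 - \<kappa>)) * (norm x + sup_on {0..<h} u))"


section \<open>The closed loop\<close>

definition plant_solution :: "('n \<Rightarrow> 'n rvec \<Rightarrow> real) \<Rightarrow> ('n \<Rightarrow> 'n rvec \<Rightarrow> real \<Rightarrow> real) \<Rightarrow>
    real \<Rightarrow> (real \<Rightarrow> 'n rvec) \<Rightarrow> (real \<Rightarrow> real) \<Rightarrow>
    (real \<Rightarrow> ('n::{finite,linorder}) rvec) \<Rightarrow> bool" where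
  "plant_solution f g \<tau> d u x \<longleftrightarrow>
     ac_derivative_on {0..} x (\<lambda>t. fvec f (x t) + chain *v x t
       + diag (\<chi> i. g i (x t) (u t)) *v d t + u (t - \<tau>) *\<^sub>R last_unit)"

primrec sampling_time :: "real \<Rightarrow> (real \<Rightarrow> real) \<Rightarrow> nat \<Rightarrow> real" where
  "sampling_time T1 b 0 = 0"
| "sampling_time T1 b (Suc i) =
     sampling_time T1 b i + T1 * exp (- b (sampling_time T1 b i))"

definition observer_solution :: "('n \<Rightarrow> 'n rvec \<Rightarrow> real) \<Rightarrow> 'n rvec \<Rightarrow> real \<Rightarrow> real \<Rightarrow>
    real \<Rightarrow> real \<Rightarrow> (real \<Rightarrow> real) \<Rightarrow> (real \<Rightarrow> real) \<Rightarrow>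
    (real \<Rightarrow> 'n rvec) \<Rightarrow> (real \<Rightarrow> real) \<Rightarrow>
    (real \<Rightarrow> ('n::{finite,linorder}) rvec) \<Rightarrow> (real \<Rightarrow> real) \<Rightarrow> bool" where
  "observer_solution f p \<theta> T1 r \<tau> \<xi> b x u z w \<longleftrightarrow>
     ac_derivative_on {0..} z (\<lambda>t. fvec f (z t) + chain *v z t
       + (\<chi> i. \<theta> ^ idx i * p $ i * (first_unit \<bullet> z t - w t))
       + u (t - r - \<tau>) *\<^sub>R last_unit) \<and>
     (\<forall>i. ac_derivative_on {sampling_time T1 b i..<sampling_time T1 b (Suc i)} w
            (\<lambda>t. first_unit \<bullet> (fvec f (z t) + chain *v z t)) \<and>
          w (sampling_time T1 b (Suc i)) =
            first_unit \<bullet> x (sampling_time T1 b (Suc i) - r) + \<xi> (sampling_time T1 b (Suc i)))"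

definition control_law :: "('n \<Rightarrow> 'n rvec \<Rightarrow> real) \<Rightarrow> nat \<Rightarrow> nat \<Rightarrow> real \<Rightarrow> real \<Rightarrow>
    'n rvec \<Rightarrow> (real \<Rightarrow> ('n::{finite,linorder}) rvec) \<Rightarrow> (real \<Rightarrow> real) \<Rightarrow> bool" where
  "control_law f l m h T2 k z u \<longleftrightarrow>
     (\<forall>i::nat. \<forall>t\<in>{real i * T2..<(real i + 1) * T2}.
        u t = k \<bullet> Phi_pred f l m h (z (real i * T2)) (shift (real i * T2) u))"

definition closed_loop_solution :: "('n \<Rightarrow> 'n rvec \<Rightarrow> real) \<Rightarrow>
    ('n \<Rightarrow> 'n rvec \<Rightarrow> real \<Rightarrow> real) \<Rightarrow> real \<Rightarrow> real \<Rightarrow> 'n rvec \<Rightarrow> real \<Rightarrow> real \<Rightarrow> real \<Rightarrow>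
    nat \<Rightarrow> nat \<Rightarrow> 'n rvec \<Rightarrow>
    (real \<Rightarrow> 'n rvec) \<Rightarrow> (real \<Rightarrow> real) \<Rightarrow> 'n rvec \<Rightarrow> real \<Rightarrow>
    (real \<Rightarrow> real) \<Rightarrow> (real \<Rightarrow> real) \<Rightarrow> (real \<Rightarrow> 'n rvec) \<Rightarrow>
    (real \<Rightarrow> 'n rvec) \<Rightarrow> (real \<Rightarrow> real) \<Rightarrow>
    (real \<Rightarrow> ('n::{finite,linorder}) rvec) \<Rightarrow> (real \<Rightarrow> real) \<Rightarrow> bool" where
  "closed_loop_solution f g r \<tau> p \<theta> T1 T2 l m k x0 u0 z0 w0 \<xi> b d x u z w \<longleftrightarrow>
     (\<forall>t\<in>{-r..0}. x t = x0 t) \<and> (\<forall>t\<in>{-r-\<tau>..<0}. u t = u0 t) \<and> z 0 = z0 \<and> w 0 = w0 \<and>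
     plant_solution f g \<tau> d u x \<and>
     observer_solution f p \<theta> T1 r \<tau> \<xi> b x u z w \<and>
     control_law f l m (r + \<tau>) T2 k z u"

end

theory Submission
  imports Defs
begin

text \<open>Fix \<open>t\<close> and let \<open>E\<close> bound the initial data and the weighted signals \<open>e\<^sup>\<sigma>\<^sup>s |\<xi>(s)|\<close>,
  \<open>e\<^sup>\<sigma>\<^sup>s |d(s)|\<close> on \<open>[0, t]\<close>; every closed-loop signal is to be bounded by \<open>C E e\<^sup>-\<^sup>\<sigma>\<^sup>t\<close>.
  On a bounded initial interval this follows from Gronwall's lemma, hold interval by hold interval,
  uniformly in \<open>b\<close>: \<open>w\<close> is controlled by its initial value, the last sample and an integral along \<open>z\<close>,
  however the samples are spaced; the factor \<open>M \<ge> 1\<close> then comes for free.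
  Afterwards two small-gain arguments in the weighted supremum norm apply. The rescaled observer error
  \<open>\<theta>\<^sup>-\<^sup>i (z\<^sub>i(s) - x\<^sub>i(s - r))\<close> has the Lyapunov function given by \<open>Q\<close>, and the inter-sample error of \<open>w\<close>
  feeds back with gain proportional to \<open>T\<^sub>1\<close>. The state has the Lyapunov function given by
  \<open>P\<close>, driven by the control error \<open>u(s - \<tau>) - k'x(s)\<close>, which feeds back with gain proportional to \<open>T\<^sub>2\<close> plus the
  predictor accuracy. Both strict inequalities at \<open>\<sigma> = 0\<close> persist for small \<open>\<sigma> > 0\<close>.
  Solutions exist because the loop is a causal, locally Lipschitz functional differential equation
  for \<open>(x, z)\<close> of linear growth on each hold interval.\<close>

section \<open>Absolutely continuous functions\<close>

text \<open>Both small-gain steps derive \<open>Y \<le> c + gain * Y\<close> for a weighted supremum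
  \<open>Y\<close>, which can be solved only if the supremum is known to be finite. Bounds that
  depend on the time horizon supply the finiteness and then disappear from the constants. The
  smallness conditions are gains at \<sigma> = 0. The observer gain multiplies the growth of the
  inter-sample error, T1 \<theta> (L + \<theta>) / sqrt a, by the effect |Qp| / sqrt (q \<theta>
  \<open>decay\<close>) of that error on the Lyapunov function. The control gain is the left side of
  the T2 condition divided by \<mu>. No regularity of the predictor in its arguments is ever
  established. For existence, each held value is frozen by the past, so it is constant along a
  stage. For the estimates, only the accuracy relative to an exact nominal solution enters, and
  Gronwall's lemma transfers it to the true trajectory. The input delay means that u at time t is
  designed for the state at t + \<tau>, beyond the range where the disturbance is controlled. The
  control error is therefore measured along a continuation of the plant.\<close>

lemma ac_derivative_on_subset:
  "ac_derivative_on I y h \<Longrightarrow> J \<subseteq> I \<Longrightarrow> ac_derivative_on J y h"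
  unfolding ac_derivative_on_def by blast

lemma ac_derivative_onD:
  assumes "ac_derivative_on I y h" "s \<in> I" "t \<in> I" "s \<le> t"
  shows "h absolutely_integrable_on {s..t}" "h integrable_on {s..t}"
    "y t = y s + integral {s..t} h"
  using assms set_lebesgue_integral_eq_integral(1) unfolding ac_derivative_on_def by blast+

lemma ac_derivative_on_continuous:
  assumes "ac_derivative_on {a..b} y h"
  shows "continuous_on {a..b} y"
proof (cases "a \<le> b")
  case True
  have "h integrable_on {a..b}"
    by (rule ac_derivative_onD(2)[OF assms]) (use True in auto)
  then have "continuous_on {a..b} (\<lambda>t. y a + integral {a..t} h)"
    by (intro continuous_on_add continuous_on_const indefinite_integral_continuous_1)
  then show ?thesis
    by (rule continuous_on_eq) (rule ac_derivative_onD(3)[OF assms, symmetric], auto)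
qed auto

text \<open>Continuity is local: a sequence converging to \<open>t\<close> eventually lies in
  \<open>{a..t+1}\<close>, where the compact version applies.\<close>

lemma ac_derivative_on_continuous_atLeast:
  assumes "ac_derivative_on {a..} y h"
  shows "continuous_on {a..} y"
proof (rule continuous_on_sequentially[THEN iffD2], intro allI ballI impI)
  fix s :: "nat \<Rightarrow> real" and t assume t: "t \<in> {a..}" and s: "(\<forall>n. s n \<in> {a..}) \<and> s \<longlonglongrightarrow> t"
  have "ac_derivative_on {a..t+1} y h"
    by (rule ac_derivative_on_subset[OF assms]) auto
  then have c: "continuous_on {a..t+1} y"
    by (rule ac_derivative_on_continuous)
  have "eventually (\<lambda>n. s n < t + 1) sequentially"
    using s by (intro order_tendstoD(2)) auto
  then have "eventually (\<lambda>n. s n \<in> {a..t+1}) sequentially"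
    by (rule eventually_mono) (use s in auto)
  then have "(\<lambda>n. y (s n)) \<longlonglongrightarrow> y t"
    using s t by (intro continuous_on_tendsto_compose[OF c]) auto
  then show "(y \<circ> s) \<longlonglongrightarrow> y t"
    by (simp add: o_def)
qed

lemma ac_derivative_on_diff:
  assumes "ac_derivative_on I y h" "ac_derivative_on I y' h'"
  shows "ac_derivative_on I (\<lambda>t. y t - y' t) (\<lambda>t. h t - h' t)"
  unfolding ac_derivative_on_def
proof (intro ballI impI)
  fix s t assume st: "s \<in> I" "t \<in> I" "s \<le> t"
  note 1 = ac_derivative_onD[OF assms(1) st] and 2 = ac_derivative_onD[OF assms(2) st]
  show "(\<lambda>t. h t - h' t) absolutely_integrable_on {s..t} \<and>
      y t - y' t = y s - y' s + integral {s..t} (\<lambda>t. h t - h' t)"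
    using 1 2 by (auto simp: integral_diff intro!: set_integral_diff(1))
qed

lemma ac_derivative_on_linear:
  fixes A :: "'a::euclidean_space \<Rightarrow> 'b::euclidean_space"
  assumes "ac_derivative_on I y h" "bounded_linear A"
  shows "ac_derivative_on I (\<lambda>t. A (y t)) (\<lambda>t. A (h t))"
  unfolding ac_derivative_on_def
proof (intro ballI impI)
  fix s t assume st: "s \<in> I" "t \<in> I" "s \<le> t"
  note 1 = ac_derivative_onD[OF assms(1) st]
  show "(\<lambda>t. A (h t)) absolutely_integrable_on {s..t} \<and>
      A (y t) = A (y s) + integral {s..t} (\<lambda>t. A (h t))"
    using absolutely_integrable_linear[OF 1(1) assms(2)] integral_linear[OF 1(2) assms(2)]
    by (simp add: o_def 1(3) linear_simps[OF assms(2)])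
qed

lemma absolutely_integrable_shift_real:
  fixes h :: "real \<Rightarrow> 'a::euclidean_space"
  assumes "h absolutely_integrable_on {a..b}"
  shows "(\<lambda>t. h (t + c)) absolutely_integrable_on {a - c..b - c}"
  using assms integrable_shift_real_ivl[of h a b c]
    integrable_shift_real_ivl[of "\<lambda>t. norm (h t)" a b c]
  unfolding absolutely_integrable_on_def by simp

lemma ac_derivative_on_shift:
  assumes "ac_derivative_on I y h"
  shows "ac_derivative_on ((\<lambda>t. t - c) ` I) (\<lambda>t. y (t + c)) (\<lambda>t. h (t + c))"
  unfolding ac_derivative_on_def
proof (intro ballI impI)
  fix s t assume "s \<in> (\<lambda>t. t - c) ` I" "t \<in> (\<lambda>t. t - c) ` I" and "s \<le> t"
  then have st: "s + c \<in> I" "t + c \<in> I" "s + c \<le> t + c"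
    by (auto simp: image_iff)
  note 1 = ac_derivative_onD[OF assms(1) st]
  show "(\<lambda>t. h (t + c)) absolutely_integrable_on {s..t} \<and>
      y (t + c) = y (s + c) + integral {s..t} (\<lambda>t. h (t + c))"
    using absolutely_integrable_shift_real[OF 1(1), of c] 1(3)
      integral_shift_real_ivl[of "s + c" c "t + c" h] by simp
qed

lemma ac_derivative_on_shift_Icc:
  assumes "ac_derivative_on {a..b} y h"
  shows "ac_derivative_on {a - c..b - c} (\<lambda>t. y (t + c)) (\<lambda>t. h (t + c))"
proof -
  have "(\<lambda>t. t - c) ` {a..b} = {a - c..b - c}"
    by (auto simp: image_iff intro!: bexI[of _ "_ + c"])
  then show ?thesis
    using ac_derivative_on_shift[OF assms, of c] by simp
qed

text \<open>A derivative may be changed on a null set. This is used to discard the right endpoint of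
  an interval, where a bound on the input or on a perturbation is not yet available.\<close>

lemma ac_derivative_on_spike:
  assumes "ac_derivative_on I y h" "negligible N" "\<And>t. t \<in> I - N \<Longrightarrow> h' t = h t"
    and "\<And>s t. s \<in> I \<Longrightarrow> t \<in> I \<Longrightarrow> {s..t} \<subseteq> I"
  shows "ac_derivative_on I y h'"
  unfolding ac_derivative_on_def
proof (intro ballI impI)
  fix s t assume st: "s \<in> I" "t \<in> I" "s \<le> t"
  note 1 = ac_derivative_onD[OF assms(1) st]
  have eq: "h' x = h x" if "x \<in> {s..t} - N" for x
    using assms(3,4) st that by blast
  show "h' absolutely_integrable_on {s..t} \<and> y t = y s + integral {s..t} h'"
    using absolutely_integrable_spike[OF 1(1) assms(2) eq] integral_spike[OF assms(2)
        eq[symmetric], of "{s..t}"] 1(3)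
    by simp
qed

lemma ac_derivative_on_increment_bound:
  assumes "ac_derivative_on {a..b} y h" "s \<in> {a..b}" "t \<in> {a..b}" "s \<le> t"
    and "\<And>x. x \<in> {s..t} \<Longrightarrow> norm (h x) \<le> B"
  shows "norm (y t - y s) \<le> B * (t - s)"
proof -
  have "norm (integral {s..t} h) \<le> integral {s..t} (\<lambda>_. B)"
    using ac_derivative_onD(2)[OF assms(1-4)] assms(5)
    by (intro integral_norm_bound_integral) auto
  then show ?thesis
    using ac_derivative_onD(3)[OF assms(1-4)] assms(4) by (simp add: mult.commute)
qed

text \<open>For a bounded derivative, \<open>V t - V s\<close> with \<open>V = y \<bullet> Q y\<close> equals \<open>\<integral> h \<bullet> Q (y s + y t)\<close>, which
  differs from \<open>\<integral> 2 h \<bullet> Q y\<close> by \<open>O((t - s)\<^sup>2)\<close>; no product rule for absolutely continuous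
  functions is needed.\<close>

lemma quadratic_form_increment:
  fixes y :: "real \<Rightarrow> 'a::euclidean_space"
  assumes y: "ac_derivative_on {a..b} y h" and ab: "a \<le> b"
    and h: "\<And>t. t \<in> {a..b} \<Longrightarrow> norm (h t) \<le> B"
    and A: "bounded_linear A" and sym: "\<And>u v. u \<bullet> A v = v \<bullet> A u"
  shows "(\<lambda>t. 2 * (h t \<bullet> A (y t))) integrable_on {a..b}"
    and "y b \<bullet> A (y b) - y a \<bullet> A (y a) = integral {a..b} (\<lambda>t. 2 * (h t \<bullet> A (y t)))"
proof -
  interpret A: bounded_linear A by fact
  obtain KA where KA: "KA > 0" "\<And>v. norm (A v) \<le> norm v * KA"
    using A.pos_bounded by blast
  have B: "B \<ge> 0" by (rule order_trans[OF norm_ge_zero h[of a]]) (use ab in simp)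
  have cy: "continuous_on {a..b} y"
    by (rule ac_derivative_on_continuous[OF y])
  have hai: "h absolutely_integrable_on {a..b}"
    using ac_derivative_onD(1)[OF y, of a b] ab by auto
  have cAy: "continuous_on {a..b} (\<lambda>t. A (y t))"
    by (intro A.continuous_on cy)
  have "bounded ((\<lambda>t. A (y t)) ` {a..b})"
    by (intro compact_imp_bounded compact_continuous_image cAy) auto
  then obtain C where C: "\<And>t. t \<in> {a..b} \<Longrightarrow> norm (A (y t)) \<le> C"
    unfolding bounded_iff by blast
  have "(\<lambda>t. h t \<bullet> A (y t)) absolutely_integrable_on {a..b}"
  proof (rule measurable_bounded_by_integrable_imp_absolutely_integrable)
    show "(\<lambda>t. h t \<bullet> A (y t)) \<in> borel_measurable (lebesgue_on {a..b})"
      using absolutely_integrable_measurable[THEN iffD1, OF _ hai] cAy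
      by (intro borel_measurable_inner) (auto intro!: continuous_imp_measurable_on_sets_lebesgue)
    show "(\<lambda>_. B * C) integrable_on {a..b}" by auto
    show "norm (h t \<bullet> A (y t)) \<le> B * C" if "t \<in> {a..b}" for t
      using Cauchy_Schwarz_ineq2[of "h t" "A (y t)"] h[OF that] C[OF that] B
      by (auto intro!: order_trans[OF Cauchy_Schwarz_ineq2] mult_mono)
  qed auto
  then have int1: "(\<lambda>t. h t \<bullet> A (y t)) integrable_on {a..b}"
    using set_lebesgue_integral_eq_integral(1) by blast
  then show int: "(\<lambda>t. 2 * (h t \<bullet> A (y t))) integrable_on {a..b}"
    by (rule integrable_on_mult_right)
  define \<phi> where "\<phi> t = y t \<bullet> A (y t) - integral {a..t} (\<lambda>t. 2 * (h t \<bullet> A (y t)))" for t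
  define D where "D = 2 * B * KA * B"
  have quad: "\<bar>\<phi> t - \<phi> s\<bar> \<le> D * (t - s) * (t - s)" if st: "s \<in> {a..b}" "t \<in> {a..b}" "s \<le> t" for s t
  proof -
    note i = ac_derivative_onD[OF y st]
    have ints: "(\<lambda>t. 2 * (h t \<bullet> A (y t))) integrable_on {s..t}"
      by (rule integrable_subinterval_real[OF int]) (use st in auto)
    have bl: "bounded_linear (\<lambda>v. v \<bullet> A (y t + y s))"
      by (rule bounded_linear_inner_left)
    have hint: "(\<lambda>x. h x \<bullet> A (y t + y s)) integrable_on {s..t}"
      using integrable_linear[OF i(2) bl] by (simp add: o_def)
    have "y t \<bullet> A (y t) - y s \<bullet> A (y s) = (y t - y s) \<bullet> A (y t + y s)"
      using sym[of "y t" "y s"] by (simp add: A.add inner_diff_left inner_add_right)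
    also have "\<dots> = integral {s..t} (\<lambda>x. h x \<bullet> A (y t + y s))"
      using integral_linear[OF i(2) bl] i(3) by (simp add: o_def)
    finally have e1: "y t \<bullet> A (y t) - y s \<bullet> A (y s) = integral {s..t} (\<lambda>x. h x \<bullet> A (y t + y s))" .
    have "integral {a..s} (\<lambda>t. 2 * (h t \<bullet> A (y t))) + integral {s..t} (\<lambda>t. 2 * (h t \<bullet> A (y t)))
        = integral {a..t} (\<lambda>t. 2 * (h t \<bullet> A (y t)))"
      by (rule Henstock_Kurzweil_Integration.integral_combine)
        (use st integrable_subinterval_real[OF int, of a t] in auto)
    then have "\<phi> t - \<phi> s = integral {s..t} (\<lambda>x. h x \<bullet> A (y t + y s))
        - integral {s..t} (\<lambda>t. 2 * (h t \<bullet> A (y t)))"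
      using e1 unfolding \<phi>_def by simp
    also have "\<dots> = integral {s..t} (\<lambda>x. h x \<bullet> A (y t + y s) - 2 * (h x \<bullet> A (y x)))"
      by (rule integral_diff[symmetric, OF hint ints])
    also have "norm \<dots> \<le> integral {s..t} (\<lambda>_. D * (t - s))"
    proof (rule integral_norm_bound_integral[OF integrable_diff[OF hint ints]])
      fix x assume x: "x \<in> {s..t}"
      have xt: "norm (y t - y x) \<le> B * (t - x)" "norm (y x - y s) \<le> B * (x - s)"
        by (rule ac_derivative_on_increment_bound[OF y]; use st x h in auto)+
      have xx: "norm (y t - y x) \<le> B * (t - s)" "norm (y x - y s) \<le> B * (t - s)"
        using xt x B by (auto elim!: order_trans intro!: mult_left_mono)
      \<comment> \<open>The sum of the end values minus twice the middle value is a difference of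
        two increments of \<open>y\<close>, each of size at most \<open>B * (t - s)\<close>.\<close>
      have "h x \<bullet> A (y t + y s) - 2 * (h x \<bullet> A (y x)) = h x \<bullet> A ((y t - y x) - (y x - y s))"
        by (simp add: A.add A.diff inner_diff_right inner_add_right)
      also have "\<bar>\<dots>\<bar> \<le> norm (h x) * norm (A ((y t - y x) - (y x - y s)))"
        by (rule Cauchy_Schwarz_ineq2)
      also have "\<dots> \<le> B * ((2 * B * (t - s)) * KA)"
      proof (rule mult_mono)
        show "norm (h x) \<le> B" using x st by (intro h) auto
        have "norm ((y t - y x) - (y x - y s)) \<le> norm (y t - y x) + norm (y x - y s)"
          by (rule norm_triangle_ineq4)
        then have "norm ((y t - y x) - (y x - y s)) * KA \<le> 2 * B * (t - s) * KA"
          using xx KA(1) by (intro mult_right_mono) auto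
        then show "norm (A ((y t - y x) - (y x - y s))) \<le> 2 * B * (t - s) * KA"
          using KA(2) order_trans by blast
      qed (use B in auto)
      finally show "norm (h x \<bullet> A (y t + y s) - 2 * (h x \<bullet> A (y x))) \<le> D * (t - s)"
        unfolding D_def by (simp add: algebra_simps)
    qed auto
    also have "\<dots> = D * (t - s) * (t - s)" using st by (simp add: mult.commute)
    finally show ?thesis by (simp only: real_norm_def)
  qed
  \<comment> \<open>By the quadratic bound the difference quotients of \<open>\<phi>\<close> tend to
    0 at every point, although neither of its two summands need be differentiable there.\<close>
  have "\<exists>c. \<forall>x\<in>{a..b}. \<phi> x = c"
  proof (rule has_field_derivative_zero_constant)
    fix x assume x: "x \<in> {a..b}"
    have D: "D \<ge> 0" unfolding D_def using B KA by simp
    have "((\<lambda>t. (\<phi> t - \<phi> x) / (t - x)) \<longlongrightarrow> 0) (at x within {a..b})"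
    proof (rule Lim_null_comparison)
      show "\<forall>\<^sub>F t in at x within {a..b}. norm ((\<phi> t - \<phi> x) / (t - x)) \<le> D * \<bar>t - x\<bar>"
        unfolding eventually_at_filter
      proof (rule always_eventually, intro allI impI)
        fix t assume t: "t \<noteq> x" "t \<in> {a..b}"
        have "\<bar>\<phi> t - \<phi> x\<bar> \<le> D * \<bar>t - x\<bar> * \<bar>t - x\<bar>"
          using quad[of x t] quad[of t x] x t by (cases "x \<le> t") (auto simp: abs_minus_commute)
        then show "norm ((\<phi> t - \<phi> x) / (t - x)) \<le> D * \<bar>t - x\<bar>"
          using t by (simp add: abs_divide pos_divide_le_eq)
      qed
      show "((\<lambda>t. D * \<bar>t - x\<bar>) \<longlongrightarrow> 0) (at x within {a..b})"
        by (auto intro!: tendsto_eq_intros)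
    qed
    then show "(\<phi> has_field_derivative 0) (at x within {a..b})"
      by (simp add: has_field_derivative_iff)
  qed auto
  then have "\<phi> b = \<phi> a" using ab by auto
  then show "y b \<bullet> A (y b) - y a \<bullet> A (y a) = integral {a..b} (\<lambda>t. 2 * (h t \<bullet> A (y t)))"
    unfolding \<phi>_def by simp
qed

section \<open>Comparison lemmas\<close>

text \<open>The integrating factor turns the right-hand side into \<open>\<psi>\<close>, whose
  derivative is \<open>C * exp (- C * (s - a))\<close> times the nonpositive difference between
  \<open>\<phi> s\<close> and that right-hand side.\<close>

lemma gronwall:
  fixes \<phi> :: "real \<Rightarrow> real"
  assumes c: "continuous_on {a..b} \<phi>" and C: "0 \<le> C"
    and le: "\<And>t. t \<in> {a..b} \<Longrightarrow> \<phi> t \<le> A + C * integral {a..t} \<phi>"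
    and t: "t \<in> {a..b}"
  shows "\<phi> t \<le> A * exp (C * (t - a))"
proof -
  define \<psi> where "\<psi> s = exp (- C * (s - a)) * (A + C * integral {a..s} \<phi>)" for s
  have der: "(\<psi> has_real_derivative exp (- C * (s - a)) * (C * \<phi> s - C * (A
      + C * integral {a..s} \<phi>)))
      (at s within {a..b})" if "s \<in> {a..b}" for s
    unfolding \<psi>_def using integral_has_real_derivative[OF c that]
    by (auto intro!: derivative_eq_intros simp: algebra_simps)
  have "\<psi> t \<le> \<psi> a"
  proof (cases "a < t")
    case True
    have "continuous_on {a..b} \<psi>" using der by (rule DERIV_continuous_on)
    then have ct: "continuous_on {a..t} \<psi>" by (rule continuous_on_subset) (use t in auto)
    show ?thesis
    proof (rule DERIV_nonpos_imp_decreasing_open[OF less_imp_le[OF True] _ ct])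
      fix x assume x: "a < x" "x < t"
      then have at: "at x within {a..b} = at x" using t by (intro at_within_Icc_at) auto
      have "exp (- C * (x - a)) * (C * \<phi> x - C * (A + C * integral {a..x} \<phi>)) \<le> 0"
        using mult_left_mono[OF le[of x] C] x t by (intro mult_nonneg_nonpos) auto
      then show "\<exists>y. (\<psi> has_real_derivative y) (at x) \<and> y \<le> 0"
        using der[of x] x t unfolding at by auto
    qed
  qed (use t in auto)
  then have "exp (- C * (t - a)) * (A + C * integral {a..t} \<phi>) \<le> A"
    unfolding \<psi>_def by simp
  then have "exp (C * (t - a)) * (exp (- C * (t - a)) * (A + C * integral {a..t} \<phi>))
      \<le> exp (C * (t - a)) * A"
    by (rule mult_left_mono) simp
  then have "A + C * integral {a..t} \<phi> \<le> A * exp (C * (t - a))"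
    by (simp add: mult.assoc[symmetric] exp_add[symmetric] mult.commute)
  then show ?thesis using le[OF t] by linarith
qed

lemma ac_derivative_on_gronwall:
  fixes y :: "real \<Rightarrow> 'a::euclidean_space"
  assumes y: "ac_derivative_on {a..b} y h" and C: "C \<ge> 0" and D: "D \<ge> 0"
    and h: "\<And>t. t \<in> {a..b} \<Longrightarrow> norm (h t) \<le> C * norm (y t) + D" and t: "t \<in> {a..b}"
  shows "norm (y t) \<le> (norm (y a) + D * (b - a)) * exp (C * (b - a))"
proof -
  have cy: "continuous_on {a..b} (\<lambda>t. norm (y t))"
    by (intro continuous_intros ac_derivative_on_continuous[OF y])
  have 1: "norm (y s) \<le> (norm (y a) + D * (b - a)) + C * integral {a..s} (\<lambda>t. norm (y t))"
    if s: "s \<in> {a..b}" for s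
  proof -
    have i: "(\<lambda>t. norm (y t)) integrable_on {a..s}"
      by (intro integrable_continuous_real continuous_on_subset[OF cy]) (use s in auto)
    have "norm (integral {a..s} h) \<le> integral {a..s} (\<lambda>t. C * norm (y t) + D)"
    proof (rule integral_norm_bound_integral)
      show "h integrable_on {a..s}" using ac_derivative_onD(2)[OF y, of a s] s by auto
      show "(\<lambda>t. C * norm (y t) + D) integrable_on {a..s}"
        by (intro integrable_add integrable_on_mult_right i) auto
    qed (use h s in auto)
    also have "\<dots> = C * integral {a..s} (\<lambda>t. norm (y t)) + D * (s - a)"
      using i s by (subst integral_add) (auto intro: integrable_on_mult_right)
    also have "D * (s - a) \<le> D * (b - a)" using D s by (intro mult_left_mono) auto
    finally show ?thesis
      using ac_derivative_onD(3)[OF y, of a s] s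
        norm_triangle_ineq[of "y a" "integral {a..s} h"] by auto
  qed
  have "norm (y t) \<le> (norm (y a) + D * (b - a)) * exp (C * (t - a))"
    by (rule gronwall[OF cy C 1 t])
  also have "\<dots> \<le> (norm (y a) + D * (b - a)) * exp (C * (b - a))"
    using t C D by (intro mult_left_mono) (auto intro!: mult_left_mono add_nonneg_nonneg)
  finally show ?thesis .
qed

text \<open>If \<open>V t\<close> exceeded \<open>U t\<close>, then after the last time
  \<open>s\<close> with \<open>V s \<le> U s\<close> the function \<open>V\<close> would stay above
  \<open>U\<close>, and there \<open>step\<close> forbids it to grow faster. Increments replace
  derivatives because \<open>V\<close> is only absolutely continuous in the applications.\<close>

lemma comparison:
  fixes V U :: "real \<Rightarrow> real"
  assumes cV: "continuous_on {a..b} V" and cU: "continuous_on {a..b} U" and init: "V a \<le> U a"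
    and step: "\<And>s t. a \<le> s \<Longrightarrow> s < t \<Longrightarrow> t \<le> b \<Longrightarrow> (\<And>x. x \<in> {s..t} \<Longrightarrow> U x \<le> V x) \<Longrightarrow>
      V t - V s \<le> U t - U s"
    and t: "t \<in> {a..b}"
  shows "V t \<le> U t"
proof (rule ccontr)
  assume gt: "\<not> V t \<le> U t"
  define S where "S = {x \<in> {a..t}. V x \<le> U x}"
  have ct: "continuous_on {a..t} V" "continuous_on {a..t} U"
    by (rule continuous_on_subset[OF cV], use t in simp, rule continuous_on_subset[OF cU], use t
        in simp)
  have "closed S" unfolding S_def
    by (intro continuous_on_closed_Collect_le ct closed_atLeastAtMost)
  moreover have "a \<in> S" unfolding S_def using init t by auto
  moreover have bdd: "bdd_above S" unfolding S_def by (auto simp: bdd_above_def)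
  ultimately have sS: "Sup S \<in> S"
    by (intro closed_contains_Sup) auto
  define s where "s = Sup S"
  have s: "a \<le> s" "s \<le> t" "V s \<le> U s" using sS unfolding s_def S_def by auto
  have "s \<noteq> t" using s gt by auto
  then have st: "s < t" using s by simp
  have above: "U x < V x" if "x \<in> {s<..t}" for x
  proof (rule ccontr)
    assume "\<not> U x < V x"
    then have "x \<in> S" unfolding S_def using that s by auto
    then have "x \<le> s" unfolding s_def by (rule cSup_upper[OF _ bdd])
    then show False using that by auto
  qed
  \<comment> \<open>\<open>step\<close> needs \<open>U \<le> V\<close> at the left endpoint as well.
    If it failed there, the intermediate value theorem would give a crossing later than
    \<open>s\<close>, which was the last one.\<close>
  have Vs: "U s \<le> V s"
  proof (rule ccontr)
    assume *: "\<not> U s \<le> V s"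
    have "\<exists>x\<ge>s. x \<le> t \<and> V x - U x = 0"
      by (rule IVT') (use * gt st s in
        \<open>auto intro!: continuous_intros continuous_on_subset[OF ct(1)] continuous_on_subset[OF
            ct(2)]\<close>)
    then obtain x where x: "s \<le> x" "x \<le> t" "V x = U x" by auto
    then have "x \<noteq> s" using * by auto
    then show False using above[of x] x by auto
  qed
  have "V t - V s \<le> U t - U s"
  proof (rule step)
    show "U x \<le> V x" if "x \<in> {s..t}" for x
      using above[of x] Vs that by (cases "x = s") auto
  qed (use s st t in auto)
  then show False using gt s by linarith
qed

text \<open>Where \<open>V\<close> lies above \<open>exp (- 2 * \<sigma> * t) * M\<close>, the bound
  on \<open>v\<close> and the choice of \<open>M\<close> give
  \<open>v t \<le> - 2 * \<sigma> * exp (- 2 * \<sigma> * t) * M\<close>, the derivative of that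
  function. The rate is doubled since \<open>V\<close> will be a quadratic form in signals that
  decay at rate \<sigma>.\<close>

lemma exponential_comparison:
  fixes V :: "real \<Rightarrow> real"
  assumes cV: "continuous_on {a..b} V" and init: "V a \<le> exp (- 2 * \<sigma> * a) * M"
    and inc: "\<And>s t. a \<le> s \<Longrightarrow> s \<le> t \<Longrightarrow> t \<le> b \<Longrightarrow> v integrable_on {s..t} \<and> V t - V s = integral {s..t} v"
    and v: "\<And>t. t \<in> {a..b} \<Longrightarrow> v t \<le> - 2 * \<kappa> * V t + exp (- 2 * \<sigma> * t) * B"
    and \<kappa>: "\<kappa> \<ge> 0" and M: "B \<le> 2 * (\<kappa> - \<sigma>) * M" and t: "t \<in> {a..b}"
  shows "V t \<le> exp (- 2 * \<sigma> * t) * M"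
proof (rule comparison[where a = a and b = b and U = "\<lambda>t. exp (- 2 * \<sigma> * t) * M", OF cV _ _ _ t])
  show "V a \<le> exp (- 2 * \<sigma> * a) * M" by (rule init)
  show "continuous_on {a..b} (\<lambda>t. exp (- 2 * \<sigma> * t) * M)" by (intro continuous_intros)
  fix s t assume st: "a \<le> s" "s < t" "t \<le> b" and ge: "\<And>x. x \<in> {s..t} \<Longrightarrow> exp (- 2 * \<sigma> * x) * M \<le> V x"
  have U: "((\<lambda>x. - 2 * \<sigma> * exp (- 2 * \<sigma> * x) * M) has_integral
      exp (- 2 * \<sigma> * t) * M - exp (- 2 * \<sigma> * s) * M) {s..t}"
    using st
    by (intro fundamental_theorem_of_calculus)
      (auto intro!: derivative_eq_intros simp flip: has_real_derivative_iff_has_vector_derivative)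
  have "V t - V s = integral {s..t} v" using inc[of s t] st by auto
  also have "\<dots> \<le> integral {s..t} (\<lambda>x. - 2 * \<sigma> * exp (- 2 * \<sigma> * x) * M)"
  proof (rule integral_le)
    show "v integrable_on {s..t}" using inc[of s t] st by auto
    show "(\<lambda>x. - 2 * \<sigma> * exp (- 2 * \<sigma> * x) * M) integrable_on {s..t}" using U by blast
    fix x assume x: "x \<in> {s..t}"
    have "v x \<le> - 2 * \<kappa> * V x + exp (- 2 * \<sigma> * x) * B" using v x st by auto
    also have "\<dots> \<le> - 2 * \<kappa> * (exp (- 2 * \<sigma> * x) * M) + exp (- 2 * \<sigma> * x) * (2 * (\<kappa> - \<sigma>) * M)"
      using ge[OF x] \<kappa> M by (intro add_mono mult_left_mono mult_left_mono_neg) auto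
    finally show "v x \<le> - 2 * \<sigma> * exp (- 2 * \<sigma> * x) * M" by (simp add: algebra_simps)
  qed
  also have "\<dots> = exp (- 2 * \<sigma> * t) * M - exp (- 2 * \<sigma> * s) * M" using U by blast
  finally show "V t - V s \<le> exp (- 2 * \<sigma> * t) * M - exp (- 2 * \<sigma> * s) * M" .
qed

text \<open>Since the supremum is finite, it is itself an admissible \<open>Y\<close>. Taking the
  supremum over \<open>x\<close> gives \<open>Y \<le> c + \<rho> * Y\<close>, which
  \<open>\<rho> < 1\<close> allows to solve for \<open>Y\<close>.\<close>

lemma small_gain:
  fixes \<phi> :: "'a \<Rightarrow> real"
  assumes "bdd_above (\<phi> ` A)" and \<rho>: "\<rho> < 1"
    and le: "\<And>Y x. (\<And>x. x \<in> A \<Longrightarrow> \<phi> x \<le> Y) \<Longrightarrow> x \<in> A \<Longrightarrow> \<phi> x \<le> c + \<rho> * Y"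
    and x: "x \<in> A"
  shows "\<phi> x \<le> c / (1 - \<rho>)"
proof -
  define Y where "Y = (SUP x\<in>A. \<phi> x)"
  have up: "\<phi> x \<le> Y" if "x \<in> A" for x
    unfolding Y_def by (rule cSUP_upper[OF that assms(1)])
  have "Y \<le> c + \<rho> * Y"
    unfolding Y_def[symmetric] using x le[OF up]
    by (subst Y_def, intro cSUP_least) auto
  then have "Y \<le> c / (1 - \<rho>)" using \<rho> by (simp add: field_simps)
  then show ?thesis using up[OF x] by linarith
qed

section \<open>Functional differential equations\<close>

lemma exp_integral_bound:
  fixes \<kappa> :: real
  assumes "\<kappa> > 0" "a \<le> t"
  shows "(\<lambda>s. c * exp (\<kappa> * (s - a))) integrable_on {a..t}"
    "integral {a..t} (\<lambda>s. c * exp (\<kappa> * (s - a))) = c * (exp (\<kappa> * (t - a)) - 1) / \<kappa>"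
proof -
  have "((\<lambda>s. c * exp (\<kappa> * (s - a))) has_integral
      c * exp (\<kappa> * (t - a)) / \<kappa> - c * exp (\<kappa> * (a - a)) / \<kappa>) {a..t}"
    using assms
    by (intro fundamental_theorem_of_calculus)
      (auto intro!: derivative_eq_intros simp flip: has_real_derivative_iff_has_vector_derivative)
  then show "(\<lambda>s. c * exp (\<kappa> * (s - a))) integrable_on {a..t}"
    "integral {a..t} (\<lambda>s. c * exp (\<kappa> * (s - a))) = c * (exp (\<kappa> * (t - a)) - 1) / \<kappa>"
    by (auto simp: has_integral_iff diff_divide_distrib right_diff_distrib)
qed

text \<open>Picard iteration in the weighted unknown \<open>exp (- \<kappa> (t - t0)) (y t - h t0)\<close>, which makes the
  integral operator a contraction on the whole interval.\<close>

lemma functional_ode_Lipschitz: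
  fixes F :: "real \<Rightarrow> (real \<Rightarrow> 'a::euclidean_space) \<Rightarrow> 'a"
  assumes t01: "t0 \<le> t1" and h: "continuous_on UNIV h" and C: "C \<ge> 0"
    and int: "\<And>y. continuous_on UNIV y \<Longrightarrow> (\<And>s. s \<le> t0 \<Longrightarrow> y s = h s) \<Longrightarrow>
      (\<lambda>s. F s y) integrable_on {t0..t1}"
    and Lip: "\<And>y y' s B. continuous_on UNIV y \<Longrightarrow> (\<And>s. s \<le> t0 \<Longrightarrow> y s = h s) \<Longrightarrow>
      continuous_on UNIV y' \<Longrightarrow> (\<And>s. s \<le> t0 \<Longrightarrow> y' s = h s) \<Longrightarrow> s \<in> {t0..t1} \<Longrightarrow>
      (\<And>v. v \<in> {t0..s} \<Longrightarrow> norm (y v - y' v) \<le> B) \<Longrightarrow> norm (F s y - F s y') \<le> C * B"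
  shows "\<exists>y. continuous_on UNIV y \<and> (\<forall>s\<le>t0. y s = h s) \<and>
    (\<forall>t\<in>{t0..t1}. y t = h t0 + integral {t0..t} (\<lambda>s. F s y))"
proof -
  \<comment> \<open>Two unknowns at distance \<open>D\<close> give trajectories whose weighted
    distance is at most \<open>2 * D\<close>, because the value at \<open>t0\<close> is subtracted.
    The operator then contracts by \<open>2 * C / \<kappa>\<close>, at most 1/2.\<close>
  define \<kappa> where "\<kappa> = 4 * C + 1"
  have \<kappa>: "\<kappa> > 0" using C unfolding \<kappa>_def by simp
  \<comment> \<open>Clamping time to \<open>{t0..t1}\<close> makes every iterate a bounded
    continuous function on the whole line, hence an element of a Banach space.\<close>
  define cl where "cl t = max t0 (min t1 t)" for t :: real
  have cl: "cl t \<in> {t0..t1}" for t unfolding cl_def using t01 by auto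
  have cl_id: "cl t = t" if "t \<in> {t0..t1}" for t unfolding cl_def using that by auto
  have cl_t0: "cl t = t0" if "t \<le> t0" for t unfolding cl_def using that t01 by auto
  have ccl: "continuous_on UNIV cl" unfolding cl_def by (intro continuous_intros)
  \<comment> \<open>Subtracting \<open>v t0\<close> makes \<open>Y v\<close> continue the history
    \<open>h\<close> continuously for every \<open>v\<close>, not only for the fixed point, where
    \<open>v t0\<close> turns out to be 0.\<close>
  define Y :: "(real \<Rightarrow>\<^sub>C 'a) \<Rightarrow> real \<Rightarrow> 'a" where
    "Y v t = h (min t t0) + exp (\<kappa> * (cl t - t0)) *\<^sub>R (v (cl t) - v t0)" for v t
  have cY: "continuous_on UNIV (Y v)" for v
    unfolding Y_def
    by (intro continuous_intros continuous_on_compose2[OF h] continuous_on_compose2[OF _ ccl]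
        continuous_on_apply_bcontfun ccl) auto
  have Yh: "Y v s = h s" if "s \<le> t0" for v s
    unfolding Y_def using that cl_t0[OF that] by simp
  have iY: "(\<lambda>s. F s (Y v)) integrable_on {t0..t1}" for v
    by (rule int[OF cY Yh])
  define R0 where "R0 v t = exp (- \<kappa> * (cl t - t0)) *\<^sub>R integral {t0..cl t} (\<lambda>s. F s (Y v))" for v t
  have cR0: "continuous_on UNIV (R0 v)" for v
    unfolding R0_def
    by (intro continuous_intros ccl continuous_on_compose2[OF indefinite_integral_continuous_1[OF
        iY] ccl])
      (use cl in auto)
  have "R0 v \<in> bcontfun" for v
  proof -
    have "bounded (R0 v ` {t0..t1})"
      by (intro compact_imp_bounded compact_continuous_image continuous_on_subset[OF cR0]) auto
    then obtain B where B: "\<And>t. t \<in> {t0..t1} \<Longrightarrow> norm (R0 v t) \<le> B" unfolding bounded_iff by blast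
    have "norm (R0 v t) \<le> B" for t
      using B[OF cl[of t]] cl_id[OF cl[of t]] unfolding R0_def by simp
    then show ?thesis by (rule bcontfun_normI[OF cR0])
  qed
  define R where "R v = Bcontfun (R0 v)" for v
  have R: "apply_bcontfun (R v) = R0 v" for v
    unfolding R_def by (rule Bcontfun_inverse) fact
  have contr: "dist (R v) (R v') \<le> 1/2 * dist v v'" for v v'
  proof (rule dist_bound)
    fix t
    define D where "D = dist v v'"
    have D: "D \<ge> 0" unfolding D_def by simp
    have bound: "norm (F s (Y v) - F s (Y v'))
        \<le> 2 * C * D * exp (\<kappa> * (s - t0))" if s: "s \<in> {t0..t1}" for s
    proof -
      have "norm (F s (Y v) - F s (Y v')) \<le> C * (exp (\<kappa> * (s - t0)) * (2 * D))"
      proof (rule Lip[OF cY Yh cY Yh s])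
        fix w assume w: "w \<in> {t0..s}"
        then have w': "cl w = w" using s by (intro cl_id) auto
        have "Y v w - Y v' w = exp (\<kappa> * (w - t0)) *\<^sub>R ((v w - v' w) - (v t0 - v' t0))"
          unfolding Y_def w' by (simp add: algebra_simps)
        also have "norm \<dots> = exp (\<kappa> * (w - t0)) * norm ((v w - v' w) - (v t0 - v' t0))" by simp
        also have "\<dots> \<le> exp (\<kappa> * (s - t0)) * (2 * D)"
        proof (rule mult_mono)
          have "norm ((v w - v' w) - (v t0 - v' t0)) \<le> norm (v w - v' w) + norm (v t0 - v' t0)"
            by (rule norm_triangle_ineq4)
          also have "\<dots> \<le> D + D"
            unfolding D_def using dist_bounded[of v w v'] dist_bounded[of v t0 v']
            by (intro add_mono) (auto simp: dist_norm)
          finally show "norm ((v w - v' w) - (v t0 - v' t0)) \<le> 2 * D" by simp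
        qed (use w \<kappa> in auto)
        finally show "norm (Y v w - Y v' w) \<le> exp (\<kappa> * (s - t0)) * (2 * D)" .
      qed
      then show ?thesis by (simp add: algebra_simps)
    qed
    define u where "u = cl t"
    have u: "u \<in> {t0..t1}" unfolding u_def by (rule cl)
    have sub: "(\<lambda>s. F s (Y v)) integrable_on {t0..u}" for v
      by (rule integrable_subinterval_real[OF iY]) (use u in auto)
    have "dist (R v t) (R v' t)
        = exp (- \<kappa> * (u - t0)) * norm (integral {t0..u} (\<lambda>s. F s (Y v) - F s (Y v')))"
      unfolding R R0_def dist_norm u_def[symmetric]
      by (simp add: integral_diff[OF sub sub] flip: scaleR_diff_right)
    also have "\<dots> \<le> exp (- \<kappa> * (u - t0)) * (2 * C * D * (exp (\<kappa> * (u - t0)) - 1) / \<kappa>)"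
      using exp_integral_bound[OF \<kappa>, of t0 u "2 * C * D"] u bound
      by (intro mult_left_mono order_trans[OF integral_norm_bound_integral[OF integrable_diff[OF
          sub sub]]])
        auto
    also have "\<dots> \<le> exp (- \<kappa> * (u - t0)) * (2 * C * D * exp (\<kappa> * (u - t0)) / \<kappa>)"
      using C D \<kappa> by (intro mult_left_mono divide_right_mono) auto
    also have "\<dots> = 2 * C * D / \<kappa>"
      by (simp add: exp_minus)
    also have "\<dots> \<le> 1/2 * D"
      using \<kappa> C D unfolding \<kappa>_def by (simp add: field_simps)
    finally show "dist (R v t) (R v' t) \<le> 1/2 * dist v v'" unfolding D_def .
  qed
  then obtain v where v: "R v = v"
    using banach_fix_type[of "1/2" R] by auto
  have vt0: "v t0 = 0"
  proof -
    have "v t0 = R0 v t0" by (subst v[symmetric]) (simp add: R)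
    also have "\<dots> = 0" unfolding R0_def using cl_t0[of t0] by simp
    finally show ?thesis .
  qed
  show ?thesis
  proof (intro exI[of _ "Y v"] conjI ballI allI impI cY Yh)
    fix t assume t: "t \<in> {t0..t1}"
    have "v t = R0 v t" by (subst v[symmetric]) (simp add: R)
    then show "Y v t = h t0 + integral {t0..t} (\<lambda>s. F s (Y v))"
      unfolding Y_def R0_def cl_id[OF t] vt0 using t
      by (simp add: exp_minus min_absorb2)
  qed
qed

text \<open>After \<open>t0\<close> the argument is projected onto a ball, which makes the equation
  globally Lipschitz. The radius is an a priori bound obtained from the linear growth, so the
  truncated solution stays inside the ball and solves the original equation. The assumptions omit
  \<open>t1\<close> because there the held input takes a new value.\<close>

lemma functional_ode_local:
  fixes F :: "real \<Rightarrow> (real \<Rightarrow> 'a::euclidean_space) \<Rightarrow> 'a"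
  assumes t01: "t0 \<le> t1" and h: "continuous_on UNIV h" and C: "C \<ge> 0"
    and int: "\<And>y. continuous_on UNIV y \<Longrightarrow> (\<And>s. s \<le> t0 \<Longrightarrow> y s = h s) \<Longrightarrow>
      (\<lambda>s. F s y) integrable_on {t0..t1}"
    and growth: "\<And>y s B. continuous_on UNIV y \<Longrightarrow> (\<And>s. s \<le> t0 \<Longrightarrow> y s = h s) \<Longrightarrow> s \<in> {t0..<t1} \<Longrightarrow>
      (\<And>v. v \<in> {t0..s} \<Longrightarrow> norm (y v) \<le> B) \<Longrightarrow> norm (F s y) \<le> C * (1 + B)"
    and Lip: "\<And>R. \<exists>D\<ge>0. \<forall>y y' s B. continuous_on UNIV y \<longrightarrow> (\<forall>s\<le>t0. y s = h s) \<longrightarrow>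
      continuous_on UNIV y' \<longrightarrow> (\<forall>s\<le>t0. y' s = h s) \<longrightarrow> s \<in> {t0..<t1} \<longrightarrow>
      (\<forall>v\<in>{t0..s}. norm (y v) \<le> R \<and> norm (y' v) \<le> R) \<longrightarrow>
      (\<forall>v\<in>{t0..s}. norm (y v - y' v) \<le> B) \<longrightarrow> norm (F s y - F s y') \<le> D * B"
  shows "\<exists>y. continuous_on UNIV y \<and> (\<forall>s\<le>t0. y s = h s) \<and>
    (\<forall>t\<in>{t0..t1}. y t = h t0 + integral {t0..t} (\<lambda>s. F s y))"
proof -
  define \<kappa> where "\<kappa> = 2 * C + 1"
  have \<kappa>: "\<kappa> > 0" using C unfolding \<kappa>_def by simp
  \<comment> \<open>The factor in front of the exponential is the bound for the weighted norm
    \<open>W\<close> established below.\<close>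
  define R where "R = 2 * (1 + norm (h t0)) * exp (\<kappa> * (t1 - t0))"
  have ex1: "exp (\<kappa> * (t1 - t0)) \<ge> 1" using \<kappa> t01 by auto
  have "norm (h t0) \<le> 2 * (1 + norm (h t0)) * 1" by simp
  also have "\<dots> \<le> R" unfolding R_def by (rule mult_left_mono[OF ex1]) simp
  finally have hR: "norm (h t0) \<le> R" .
  then have R0: "R \<ge> 0" using norm_ge_zero order_trans by blast
  define cp :: "'a \<Rightarrow> 'a" where "cp = closest_point (cball 0 R)"
  have cp_id: "cp x = x" if "norm x \<le> R" for x
    unfolding cp_def by (rule closest_point_self) (use that in auto)
  have cp_le: "norm (cp x) \<le> R" for x
    using closest_point_in_set[of "cball 0 R" x] R0 unfolding cp_def by auto
  have cp_Lip: "norm (cp x - cp y) \<le> norm (x - y)" for x y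
    using closest_point_lipschitz[of "cball 0 R" x y] R0 unfolding cp_def dist_norm by auto
  have cp_norm: "norm (cp x) \<le> norm x" for x
    using cp_Lip[of x 0] cp_id[of 0] R0 by simp
  have ccp: "continuous_on UNIV cp"
    unfolding cp_def by (rule continuous_on_closest_point) (use R0 in auto)
  define tr where "tr y t = (if t \<le> t0 then h t else cp (y t))" for y t
  have ctr: "continuous_on UNIV (tr y)" if y: "continuous_on UNIV y" "\<And>s. s \<le> t0 \<Longrightarrow> y s = h s" for y
  proof -
    have "tr y = (\<lambda>t. h (min t t0) + cp (y (max t t0)) - cp (h t0))"
      unfolding tr_def using y(2) by (auto simp: fun_eq_iff min_def max_def cp_id[OF hR])
    moreover have "continuous_on UNIV \<dots>"
      by (intro continuous_intros continuous_on_compose2[OF h] continuous_on_compose2[OF ccp]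
          continuous_on_compose2[OF y(1)]) auto
    ultimately show ?thesis by simp
  qed
  have trh: "tr y s = h s" if "s \<le> t0" for y s unfolding tr_def using that by simp
  have trR: "norm (tr y s) \<le> R" if "s \<ge> t0" for y s
    using that hR cp_le unfolding tr_def by auto
  obtain D where D: "D \<ge> 0" and DLip: "\<And>y y' s B. continuous_on UNIV y \<Longrightarrow> (\<And>s. s \<le> t0 \<Longrightarrow> y s = h s) \<Longrightarrow>
      continuous_on UNIV y' \<Longrightarrow> (\<And>s. s \<le> t0 \<Longrightarrow> y' s = h s) \<Longrightarrow> s \<in> {t0..<t1} \<Longrightarrow>
      (\<And>v. v \<in> {t0..s} \<Longrightarrow> norm (y v) \<le> R \<and> norm (y' v) \<le> R) \<Longrightarrow>
      (\<And>v. v \<in> {t0..s} \<Longrightarrow> norm (y v - y' v) \<le> B) \<Longrightarrow> norm (F s y - F s y') \<le> D * B"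
    using Lip[of R] by (elim exE conjE) (metis (full_types))
  \<comment> \<open>The Lipschitz theorem requires bounds on the closed interval; the default 0
    provides them at \<open>t1\<close> without changing any integral.\<close>
  define G where "G s y = (if s < t1 then F s (tr y) else 0)" for s y
  have Gint: "(\<lambda>s. G s y) integrable_on {t0..t1}"
    if y: "continuous_on UNIV y" "\<And>s. s \<le> t0 \<Longrightarrow> y s = h s" for y
    by (rule integrable_spike[OF int[OF ctr[OF y] trh], where S = "{t1}"]) (auto simp: G_def)
  have GLip: "norm (G s y - G s y') \<le> D * B"
    if y: "continuous_on UNIV y" "\<And>s. s \<le> t0 \<Longrightarrow> y s = h s"
      and y': "continuous_on UNIV y'" "\<And>s. s \<le> t0 \<Longrightarrow> y' s = h s" and s: "s \<in> {t0..t1}"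
      and B: "\<And>v. v \<in> {t0..s} \<Longrightarrow> norm (y v - y' v) \<le> B" for y y' s B
  proof (cases "s < t1")
    case True
    have B0: "B \<ge> 0" using B[of s] s order_trans[OF norm_ge_zero] by auto
    have "norm (F s (tr y) - F s (tr y')) \<le> D * B"
    proof (rule DLip[OF ctr[OF y] trh ctr[OF y'] trh])
      fix v assume v: "v \<in> {t0..s}"
      show "norm (tr y v) \<le> R \<and> norm (tr y' v) \<le> R" using trR v by auto
      show "norm (tr y v - tr y' v) \<le> B"
        unfolding tr_def using order_trans[OF cp_Lip B[OF v]] B0 by auto
    qed (use s True in auto)
    then show ?thesis unfolding G_def using True by simp
  next
    case False
    have "B \<ge> 0" using B[of s] s order_trans[OF norm_ge_zero] by auto
    then show ?thesis unfolding G_def using False D by simp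
  qed
  have "\<exists>y. continuous_on UNIV y \<and> (\<forall>s\<le>t0. y s = h s) \<and>
    (\<forall>t\<in>{t0..t1}. y t = h t0 + integral {t0..t} (\<lambda>s. G s y))"
    by (rule functional_ode_Lipschitz[OF t01 h D]) (fact Gint, fact GLip)
  then obtain y where y: "continuous_on UNIV y" "\<And>s. s \<le> t0 \<Longrightarrow> y s = h s"
      "\<And>t. t \<in> {t0..t1} \<Longrightarrow> y t = h t0 + integral {t0..t} (\<lambda>s. G s y)"
    by blast
  \<comment> \<open>At the maximum of this weighted norm the integral term is at most half of
    \<open>1 + norm (y m)\<close>, because \<open>C / \<kappa> \<le> 1/2\<close>, and is absorbed by
    the left side.\<close>
  define W where "W t = exp (- \<kappa> * (t - t0)) * (1 + norm (y t))" for t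
  have cW: "continuous_on {t0..t1} W"
    unfolding W_def by (intro continuous_intros continuous_on_subset[OF y(1)]) auto
  obtain m where m: "m \<in> {t0..t1}" "\<And>t. t \<in> {t0..t1} \<Longrightarrow> W t \<le> W m"
    using continuous_attains_sup[OF compact_Icc _ cW] t01 by auto
  have Wy: "1 + norm (y t) = W t * exp (\<kappa> * (t - t0))" for t
    unfolding W_def by (simp add: exp_minus)
  have W0: "W m \<ge> 0" unfolding W_def by simp
  have Gb: "norm (G s y) \<le> C * W m * exp (\<kappa> * (s - t0))" if s: "s \<in> {t0..t1}" for s
  proof (cases "s < t1")
    case True
    have "norm (F s (tr y)) \<le> C * (1 + (W m * exp (\<kappa> * (s - t0)) - 1))"
    proof (rule growth[OF ctr[OF y(1,2)] trh])
      fix v assume v: "v \<in> {t0..s}"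
      have "norm (tr y v) \<le> norm (y v)"
        unfolding tr_def using cp_norm y(2) by auto
      moreover have "W v * exp (\<kappa> * (v - t0)) \<le> W m * exp (\<kappa> * (s - t0))"
        using m(2)[of v] v s \<kappa> W0 by (intro mult_mono) auto
      ultimately show "norm (tr y v) \<le> W m * exp (\<kappa> * (s - t0)) - 1"
        using Wy[of v] by linarith
    qed (use s True in auto)
    then show ?thesis unfolding G_def using True by simp
  next
    case False
    then show ?thesis unfolding G_def using C W0 by simp
  qed
  have "W m \<le> 2 * (1 + norm (h t0))"
  proof -
    have "norm (integral {t0..m} (\<lambda>s. G s y)) \<le> C * W m * (exp (\<kappa> * (m - t0)) - 1) / \<kappa>"
      using exp_integral_bound[OF \<kappa>, of t0 m "C * W m"] m(1) Gb
        integrable_subinterval_real[OF Gint[OF y(1,2)], of t0 m]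
      by (intro order_trans[OF integral_norm_bound_integral]) auto
    also have "\<dots> \<le> C * W m * exp (\<kappa> * (m - t0)) / \<kappa>"
      using C W0 \<kappa> by (intro divide_right_mono mult_left_mono) auto
    also have "\<dots> \<le> W m * exp (\<kappa> * (m - t0)) / 2"
      using W0 C \<kappa> unfolding \<kappa>_def by (simp add: field_simps)
    finally have "norm (integral {t0..m} (\<lambda>s. G s y)) \<le> W m * exp (\<kappa> * (m - t0)) / 2" .
    then have "1 + norm (y m) \<le> (1 + norm (h t0)) + W m * exp (\<kappa> * (m - t0)) / 2"
      using arg_cong[OF y(3)[OF m(1)], of norm]
        norm_triangle_ineq[of "h t0" "integral {t0..m} (\<lambda>s. G s y)"] by linarith
    moreover have "X \<le> 2 * c" if "X \<le> c + X / 2" for X c :: real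
      using that by linarith
    ultimately have "W m * exp (\<kappa> * (m - t0)) \<le> 2 * (1 + norm (h t0))"
      unfolding Wy by blast
    moreover have "W m * 1 \<le> W m * exp (\<kappa> * (m - t0))"
      using W0 m(1) \<kappa> by (intro mult_left_mono) auto
    ultimately show ?thesis by linarith
  qed
  then have yR: "norm (y t) \<le> R" if t: "t \<in> {t0..t1}" for t
  proof -
    have "W t * exp (\<kappa> * (t - t0)) \<le> (2 * (1 + norm (h t0))) * exp (\<kappa> * (t1 - t0))"
      using m(2)[OF t] \<open>W m \<le> _\<close> t \<kappa> by (intro mult_mono) auto
    then show ?thesis using Wy[of t] unfolding R_def by linarith
  qed
  have eq: "G s y = F s y" if s: "s \<in> {t0..<t1}" for s
  proof -
    have tr_y: "tr y v = y v" if "v \<in> {t0..s}" for v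
      using that s yR[of v] cp_id[of "y v"] y(2)[of v] unfolding tr_def by auto
    \<comment> \<open>\<open>tr y\<close> and \<open>y\<close> are compared only up to time
      \<open>s\<close>. The Lipschitz bound with distance 0 there expresses that \<open>F s\<close>
      does not see later values.\<close>
    have "norm (F s (tr y) - F s y) \<le> D * 0"
    proof (rule DLip[OF ctr[OF y(1,2)] trh y(1,2) s])
      fix v assume v: "v \<in> {t0..s}"
      show "norm (tr y v) \<le> R \<and> norm (y v) \<le> R" using yR[of v] v s tr_y[OF v] by auto
      show "norm (tr y v - y v) \<le> 0" using tr_y[OF v] by simp
    qed
    then show ?thesis unfolding G_def using s by simp
  qed
  show ?thesis
  proof (intro exI[of _ y] conjI ballI allI impI y(1,2))
    fix t assume t: "t \<in> {t0..t1}"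
    have "integral {t0..t} (\<lambda>s. F s y) = integral {t0..t} (\<lambda>s. G s y)"
      by (rule integral_spike[of "{t1}"]) (use eq t in auto)
    then show "y t = h t0 + integral {t0..t} (\<lambda>s. F s y)" using y(3)[OF t] by simp
  qed
qed

text \<open>Method of steps with stages of length \<open>S\<close>. The growth and Lipschitz
  constants may depend on the stage and on the history \<open>h\<close> before it, which is what a
  feedback held constant over each stage requires. Causality shows that extending the solution does
  not disturb the equation already solved.\<close>

lemma functional_ode_global:
  fixes F :: "real \<Rightarrow> (real \<Rightarrow> 'a::euclidean_space) \<Rightarrow> 'a"
  assumes S: "S > 0"
    and causal: "\<And>y y' s. s \<ge> 0 \<Longrightarrow> (\<And>v. v \<in> {0..s} \<Longrightarrow> y v = y' v) \<Longrightarrow> F s y = F s y'"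
    and int: "\<And>y t. continuous_on UNIV y \<Longrightarrow> (\<lambda>s. F s y) absolutely_integrable_on {0..t}"
    and growth: "\<And>h i. continuous_on UNIV h \<Longrightarrow> \<exists>C\<ge>0. \<forall>y s B. continuous_on UNIV y \<longrightarrow>
      (\<forall>s\<le>real i * S. y s = h s) \<longrightarrow> s \<in> {real i * S..<real (Suc i) * S} \<longrightarrow>
      (\<forall>v\<in>{real i * S..s}. norm (y v) \<le> B) \<longrightarrow> norm (F s y) \<le> C * (1 + B)"
    and Lip: "\<And>h i R. continuous_on UNIV h \<Longrightarrow> \<exists>D\<ge>0. \<forall>y y' s B. continuous_on UNIV y \<longrightarrow>
      (\<forall>s\<le>real i * S. y s = h s) \<longrightarrow> continuous_on UNIV y' \<longrightarrow> (\<forall>s\<le>real i * S. y' s = h s) \<longrightarrow>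
      s \<in> {real i * S..<real (Suc i) * S} \<longrightarrow>
      (\<forall>v\<in>{real i * S..s}. norm (y v) \<le> R \<and> norm (y' v) \<le> R) \<longrightarrow>
      (\<forall>v\<in>{real i * S..s}. norm (y v - y' v) \<le> B) \<longrightarrow> norm (F s y - F s y') \<le> D * B"
  obtains y where "continuous_on UNIV y" "y 0 = y0" "ac_derivative_on {0..} y (\<lambda>s. F s y)"
proof -
  define P where "P i y \<longleftrightarrow> continuous_on UNIV y \<and> y 0 = y0 \<and>
      (\<forall>t\<in>{0..real i * S}. y t = y0 + integral {0..t} (\<lambda>s. F s y))" for i y
  have int': "(\<lambda>s. F s y) integrable_on {a..t}" if "continuous_on UNIV y" "a \<ge> 0" for y a t
  proof -
    have "(\<lambda>s. F s y) integrable_on {0..t}"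
      using set_lebesgue_integral_eq_integral(1)[OF int[OF that(1)]] .
    then show ?thesis
      by (cases "a \<le> t") (use that in \<open>auto intro: integrable_subinterval_real\<close>)
  qed
  \<comment> \<open>Dependent choice keeps each stage equal to its predecessor on the past, so that
    the stages can be glued.\<close>
  have "\<exists>Y. \<forall>i. P i (Y i) \<and> (\<forall>s\<le>real i * S. Y (Suc i) s = Y i s)"
  proof (rule dependent_nat_choice)
    show "\<exists>y. P 0 y" unfolding P_def by (intro exI[of _ "\<lambda>_. y0"]) auto
    fix h i assume h: "P i h"
    define t0 where "t0 = real i * S"
    define t1 where "t1 = real (Suc i) * S"
    have t01: "t0 \<le> t1" "0 \<le> t0" unfolding t0_def t1_def using S by (auto simp: mult_right_mono)
    have ch: "continuous_on UNIV h" using h unfolding P_def by simp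
    obtain C where C: "C \<ge> 0" "\<And>y s B. continuous_on UNIV y \<Longrightarrow>
      (\<And>s. s \<le> t0 \<Longrightarrow> y s = h s) \<Longrightarrow> s \<in> {t0..<t1} \<Longrightarrow>
      (\<And>v. v \<in> {t0..s} \<Longrightarrow> norm (y v) \<le> B) \<Longrightarrow> norm (F s y) \<le> C * (1 + B)"
      using growth[OF ch, of i] unfolding t0_def t1_def by (elim exE conjE) (metis (full_types))
    have "\<exists>y. continuous_on UNIV y \<and> (\<forall>s\<le>t0. y s = h s) \<and>
      (\<forall>t\<in>{t0..t1}. y t = h t0 + integral {t0..t} (\<lambda>s. F s y))"
      by (rule functional_ode_local[OF t01(1) ch C(1)])
        (erule int'[OF _ t01(2)], fact C(2), fact Lip[OF ch, of i, folded t0_def t1_def])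
    then obtain y where y: "continuous_on UNIV y" "\<And>s. s \<le> t0 \<Longrightarrow> y s = h s"
      "\<And>t. t \<in> {t0..t1} \<Longrightarrow> y t = h t0 + integral {t0..t} (\<lambda>s. F s y)"
      by blast
    have old: "y t = y0 + integral {0..t} (\<lambda>s. F s y)" if t: "t \<in> {0..t0}" for t
    proof -
      have "y t = y0 + integral {0..t} (\<lambda>s. F s h)"
        using h t y(2)[of t] unfolding P_def t0_def by auto
      also have "integral {0..t} (\<lambda>s. F s h) = integral {0..t} (\<lambda>s. F s y)"
        by (rule integral_cong) (use y(2) t in \<open>auto intro!: causal\<close>)
      finally show ?thesis .
    qed
    have "y t = y0 + integral {0..t} (\<lambda>s. F s y)" if t: "t \<in> {t0..t1}" for t
    proof -
      have "integral {0..t0} (\<lambda>s. F s y) + integral {t0..t} (\<lambda>s. F s y)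
          = integral {0..t} (\<lambda>s. F s y)"
        by (rule Henstock_Kurzweil_Integration.integral_combine) (use t t01 int'[OF y(1)] in auto)
      then show ?thesis using y(3)[OF t] old[of t0] y(2)[of t0] t01 by simp
    qed
    then have "\<forall>t\<in>{0..t1}. y t = y0 + integral {0..t} (\<lambda>s. F s y)"
      using old by (metis atLeastAtMost_iff linear)
    moreover have "y 0 = y0" using y(2)[of 0] t01 h unfolding P_def by auto
    ultimately show "\<exists>y. P (Suc i) y \<and> (\<forall>s\<le>real i * S. y s = h s)"
      using y(1,2) unfolding P_def t0_def t1_def by blast
  qed
  then obtain Y where Y: "\<And>i. P i (Y i)" "\<And>i s. s \<le> real i * S \<Longrightarrow> Y (Suc i) s = Y i s"
    by blast
  have Yle: "Y j s = Y i s" if "i \<le> j" "s \<le> real i * S" for i j s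
    using that
  proof (induction j rule: dec_induct)
    case (step n)
    have "real i * S \<le> real n * S" using step S by (intro mult_right_mono) auto
    then show ?case using step Y(2)[of s n] by simp
  qed simp
  define N where "N t = nat \<lceil>t / S\<rceil>" for t
  have N: "t \<le> real (N t) * S" for t
  proof -
    have "t / S \<le> real (N t)" unfolding N_def by linarith
    then show ?thesis using S by (simp add: field_simps)
  qed
  define y where "y t = Y (N t) t" for t
  have yY: "y t = Y i t" if "t \<le> real i * S" for i t
    unfolding y_def using Yle[of i "N t" t] Yle[of "N t" i t] N that by (cases "i \<le> N t") auto
  have cy: "continuous_on UNIV y"
  proof (rule continuous_at_imp_continuous_on, intro ballI)
    fix t :: real
    define i where "i = N (t + 1)"
    have "eventually (\<lambda>s. s \<in> {..<t+1}) (nhds t)" by (rule eventually_nhds_in_open) auto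
    then have "eventually (\<lambda>s. y s = Y i s) (nhds t)"
      by (rule eventually_mono) (use N[of "t+1"] in \<open>auto intro!: yY simp: i_def\<close>)
    moreover have "isCont (Y i) t"
      using Y(1)[of i] unfolding P_def by (auto simp: continuous_on_eq_continuous_at)
    ultimately show "isCont y t" by (simp add: isCont_cong)
  qed
  have eq: "y t = y0 + integral {0..t} (\<lambda>s. F s y)" if "t \<ge> 0" for t
  proof -
    have "y t = y0 + integral {0..t} (\<lambda>s. F s (Y (N t)))"
      using Y(1)[of "N t"] that N[of t] unfolding y_def P_def by simp
    also have "integral {0..t} (\<lambda>s. F s (Y (N t))) = integral {0..t} (\<lambda>s. F s y)"
    proof (rule integral_cong)
      fix s assume "s \<in> {0..t}"
      then show "F s (Y (N t)) = F s y"
        using N[of t] by (intro causal) (auto intro!: yY[symmetric])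
    qed
    finally show ?thesis .
  qed
  have "ac_derivative_on {0..} y (\<lambda>s. F s y)"
    unfolding ac_derivative_on_def
  proof (intro ballI impI conjI)
    fix s t :: real assume st: "s \<in> {0..}" "t \<in> {0..}" "s \<le> t"
    show "(\<lambda>s. F s y) absolutely_integrable_on {s..t}"
      using absolutely_integrable_on_subinterval[OF int[OF cy, of t], of s t] st by auto
    have "integral {0..s} (\<lambda>s. F s y) + integral {s..t} (\<lambda>s. F s y) = integral {0..t} (\<lambda>s. F s y)"
      by (rule Henstock_Kurzweil_Integration.integral_combine) (use st int'[OF cy] in auto)
    then show "y t = y s + integral {s..t} (\<lambda>s. F s y)"
      using eq[of s] eq[of t] st by simp
  qed
  then show thesis using that[OF cy] eq[of 0] by simp
qed

section \<open>Coordinates\<close>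

lemma idx_strict_mono: "i < j \<Longrightarrow> idx i < idx (j :: 'n::{finite,linorder})"
  unfolding idx_def by (intro psubset_card_mono) auto

lemma idx_mono: "i \<le> j \<Longrightarrow> idx i \<le> idx (j :: 'n::{finite,linorder})"
  using idx_strict_mono by (metis le_less)

lemma idx_inject: "idx i = idx j \<longleftrightarrow> i = (j :: 'n::{finite,linorder})"
  by (metis idx_strict_mono less_irrefl linorder_neqE)

lemma idx_Min: "idx (Min UNIV :: 'n::{finite,linorder}) = 1"
proof -
  have "{..Min UNIV} = {Min UNIV :: 'n}"
    by (auto intro: antisym)
  then show ?thesis unfolding idx_def by simp
qed

text \<open>\<open>chain\<close> shifts coordinates by one. The second case is the last coordinate,
  which has no successor index.\<close>

lemma chain_nth:
  fixes x :: "('n::{finite,linorder}) rvec"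
  shows "(\<exists>j. idx j = idx i + 1 \<and> (chain *v x) $ i = x $ j) \<or> (chain *v x) $ i = 0"
proof (cases "\<exists>j :: 'n. idx j = idx i + 1")
  case True
  then obtain j :: 'n where j: "idx j = idx i + 1" by blast
  have "(chain *v x) $ i = (\<Sum>l\<in>UNIV. if l = j then x $ l else 0)"
    unfolding chain_def matrix_vector_mult_def using j idx_inject[of _ j]
    by (auto simp: if_distrib[of "\<lambda>c. c * _"] cong: if_cong)
  then show ?thesis using j by auto
next
  case False
  then show ?thesis unfolding chain_def matrix_vector_mult_def by (auto intro!: sum.neutral)
qed

lemma norm_vec_square: "(norm (x :: real ^ 'm))\<^sup>2 = (\<Sum>i\<in>UNIV. (x $ i)\<^sup>2)"
  unfolding norm_vec_def L2_set_def by (simp add: sum_nonneg)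

text \<open>The nonzero coordinates of the shifted vector are distinct coordinates of
  \<open>x\<close>, since \<open>idx\<close> is injective, so the sum of squares can only
  shrink.\<close>

lemma norm_chain: "norm (chain *v x) \<le> norm (x :: ('n::{finite,linorder}) rvec)"
proof -
  define I where "I = {i. \<exists>j :: 'n. idx j = idx (i :: 'n) + 1}"
  define nx where "nx i = (SOME j :: 'n. idx j = idx (i :: 'n) + 1)" for i
  have nx: "idx (nx i) = idx i + 1" if "i \<in> I" for i
    unfolding nx_def by (rule someI_ex) (use that in \<open>auto simp: I_def\<close>)
  have inj: "inj_on nx I"
  proof (rule inj_onI)
    fix i j assume "i \<in> I" "j \<in> I" "nx i = nx j"
    then show "i = j" using nx[of i] nx[of j] idx_inject[of i j] by simp
  qed
  have "(norm (chain *v x))\<^sup>2 = (\<Sum>i\<in>I. ((chain *v x) $ i)\<^sup>2)"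
    unfolding norm_vec_square
  proof (rule sum.mono_neutral_right)
    show "\<forall>i\<in>UNIV - I. ((chain *v x) $ i)\<^sup>2 = 0"
      using chain_nth[of _ x] by (auto simp: I_def)
  qed auto
  also have "\<dots> \<le> (\<Sum>i\<in>I. (x $ nx i)\<^sup>2)"
  proof (rule sum_mono)
    fix i assume i: "i \<in> I"
    show "((chain *v x) $ i)\<^sup>2 \<le> (x $ nx i)\<^sup>2"
      using chain_nth[of i x] nx[OF i] idx_inject[of _ "nx i"] by auto
  qed
  also have "\<dots> = (\<Sum>j\<in>nx ` I. (x $ j)\<^sup>2)" by (simp add: sum.reindex[OF inj])
  also have "\<dots> \<le> (norm x)\<^sup>2" unfolding norm_vec_square by (rule sum_mono2) auto
  finally show ?thesis by (rule power2_le_imp_le) simp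
qed

lemma norm_vec_le_sqrt_card:
  fixes x :: "real ^ 'm"
  assumes "\<And>i. \<bar>x $ i\<bar> \<le> c"
  shows "norm x \<le> sqrt (real CARD('m)) * c"
proof -
  have c: "c \<ge> 0" using assms[of undefined] by linarith
  have "(norm x)\<^sup>2 \<le> (\<Sum>i\<in>(UNIV::'m set). c\<^sup>2)"
    unfolding norm_vec_square using assms c
    by (intro sum_mono) (metis abs_le_square_iff abs_of_nonneg)
  also have "\<dots> = (sqrt (real CARD('m)) * c)\<^sup>2" by (simp add: power_mult_distrib)
  finally show ?thesis by (rule power2_le_imp_le) (use c in simp)
qed

lemma norm_head_le: "norm (head i x) \<le> norm x"
  by (rule norm_le_componentwise_cart) (simp add: head_def)

lemma head_diff: "head i x - head i y = head i (x - y)"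
  by (simp add: head_def vec_eq_iff)

lemma diag_mult_nth: "(diag v *v d) $ i = v $ i * d $ i"
  unfolding diag_def matrix_vector_mult_def by (simp add: if_distrib[of "\<lambda>x. x * _"] cong: if_cong)

lemma norm_diag_mult:
  assumes "\<And>i. \<bar>v $ i\<bar> \<le> G"
  shows "norm (diag v *v d) \<le> G * norm d"
proof -
  have G: "G \<ge> 0" using assms[of undefined] by linarith
  have "norm (diag v *v d) \<le> norm (G *\<^sub>R d)"
    by (rule norm_le_componentwise_cart)
      (use assms G in \<open>auto simp: diag_mult_nth abs_mult intro!: mult_right_mono\<close>)
  then show ?thesis using G by simp
qed

lemma norm_last_unit [simp]: "norm last_unit = 1"
  unfolding last_unit_def by (simp add: norm_axis_1)

lemma norm_first_unit [simp]: "norm first_unit = 1"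
  unfolding first_unit_def by (simp add: norm_axis_1)

lemma first_unit_inner: "first_unit \<bullet> x = x $ Min UNIV"
  unfolding first_unit_def by (simp add: inner_commute inner_axis)

lemma abs_first_unit_inner_le: "\<bar>first_unit \<bullet> x\<bar> \<le> norm x"
  using Cauchy_Schwarz_ineq2[of first_unit x] by simp

section \<open>The drift\<close>

locale triangular_drift =
  fixes f :: "'n::{finite,linorder} \<Rightarrow> 'n rvec \<Rightarrow> real" and L :: real and n :: nat
  assumes n: "n = CARD('n)"
    and f_zero: "\<And>i. f i 0 = 0"
    and L: "L \<ge> 0"
    and f_Lipschitz: "\<And>i x z.
          \<bar>f i (head i x) - f i (head i z)\<bar> \<le> L * norm (head i x - head i z)"
begin

abbreviation "L\<^sub>F \<equiv> real n * L + 1"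

definition drift :: "'n rvec \<Rightarrow> 'n rvec" where
  "drift x = fvec f x + chain *v x"

lemma Lambda_ge_1: "L\<^sub>F \<ge> 1" using L by simp

lemma Lambda_nonneg: "L\<^sub>F \<ge> 0" using Lambda_ge_1 by linarith

text \<open>The n components of the nonlinearity contribute sqrt n L, enlarged to n L, and the shift
  contributes 1. This identifies \<open>L\<^sub>F\<close> with the constant in the contraction
  condition of the predictor.\<close>

lemma drift_Lipschitz: "norm (drift x - drift y) \<le> L\<^sub>F * norm (x - y)"
proof -
  have "norm (fvec f x - fvec f y) \<le> sqrt (real n) * (L * norm (x - y))"
    unfolding n
  proof (rule norm_vec_le_sqrt_card)
    fix i
    have "\<bar>f i (head i x) - f i (head i y)\<bar> \<le> L * norm (head i x - head i y)"
      by (rule f_Lipschitz)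
    also have "\<dots> \<le> L * norm (x - y)"
      unfolding head_diff by (intro mult_left_mono norm_head_le L)
    finally show "\<bar>(fvec f x - fvec f y) $ i\<bar> \<le> L * norm (x - y)" by (simp add: fvec_def)
  qed
  also have "\<dots> \<le> real n * (L * norm (x - y))"
  proof (intro mult_right_mono)
    have "1 \<le> real n" unfolding n by (simp add: Suc_leI)
    then show "sqrt (real n) \<le> real n"
      by (intro real_le_lsqrt) (auto simp: power2_eq_square)
  qed (use L in auto)
  finally have "norm (fvec f x - fvec f y) \<le> real n * (L * norm (x - y))" .
  moreover have "norm (chain *v x - chain *v y) \<le> norm (x - y)"
    using norm_chain[of "x - y"] by (simp add: matrix_vector_mult_diff_distrib)
  moreover have "drift x - drift y = (fvec f x - fvec f y) + (chain *v x - chain *v y)"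
    unfolding drift_def by simp
  ultimately show ?thesis
    using norm_triangle_ineq[of "fvec f x - fvec f y" "chain *v x - chain *v y"]
    by (simp only:) (simp add: distrib_right mult.assoc)
qed

lemma drift_zero [simp]: "drift 0 = 0"
proof -
  have head: "head i 0 = (0 :: 'n rvec)" for i by (simp add: head_def vec_eq_iff)
  have "fvec f 0 = 0" unfolding fvec_def head f_zero by (simp add: vec_eq_iff)
  then show ?thesis unfolding drift_def by simp
qed

lemma norm_drift: "norm (drift x) \<le> L\<^sub>F * norm x"
  using drift_Lipschitz[of x 0] by simp

lemma continuous_on_drift: "continuous_on S y \<Longrightarrow> continuous_on S (\<lambda>t. drift (y t))"
proof -
  have "L\<^sub>F-lipschitz_on UNIV drift"
    by (rule lipschitz_onI) (use drift_Lipschitz Lambda_nonneg in \<open>auto simp: dist_norm\<close>)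
  then show "continuous_on S y \<Longrightarrow> continuous_on S (\<lambda>t. drift (y t))"
    by (intro continuous_on_compose2[OF lipschitz_on_continuous_on[of _ UNIV drift]]) auto
qed

end

section \<open>The predictor\<close>

text \<open>An integral ignores the input at the single point \<open>S\<close>. Hence the prediction
  depends only on the past input on a half-open window and not on the value about to be
  chosen.\<close>

lemma picard_cong:
  assumes u: "\<And>s. s \<in> {0..<S} \<Longrightarrow> u s = u' s" and y: "\<And>s. s \<in> {0..S} \<Longrightarrow> y s = y' s"
    and t: "t \<in> {0..S}"
  shows "picard f u y t = picard f u' y' t"
proof -
  have "integral {0..t} (\<lambda>s. fvec f (y s) + chain *v y s + u s *\<^sub>R last_unit)
      = integral {0..t} (\<lambda>s. fvec f (y' s) + chain *v y' s + u' s *\<^sub>R last_unit)"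
    by (rule integral_spike[of "{S}"]) (use u y t in auto)
  then show ?thesis unfolding picard_def using y[of 0] t by simp
qed

lemma Q_pred_cong:
  assumes "S \<ge> 0" "\<And>s. s \<in> {0..<S} \<Longrightarrow> u s = u' s"
  shows "Q_pred f l S u x = Q_pred f l S u' x"
proof -
  have "\<forall>t\<in>{0..S}. (picard f u ^^ l) (\<lambda>_. x) t = (picard f u' ^^ l) (\<lambda>_. x) t"
  proof (induction l)
    case (Suc l)
    then show ?case by (simp, intro ballI picard_cong assms(2)) auto
  qed simp
  then show ?thesis unfolding Q_pred_def using assms(1) by auto
qed

lemma P_pred_cong:
  assumes h: "h \<ge> 0" and m: "m \<ge> 1" and u: "\<And>s. s \<in> {0..<h} \<Longrightarrow> u s = u' s"
  shows "P_pred f l m h u x = P_pred f l m h u' x"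
proof -
  define T where "T = h / real m"
  have T: "T \<ge> 0" "real m * T = h" unfolding T_def using h m by auto
  have "Q_pred f l T (\<lambda>s. u (s + (real i - 1) * T)) y
      = Q_pred f l T (\<lambda>s. u' (s + (real i - 1) * T)) y"
    if i: "i \<in> set [1..<Suc m]" for i y
  proof (rule Q_pred_cong[OF T(1)])
    fix s assume s: "s \<in> {0..<T}"
    have i': "1 \<le> real i" "real i \<le> real m" using i by auto
    have "0 \<le> (real i - 1) * T" using i' T by simp
    moreover have "(real i - 1) * T + T \<le> real m * T"
      using mult_right_mono[OF i'(2) T(1)] by (simp add: algebra_simps)
    ultimately have "s + (real i - 1) * T \<in> {0..<h}" using s T by auto
    then show "u (s + (real i - 1) * T) = u' (s + (real i - 1) * T)" by (rule u)
  qed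
  then show ?thesis
    unfolding P_pred_def Let_def T_def[symmetric] by (intro fold_cong) auto
qed

lemma Phi_pred_cong:
  assumes "h \<ge> 0" "m \<ge> 1" "\<And>s. s \<in> {-h..<0} \<Longrightarrow> u s = u' s"
  shows "Phi_pred f l m h x u = Phi_pred f l m h x u'"
  unfolding Phi_pred_def using assms by (intro P_pred_cong) auto

lemma L_inf_Ico:
  fixes u :: "real \<Rightarrow> 'a::euclidean_space"
  assumes "u absolutely_integrable_on {a..b}" "\<And>s. s \<in> {a..<b} \<Longrightarrow> norm (u s) \<le> B"
  shows "L_inf {a..<b} u"
proof -
  have "u absolutely_integrable_on {a..<b}"
    by (rule absolutely_integrable_spike_set[OF assms(1)])
      (auto intro: negligible_subset[of "{b}"])
  then show ?thesis
    unfolding L_inf_def bounded_iff using assms(2) absolutely_integrable_measurable[of "{a..<b}" u]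
    by (auto intro!: exI[of _ B])
qed

lemma sup_on_le:
  assumes "I \<noteq> {}" "\<And>s. s \<in> I \<Longrightarrow> norm (h s) \<le> B"
  shows "sup_on I h \<le> B"
  unfolding sup_on_def using assms by (intro cSUP_least) auto

lemma norm_le_sup_on:
  assumes "s \<in> I" "bounded (h ` I)"
  shows "norm (h s) \<le> sup_on I h"
proof -
  have "bdd_above ((\<lambda>s. norm (h s)) ` I)"
    using assms(2) unfolding bounded_iff bdd_above_def by auto
  then show ?thesis unfolding sup_on_def by (rule cSUP_upper[OF assms(1)])
qed

section \<open>Prediction error along a disturbed trajectory\<close>

context triangular_drift
begin

text \<open>The accuracy constant compares the prediction with any nominal solution, so it gives a
  bound only once such a solution is exhibited.\<close>

lemma nominal_solution_exists:
  assumes h: "h \<ge> 0" and u: "u absolutely_integrable_on {0..h}"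
  shows "\<exists>\<phi>. nominal_solution f h u x \<phi>"
proof -
  define F where "F s y = drift (y s) + u s *\<^sub>R last_unit" for s y
  have ui: "(\<lambda>s. u s *\<^sub>R last_unit :: 'n rvec) absolutely_integrable_on {0..h}"
    using absolutely_integrable_linear[OF u bounded_linear_scaleR_left[of last_unit]]
    by (simp add: o_def)
  have Fint: "(\<lambda>s. F s y) absolutely_integrable_on {0..h}" if y: "continuous_on {0..h} y" for y
    unfolding F_def
    by (intro set_integral_add(1) ui absolutely_integrable_continuous_real continuous_on_drift y)
  have "\<exists>y. continuous_on UNIV y \<and> (\<forall>s\<le>0. y s = (\<lambda>_. x) s) \<and>
      (\<forall>t\<in>{0..h}. y t = (\<lambda>_. x) 0 + integral {0..t} (\<lambda>s. F s y))"
  proof (rule functional_ode_Lipschitz[OF h _ Lambda_nonneg])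
    fix y :: "real \<Rightarrow> 'n rvec" assume "continuous_on UNIV y"
    then show "(\<lambda>s. F s y) integrable_on {0..h}"
      by (intro set_lebesgue_integral_eq_integral(1) Fint) (rule continuous_on_subset, auto)
  next
    fix y y' :: "real \<Rightarrow> 'n rvec" and s B
    assume s: "s \<in> {0..h}" and B: "\<And>v. v \<in> {0..s} \<Longrightarrow> norm (y v - y' v) \<le> B"
    have "norm (F s y - F s y') \<le> L\<^sub>F * norm (y s - y' s)"
      unfolding F_def using drift_Lipschitz by simp
    also have "\<dots> \<le> L\<^sub>F * B" using B[of s] s Lambda_nonneg by (intro mult_left_mono) auto
    finally show "norm (F s y - F s y') \<le> L\<^sub>F * B" .
  qed auto
  then obtain y where y: "continuous_on UNIV y" "y 0 = x"
    "\<And>t. t \<in> {0..h} \<Longrightarrow> y t = x + integral {0..t} (\<lambda>s. F s y)" by auto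
  have Fy: "(\<lambda>s. F s y) absolutely_integrable_on {0..h}"
    by (rule Fint, rule continuous_on_subset[OF y(1)]) simp
  have "ac_derivative_on {0..h} y (\<lambda>s. F s y)"
    unfolding ac_derivative_on_def
  proof (intro ballI impI conjI)
    fix s t :: real assume st: "s \<in> {0..h}" "t \<in> {0..h}" "s \<le> t"
    show "(\<lambda>s. F s y) absolutely_integrable_on {s..t}"
      using absolutely_integrable_on_subinterval[OF Fy, of s t] st by auto
    have "(\<lambda>s. F s y) absolutely_integrable_on {0..t}"
      using absolutely_integrable_on_subinterval[OF Fy, of 0 t] st by auto
    then have "integral {0..s} (\<lambda>s. F s y) + integral {s..t} (\<lambda>s. F s y)
        = integral {0..t} (\<lambda>s. F s y)"
      by (intro Henstock_Kurzweil_Integration.integral_combine set_lebesgue_integral_eq_integral(1))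
        (use st in auto)
    then show "y t = y s + integral {s..t} (\<lambda>s. F s y)"
      using y(3)[OF st(1)] y(3)[OF st(2)] by (metis add.assoc)
  qed
  then show ?thesis
    using y(2) unfolding nominal_solution_def F_def drift_def by blast
qed

text \<open>The nominal solution from \<open>x\<close> is the intermediate object: the accuracy
  constant compares the prediction with it, and Gronwall's lemma compares it with \<open>y\<close>,
  which starts at \<open>y 0\<close> and carries the perturbation \<open>\<delta>\<close>.\<close>

lemma Phi_pred_error:
  fixes y :: "real \<Rightarrow> 'n rvec"
  assumes K: "predictor_accuracy_constant f L m h K" and h: "h > 0" and l: "l \<ge> 1"
    and small: "L\<^sub>F * (h / real m) < 1"
    and u: "u absolutely_integrable_on {-h..0}" "\<And>s. s \<in> {-h..<0} \<Longrightarrow> \<bar>u s\<bar> \<le> U"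
    and y: "ac_derivative_on {0..h} y (\<lambda>t. drift (y t) + u (t - h) *\<^sub>R last_unit + \<delta> t)"
    and \<delta>: "\<And>t. t \<in> {0..<h} \<Longrightarrow> norm (\<delta> t) \<le> \<Delta>"
  shows "norm (Phi_pred f l m h x u - y h)
    \<le> K * ((L\<^sub>F * (h / real m)) ^ (l + 1) / (1 - L\<^sub>F * (h / real m))) * (norm x + U)
      + (norm (x - y 0) + \<Delta> * h) * exp (L\<^sub>F * h)"
    (is "_ \<le> ?\<epsilon> * _ + _")
proof -
  have \<Delta>: "\<Delta> \<ge> 0" using \<delta>[of 0] h order_trans[OF norm_ge_zero] by auto
  define v where "v t = u (t - h)" for t
  have v: "v absolutely_integrable_on {0..h}"
    using absolutely_integrable_shift_real[OF u(1), of "-h"] unfolding v_def by simp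
  have vU: "\<bar>v t\<bar> \<le> U" if "t \<in> {0..<h}" for t unfolding v_def using that by (intro u(2)) auto
  obtain \<phi> where \<phi>: "nominal_solution f h v x \<phi>"
    using nominal_solution_exists[OF less_imp_le[OF h] v] by blast
  have Linf: "L_inf {0..<h} v" by (rule L_inf_Ico[OF v, of U]) (use vU in simp)
  have \<epsilon>0: "?\<epsilon> \<ge> 0"
    using K small h Lambda_nonneg unfolding predictor_accuracy_constant_def n by simp
  have "norm (P_pred f l m h v x - \<phi> h) \<le> ?\<epsilon> * (norm x + sup_on {0..<h} v)"
    using K l Linf \<phi> unfolding predictor_accuracy_constant_def n Let_def by blast
  also have "\<dots> \<le> ?\<epsilon> * (norm x + U)"
    using \<epsilon>0 h vU by (intro mult_left_mono add_left_mono sup_on_le) auto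
  finally have 1: "norm (Phi_pred f l m h x u - \<phi> h) \<le> ?\<epsilon> * (norm x + U)"
    unfolding Phi_pred_def v_def[abs_def] .
  have ac\<phi>: "ac_derivative_on {0..h} \<phi> (\<lambda>t. drift (\<phi> t) + v t *\<^sub>R last_unit)" and "\<phi> 0 = x"
    using \<phi> unfolding nominal_solution_def drift_def by auto
  \<comment> \<open>\<open>\<delta>\<close> is bounded only before \<open>h\<close>; one point does
    not affect the equation for \<open>y\<close>.\<close>
  define \<delta>' where "\<delta>' t = (if t < h then \<delta> t else 0)" for t
  have y': "ac_derivative_on {0..h} y (\<lambda>t. drift (y t) + v t *\<^sub>R last_unit + \<delta>' t)"
    by (rule ac_derivative_on_spike[OF y, of "{h}"]) (auto simp: \<delta>'_def v_def)
  have "norm (\<phi> h - y h) \<le> (norm (\<phi> 0 - y 0) + \<Delta> * (h - 0)) * exp (L\<^sub>F * (h - 0))"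
  proof (rule ac_derivative_on_gronwall[OF ac_derivative_on_diff[OF ac\<phi> y'] Lambda_nonneg \<Delta>])
    fix t assume t: "t \<in> {0..h}"
    have "norm (\<delta>' t) \<le> \<Delta>" unfolding \<delta>'_def using \<delta> t \<Delta> by auto
    moreover have "drift (\<phi> t) + v t *\<^sub>R last_unit - (drift (y t) + v t *\<^sub>R last_unit + \<delta>' t)
      = (drift (\<phi> t) - drift (y t)) - \<delta>' t" by simp
    ultimately show "norm (drift (\<phi> t) + v t *\<^sub>R last_unit - (drift (y t) + v t *\<^sub>R last_unit
        + \<delta>' t))
        \<le> L\<^sub>F * norm (\<phi> t - y t) + \<Delta>"
      using drift_Lipschitz[of "\<phi> t" "y t"] norm_triangle_ineq4[of "drift (\<phi> t) - drift (y t)"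
          "\<delta>' t"]
      by (simp only:)
  qed (use h in auto)
  then have "norm (\<phi> h - y h) \<le> (norm (x - y 0) + \<Delta> * h) * exp (L\<^sub>F * h)"
    using \<open>\<phi> 0 = x\<close> by simp
  then show ?thesis
    using 1 norm_triangle_ineq[of "Phi_pred f l m h x u - \<phi> h" "\<phi> h - y h"] by simp
qed

end

section \<open>Integrability of the closed-loop signals\<close>

lemma ac_derivative_on_cong:
  assumes "ac_derivative_on I y h" "\<And>t. t \<in> I \<Longrightarrow> y' t = y t" "\<And>t. t \<in> I \<Longrightarrow> h' t = h t"
    and "\<And>s t. s \<in> I \<Longrightarrow> t \<in> I \<Longrightarrow> {s..t} \<subseteq> I"
  shows "ac_derivative_on I y' h'"
proof -
  have h': "ac_derivative_on I y h'"
    by (rule ac_derivative_on_spike[OF assms(1), of "{}"]) (use assms(3,4) in auto)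
  show ?thesis
    unfolding ac_derivative_on_def
  proof (intro ballI impI conjI)
    fix s t assume st: "s \<in> I" "t \<in> I" "s \<le> t"
    show "h' absolutely_integrable_on {s..t}" by (rule ac_derivative_onD(1)[OF h' st])
    show "y' t = y' s + integral {s..t} h'"
      unfolding assms(2)[OF st(1)] assms(2)[OF st(2)] by (rule ac_derivative_onD(3)[OF h' st])
  qed
qed

lemma absolutely_integrable_cong:
  fixes f :: "'a::euclidean_space \<Rightarrow> 'b::euclidean_space"
  assumes "f absolutely_integrable_on S" "\<And>x. x \<in> S \<Longrightarrow> g x = f x"
  shows "g absolutely_integrable_on S"
  by (rule absolutely_integrable_spike[OF assms(1), of "{}"]) (use assms(2) in auto)

lemma absolutely_integrable_if_less:
  fixes f g :: "real \<Rightarrow> 'b::euclidean_space"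
  assumes f: "f absolutely_integrable_on {a..b}" and g: "g absolutely_integrable_on {a..b}"
  shows "(\<lambda>t. if t < c then f t else g t) absolutely_integrable_on {a..b}"
proof -
  consider "c \<le> a" | "b \<le> c" | "a < c" "c < b" by linarith
  then show ?thesis
  proof cases
    case 1
    then show ?thesis by (intro absolutely_integrable_cong[OF g]) auto
  next
    case 2
    then show ?thesis by (intro absolutely_integrable_spike[OF f, of "{b}"]) auto
  next
    case 3
    show ?thesis
    proof (rule absolutely_integrable_on_combine[where c = c])
      have "f absolutely_integrable_on {a..c}"
        by (rule absolutely_integrable_on_subinterval[OF f]) (use 3 in auto)
      then show "(\<lambda>t. if t < c then f t else g t) absolutely_integrable_on {a..c}"
        by (rule absolutely_integrable_spike[of _ _ "{c}"]) auto
      have "g absolutely_integrable_on {c..b}"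
        by (rule absolutely_integrable_on_subinterval[OF g]) (use 3 in auto)
      then show "(\<lambda>t. if t < c then f t else g t) absolutely_integrable_on {c..b}"
        by (rule absolutely_integrable_cong) auto
    qed (use 3 in auto)
  qed
qed

lemma absolutely_integrable_piecewise:
  fixes f :: "real \<Rightarrow> 'b::euclidean_space"
  assumes "\<And>i. \<sigma> i \<le> \<sigma> (Suc i)" "\<And>i. f absolutely_integrable_on {\<sigma> i..\<sigma> (Suc i)}"
  shows "f absolutely_integrable_on {\<sigma> 0..\<sigma> i}"
proof (induction i)
  case 0
  show ?case
    by (rule absolutely_integrable_on_subinterval[OF assms(2)[of 0]]) (use assms(1)[of 0] in auto)
next
  case (Suc i)
  have "\<sigma> 0 \<le> \<sigma> i" by (rule lift_Suc_mono_le[of \<sigma>, OF assms(1)]) simp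
  then show ?case
    using absolutely_integrable_on_combine[OF Suc assms(2)] assms(1) by simp
qed

lemma absolutely_integrable_continuous_scaleR:
  fixes d :: "real \<Rightarrow> 'b::euclidean_space"
  assumes c: "continuous_on {a..b} c" and d: "d absolutely_integrable_on {a..b}"
  shows "(\<lambda>s. c s *\<^sub>R d s) absolutely_integrable_on {a..b}"
proof -
  have "bounded (c ` {a..b})"
    by (intro compact_imp_bounded compact_continuous_image c) auto
  then obtain B where B: "\<And>t. t \<in> {a..b} \<Longrightarrow> norm (c t) \<le> B"
    unfolding bounded_iff by blast
  have dm: "d \<in> borel_measurable (lebesgue_on {a..b})"
    using absolutely_integrable_measurable[THEN iffD1, OF _ d] by auto
  show ?thesis
  proof (rule measurable_bounded_by_integrable_imp_absolutely_integrable)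
    show "(\<lambda>s. c s *\<^sub>R d s) \<in> borel_measurable (lebesgue_on {a..b})"
      by (intro borel_measurable_scaleR dm continuous_imp_measurable_on_sets_lebesgue c) auto
    show "(\<lambda>s. B * norm (d s)) integrable_on {a..b}"
      using d unfolding absolutely_integrable_on_def by (auto intro: integrable_on_mult_right)
    show "norm (c s *\<^sub>R d s) \<le> B * norm (d s)" if "s \<in> {a..b}" for s
      using B[OF that] by (simp add: mult_right_mono)
  qed auto
qed

lemma absolutely_integrable_diag:
  fixes v :: "real \<Rightarrow> real ^ 'm"
  assumes v: "\<And>i. continuous_on {a..b} (\<lambda>s. v s $ i)" and d: "d absolutely_integrable_on {a..b}"
  shows "(\<lambda>s. diag (v s) *v d s) absolutely_integrable_on {a..b}"
proof (rule absolutely_integrable_componentwise)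
  fix e :: "real ^ 'm" assume "e \<in> Basis"
  then obtain i where e: "e = axis i 1" by (auto simp: Basis_vec_def)
  have "(\<lambda>s. d s \<bullet> e) absolutely_integrable_on {a..b}"
    by (rule absolutely_integrable_component[OF d])
  then have "(\<lambda>s. v s $ i *\<^sub>R (d s \<bullet> e)) absolutely_integrable_on {a..b}"
    by (rule absolutely_integrable_continuous_scaleR[OF v])
  then show "(\<lambda>s. (diag (v s) *v d s) \<bullet> e) absolutely_integrable_on {a..b}"
    by (simp add: e inner_axis diag_mult_nth)
qed

lemma absolutely_integrable_Pair:
  fixes f1 :: "real \<Rightarrow> 'a::euclidean_space" and f2 :: "real \<Rightarrow> 'b::euclidean_space"
  assumes "f1 absolutely_integrable_on S" "f2 absolutely_integrable_on S"
  shows "(\<lambda>s. (f1 s, f2 s)) absolutely_integrable_on S"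
proof -
  have "bounded_linear (\<lambda>v::'a. (v, 0::'b))" "bounded_linear (\<lambda>v::'b. (0::'a, v))"
    by (auto intro: bounded_linear_Pair bounded_linear_ident bounded_linear_zero)
  then have "(\<lambda>s. (f1 s, 0) + (0, f2 s)) absolutely_integrable_on S"
    using absolutely_integrable_linear[OF assms(1)] absolutely_integrable_linear[OF assms(2)]
    by (intro set_integral_add(1)) (auto simp: o_def)
  then show ?thesis by simp
qed

lemma L_infD:
  fixes u :: "real \<Rightarrow> 'a::euclidean_space"
  assumes "L_inf {a..<b} u"
  shows "u absolutely_integrable_on {a..b}" "\<exists>B\<ge>0. \<forall>s\<in>{a..<b}. norm (u s) \<le> B"
proof -
  obtain B where "\<forall>s\<in>{a..<b}. norm (u s) \<le> B"
    using assms unfolding L_inf_def bounded_iff by auto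
  then have B: "norm (u s) \<le> B" if "s \<in> {a..<b}" for s using that by blast
  have "u absolutely_integrable_on {a..<b}"
  proof (rule measurable_bounded_by_integrable_imp_absolutely_integrable)
    show "(\<lambda>_. B) integrable_on {a..<b}"
      by (rule integrable_spike_set[of _ "{a..b}"]) (auto intro: negligible_subset[of "{b}"])
  qed (use assms B in \<open>auto simp: L_inf_def\<close>)
  then show "u absolutely_integrable_on {a..b}"
    by (rule absolutely_integrable_spike_set) (auto intro: negligible_subset[of "{b}"])
  show "\<exists>B\<ge>0. \<forall>s\<in>{a..<b}. norm (u s) \<le> B"
    using B by (intro exI[of _ "max B 0"]) (auto simp: le_max_iff_disj)
qed

lemma L_inf_locD:
  fixes u :: "real \<Rightarrow> 'a::euclidean_space"
  assumes "L_inf_loc {a..} u"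
  shows "u absolutely_integrable_on {a..b}" "\<exists>B\<ge>0. \<forall>s\<in>{a..b}. norm (u s) \<le> B"
proof -
  have "bounded (u ` {a..b})"
    using assms unfolding L_inf_loc_def by auto
  then obtain B where "\<forall>s\<in>{a..b}. norm (u s) \<le> B" unfolding bounded_iff by auto
  then have B: "norm (u s) \<le> B" if "s \<in> {a..b}" for s using that by blast
  have "u \<in> borel_measurable (lebesgue_on {a..b})"
    using assms unfolding L_inf_loc_def by (auto intro: measurable_restrict_mono)
  then show "u absolutely_integrable_on {a..b}"
    by (rule measurable_bounded_by_integrable_imp_absolutely_integrable[where g
        = "\<lambda>_. B"]) (use B in auto)
  show "\<exists>B\<ge>0. \<forall>s\<in>{a..b}. norm (u s) \<le> B"
    using B by (intro exI[of _ "max B 0"]) (auto simp: le_max_iff_disj)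
qed

text \<open>Joint local Lipschitz continuity gives local Lipschitz continuity in \<open>x\<close>
  with \<open>u\<close> as a parameter. Compactness of the ball and of the parameter interval then
  yields a single constant.\<close>

lemma locally_Lipschitz_bounded:
  fixes G :: "'a::euclidean_space \<Rightarrow> real \<Rightarrow> 'b::metric_space"
  assumes "locally_Lipschitz (\<lambda>(x, u). G x u)"
  shows "\<exists>C\<ge>0. \<forall>x x' u. norm x \<le> R \<longrightarrow> norm x' \<le> R \<longrightarrow> \<bar>u\<bar> \<le> U \<longrightarrow>
    dist (G x u) (G x' u) \<le> C * norm (x - x')"
proof -
  have loc: "\<exists>\<rho>>0. \<exists>C. C-lipschitz_on (ball (x, u) \<rho>) (\<lambda>(x, u). G x u)" for x u
    using assms unfolding locally_Lipschitz_def by blast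
  \<comment> \<open>With a third of the radius in each factor, the product of the two balls fits
    into the ball of the product space.\<close>
  have sub: "(x', u') \<in> ball (x, u) \<rho>" if "\<rho> > 0" "dist x x' \<le> \<rho> / 3" "dist u u'
      \<le> \<rho> / 3" for x x' :: 'a and u u' :: real and \<rho>
  proof -
    have "dist (x, u) (x', u') \<le> dist x x' + dist u u'"
      unfolding dist_Pair_Pair by (rule sqrt_sum_squares_le_sum) auto
    then show ?thesis using that by auto
  qed
  have ll: "local_lipschitz {-U..U} (cball 0 R) (\<lambda>u x. G x u)"
  proof (rule local_lipschitzI)
    fix u x
    obtain \<rho> C where \<rho>: "\<rho> > 0" and C: "C-lipschitz_on (ball (x, u) \<rho>) (\<lambda>(x, u). G x u)"
      using loc by blast
    have "C-lipschitz_on (cball x (\<rho>/3) \<inter> cball 0 R) (\<lambda>x. G x u')" if "u' \<in> cball u (\<rho>/3)" for u'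
    proof (rule lipschitz_onI)
      fix y y' assume y: "y \<in> cball x (\<rho>/3) \<inter> cball 0 R" and y': "y' \<in> cball x (\<rho>/3) \<inter> cball 0 R"
      have "dist (G y u') (G y' u') \<le> C * dist (y, u') (y', u')"
        using lipschitz_onD[OF C sub[OF \<rho>, of x y u u'] sub[OF \<rho>, of x y' u u']] y y' that by auto
      then show "dist (G y u') (G y' u') \<le> C * dist y y'" by (simp add: dist_Pair_Pair)
    qed (rule lipschitz_on_nonneg[OF C])
    then show "\<exists>v>0. \<exists>C. \<forall>u'\<in>cball u v \<inter> {-U..U}. C-lipschitz_on (cball x v \<inter> cball 0 R)
        (\<lambda>x. G x u')"
      using \<rho> by (intro exI[of _ "\<rho>/3"] conjI exI[of _ C]) auto
  qed
  have cont: "continuous_on {-U..U} (\<lambda>u. G x u)" for x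
  proof (rule continuous_at_imp_continuous_on, intro ballI)
    fix u
    obtain \<rho> C where \<rho>: "\<rho> > 0" and C: "C-lipschitz_on (ball (x, u) \<rho>) (\<lambda>(x, u). G x u)"
      using loc by blast
    have "continuous_on (ball (x, u) \<rho>) (\<lambda>(x, u). G x u)"
      by (rule lipschitz_on_continuous_on[OF C])
    then have "isCont (\<lambda>(x, u). G x u) (x, u)"
      using \<rho> by (simp add: continuous_on_eq_continuous_at)
    then show "isCont (\<lambda>u. G x u) u"
      using isCont_o2[of u "\<lambda>u. (x, u)" "\<lambda>(x, u). G x u"] by (simp add: isCont_Pair)
  qed
  have "\<exists>C. \<forall>u\<in>{-U..U}. C-lipschitz_on (cball 0 R) (\<lambda>x. G x u)"
    by (rule local_lipschitz_compact_implies_lipschitz[OF ll compact_cball compact_Icc cont]) blast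
  then obtain C where C: "\<And>u. u \<in> {-U..U} \<Longrightarrow> C-lipschitz_on (cball 0 R) (\<lambda>x. G x u)"
    by blast
  show ?thesis
  proof (intro exI[of _ "max C 0"] conjI allI impI)
    fix x x' :: 'a and u assume "norm x \<le> R" "norm x' \<le> R" "\<bar>u\<bar> \<le> U"
    then have "dist (G x u) (G x' u) \<le> C * dist x x'"
      by (intro lipschitz_onD[OF C]) auto
    also have "\<dots> \<le> max C 0 * norm (x - x')" unfolding dist_norm by (intro mult_right_mono) auto
    finally show "dist (G x u) (G x' u) \<le> max C 0 * norm (x - x')" .
  qed simp
qed

lemma locally_Lipschitz_continuous:
  assumes "locally_Lipschitz h"
  shows "continuous_on UNIV h"
proof (rule continuous_at_imp_continuous_on, intro ballI)
  fix x
  obtain \<rho> C where \<rho>: "\<rho> > 0" and C: "C-lipschitz_on (ball x \<rho>) h"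
    using assms unfolding locally_Lipschitz_def by blast
  then show "isCont h x"
    using lipschitz_on_continuous_on[OF C] by (simp add: continuous_on_eq_continuous_at)
qed

section \<open>Sampling times\<close>

lemma sampling_time_nonneg: "T1 > 0 \<Longrightarrow> sampling_time T1 b i \<ge> 0"
  by (induction i) auto

lemma sampling_time_mono: "T1 > 0 \<Longrightarrow> i \<le> j \<Longrightarrow> sampling_time T1 b i \<le> sampling_time T1 b j"
  by (rule lift_Suc_mono_le) auto

text \<open>If the sampling times stayed below \<open>t\<close>, a bound \<open>B\<close> of
  \<open>b\<close> on \<open>{0..t}\<close> would make every step at least
  \<open>T1 * exp (- B)\<close>, so they would leave \<open>{0..t}\<close> after all.\<close>

lemma sampling_time_unbounded:
  assumes T1: "T1 > 0" and b: "L_inf_loc {0..} b"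
  shows "\<exists>i. t < sampling_time T1 b i"
proof (rule ccontr)
  assume "\<not> ?thesis"
  then have le: "sampling_time T1 b i \<le> t" for i by (meson not_less)
  obtain B where B: "\<And>s. s \<in> {0..t} \<Longrightarrow> norm (b s) \<le> B"
    using L_inf_locD(2)[OF b, of t] by blast
  have "real i * (T1 * exp (- B)) \<le> sampling_time T1 b i" for i
  proof (induction i)
    case (Suc i)
    have "b (sampling_time T1 b i) \<le> B"
      using B[of "sampling_time T1 b i"] le sampling_time_nonneg[OF T1] by auto
    then have "T1 * exp (- B) \<le> T1 * exp (- b (sampling_time T1 b i))" using T1 by simp
    then show ?case using Suc by (simp add: distrib_right)
  qed simp
  then have "real i * (T1 * exp (- B)) \<le> t" for i using le order_trans by blast
  moreover obtain i where "t < real i * (T1 * exp (- B))"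
    using reals_Archimedean3[of "T1 * exp (- B)"] T1 by auto
  ultimately show False by (meson not_less)
qed

definition sample_index :: "real \<Rightarrow> (real \<Rightarrow> real) \<Rightarrow> real \<Rightarrow> nat" where
  "sample_index T1 b t = (LEAST i. t < sampling_time T1 b (Suc i))"

lemma sample_index:
  assumes T1: "T1 > 0" and b: "L_inf_loc {0..} b" and t: "t \<ge> 0"
  shows "sampling_time T1 b (sample_index T1 b t)
      \<le> t" "t < sampling_time T1 b (Suc (sample_index T1 b t))"
proof -
  obtain i where i: "t < sampling_time T1 b i" using sampling_time_unbounded[OF T1 b] by blast
  then obtain i' where "i = Suc i'" using t by (cases i) auto
  then have ex: "\<exists>i. t < sampling_time T1 b (Suc i)" using i by blast
  show "t < sampling_time T1 b (Suc (sample_index T1 b t))"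
    unfolding sample_index_def by (rule LeastI_ex[OF ex])
  show "sampling_time T1 b (sample_index T1 b t) \<le> t"
  proof (cases "sample_index T1 b t")
    case (Suc j)
    then have "\<not> t < sampling_time T1 b (Suc j)"
      unfolding sample_index_def using not_less_Least[of j "\<lambda>i. t < sampling_time T1 b (Suc i)"]
          by auto
    then show ?thesis using Suc by simp
  qed (use t in simp)
qed

lemma sample_index_eqI:
  assumes T1: "T1 > 0" and t: "sampling_time T1 b i \<le> t" "t < sampling_time T1 b (Suc i)"
  shows "sample_index T1 b t = i"
  unfolding sample_index_def
proof (rule Least_equality)
  fix j assume "t < sampling_time T1 b (Suc j)"
  then have "\<not> Suc j \<le> i" using t(1) sampling_time_mono[OF T1, of "Suc j" i b] by linarith
  then show "i \<le> j" by simp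
qed (rule t(2))

section \<open>Sampled-and-held inputs\<close>

text \<open>Stage \<open>i\<close> is final before time \<open>i * S\<close>; its later values are
  fillers. Passing the whole stage to \<open>\<kappa> i\<close> avoids a circular definition of the
  input, provided that \<open>\<kappa> i\<close> looks only at times before
  \<open>i * S\<close>.\<close>

primrec held_input :: "(nat \<Rightarrow> (real \<Rightarrow> real) \<Rightarrow> real) \<Rightarrow> real \<Rightarrow>
    (real \<Rightarrow> real) \<Rightarrow> nat \<Rightarrow> real \<Rightarrow> real" where
  "held_input \<kappa> S u0 0 = (\<lambda>t. if t < 0 then u0 t else 0)"
| "held_input \<kappa> S u0 (Suc i) = (\<lambda>t. if t < real i * S then held_input \<kappa> S u0 i t
     else \<kappa> i (held_input \<kappa> S u0 i))"

lemma held_input_cong: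
  "(\<And>j. j < i \<Longrightarrow> \<kappa> j = \<kappa>' j) \<Longrightarrow> held_input \<kappa> S u0 i = held_input \<kappa>' S u0 i"
  by (induction i) auto

lemma held_input_stable:
  assumes "S > 0" "i \<le> j" "t < real i * S"
  shows "held_input \<kappa> S u0 j t = held_input \<kappa> S u0 i t"
  using assms(2)
proof (induction j rule: dec_induct)
  case (step j)
  have "real i * S \<le> real j * S" using step assms(1) by (intro mult_right_mono) auto
  then show ?case using step assms(3) by simp
qed simp

lemma held_input_integrable:
  fixes h a b :: real
  assumes u0: "L_inf {-h..<0} u0" and h: "h \<ge> 0" and a: "-h \<le> a"
  shows "held_input \<kappa> S u0 i absolutely_integrable_on {a..b}"
proof (induction i)
  case 0
  have "(\<lambda>t. if t < 0 then u0 t else 0) absolutely_integrable_on {a..b}"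
  proof (cases "a \<le> 0 \<and> 0 \<le> b")
    case True
    show ?thesis
    proof (rule absolutely_integrable_on_combine[where c = 0])
      have "u0 absolutely_integrable_on {a..0}"
        using absolutely_integrable_on_subinterval[OF L_infD(1)[OF u0], of a 0] a by auto
      then show "(\<lambda>t. if t < 0 then u0 t else 0) absolutely_integrable_on {a..0}"
        by (rule absolutely_integrable_spike[of _ _ "{0}"]) auto
      have "(\<lambda>_. 0 :: real) absolutely_integrable_on {0..b}"
        by (intro absolutely_integrable_continuous_real continuous_intros)
      then show "(\<lambda>t. if t < 0 then u0 t else 0) absolutely_integrable_on {0..b}"
        by (rule absolutely_integrable_cong) auto
    qed (use True in auto)
  next
    case False
    then consider "0 < a" | "b < 0" by linarith
    then show ?thesis
    proof cases
      case 1
      have "(\<lambda>_. 0 :: real) absolutely_integrable_on {a..b}"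
        by (intro absolutely_integrable_continuous_real continuous_intros)
      then show ?thesis by (rule absolutely_integrable_cong) (use 1 in auto)
    next
      case 2
      have "u0 absolutely_integrable_on {a..b}"
        using absolutely_integrable_on_subinterval[OF L_infD(1)[OF u0], of a b] a 2 by auto
      then show ?thesis by (rule absolutely_integrable_cong) (use 2 in auto)
    qed
  qed
  then show ?case by simp
next
  case (Suc i)
  have "(\<lambda>t. if t < real i * S then held_input \<kappa> S u0 i t else \<kappa> i (held_input \<kappa> S u0 i))
      absolutely_integrable_on {a..b}"
    by (intro absolutely_integrable_if_less Suc absolutely_integrable_continuous_real
        continuous_intros)
  then show ?case by simp
qed

lemma held_input_bounded:
  assumes u0: "L_inf {-h..<0} u0"
  shows "\<exists>U\<ge>0. \<forall>t\<ge>-h. \<bar>held_input \<kappa> S u0 i t\<bar> \<le> U"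
proof (induction i)
  case 0
  obtain B where "B \<ge> 0" "\<forall>s\<in>{-h..<0}. norm (u0 s) \<le> B" using L_infD(2)[OF u0] by blast
  then show ?case by (intro exI[of _ B]) auto
next
  case (Suc i)
  then obtain U where "U \<ge> 0" "\<forall>t\<ge>-h. \<bar>held_input \<kappa> S u0 i t\<bar> \<le> U" by blast
  then show ?case
    by (intro exI[of _ "max U \<bar>\<kappa> i (held_input \<kappa> S u0 i)\<bar>"]) (auto simp: le_max_iff_disj)
qed

lemma norm_fst_diff_le: "norm (fst a - fst c) \<le> norm (a - c)"
  using norm_fst_le[of "fst a - fst c" "snd a - snd c"] by (metis fst_diff prod.collapse snd_diff)

lemma norm_snd_diff_le: "norm (snd a - snd c) \<le> norm (a - c)"
  using norm_snd_le[of "snd a - snd c" "fst a - fst c"] by (metis fst_diff prod.collapse snd_diff)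

lemma norm_scaleR_le: "\<bar>c\<bar> \<le> a * a' \<Longrightarrow> norm (c *\<^sub>R v) \<le> a * norm v * a'"
  using mult_right_mono[of "\<bar>c\<bar>" "a * a'" "norm v"] by (simp add: mult_ac)

section \<open>Existence of closed-loop solutions\<close>

locale sampled_loop = triangular_drift f L n
  for f :: "'n::{finite,linorder} \<Rightarrow> 'n rvec \<Rightarrow> real" and L n +
  fixes g :: "'n \<Rightarrow> 'n rvec \<Rightarrow> real \<Rightarrow> real" and G r \<tau> \<theta> T1 T2 :: real
    and p k :: "'n rvec" and l m :: nat
  assumes n2: "n \<ge> 2"
    and delays: "r \<ge> 0" "\<tau> \<ge> 0" "r + \<tau> > 0"
    and g_Lipschitz: "\<And>i. locally_Lipschitz (\<lambda>(x, u). g i x u)"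
    and g_bounded: "\<And>i x u. \<bar>g i x u\<bar> \<le> G"
    and T1: "T1 > 0" and T2: "T2 > 0" and m: "m \<ge> 1"
begin

abbreviation "hor \<equiv> r + \<tau>"

definition p\<theta> :: "'n rvec" where "p\<theta> = (\<chi> i. \<theta> ^ idx i * p $ i)"

lemma injection_eq: "(\<chi> i. \<theta> ^ idx i * p $ i * c) = c *\<^sub>R p\<theta>"
  by (simp add: p\<theta>_def vec_eq_iff)

definition hold_index :: "real \<Rightarrow> nat" where "hold_index t = nat \<lfloor>t / T2\<rfloor>"

lemma hold_index:
  assumes "t \<ge> 0"
  shows "real (hold_index t) * T2 \<le> t" "t < real (Suc (hold_index t)) * T2"
proof -
  have "real (hold_index t) = of_int \<lfloor>t / T2\<rfloor>"
    unfolding hold_index_def using assms T2 by (simp add: of_nat_nat)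
  then have "real (hold_index t) \<le> t / T2" "t / T2 < real (hold_index t) + 1" by linarith+
  then show "real (hold_index t) * T2 \<le> t" "t < real (Suc (hold_index t)) * T2"
    using T2 by (auto simp: field_simps)
qed

lemma hold_index_eqI:
  assumes "real i * T2 \<le> t" "t < real (Suc i) * T2"
  shows "hold_index t = i"
proof -
  have "real i \<le> t / T2" "t / T2 < real i + 1" using assms T2 by (auto simp: field_simps)
  then have "\<lfloor>t / T2\<rfloor> = int i" by linarith
  then show ?thesis unfolding hold_index_def by simp
qed

lemma hold_index_neg: "t < 0 \<Longrightarrow> hold_index t = 0"
  unfolding hold_index_def using T2 by (simp add: divide_nonpos_pos)

lemma g_diag_bound: "norm (diag (\<chi> i. g i x u) *v d) \<le> G * norm d"
  by (rule norm_diag_mult) (simp add: g_bounded)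

lemma G_nonneg: "G \<ge> 0"
  using g_bounded[of undefined undefined undefined] by linarith

lemma g_diag_Lipschitz:
  "\<exists>C\<ge>0. \<forall>x x' u d. norm x \<le> R \<longrightarrow> norm x' \<le> R \<longrightarrow> \<bar>u\<bar> \<le> U \<longrightarrow>
    norm (diag (\<chi> i. g i x u) *v d - diag (\<chi> i. g i x' u) *v d) \<le> C * norm (x - x') * norm d"
proof -
  have "\<exists>C. \<forall>i. C i \<ge> 0 \<and> (\<forall>x x' u. norm x \<le> R \<longrightarrow> norm x' \<le> R \<longrightarrow> \<bar>u\<bar> \<le> U \<longrightarrow>
    dist (g i x u) (g i x' u) \<le> C i * norm (x - x'))"
    using locally_Lipschitz_bounded[OF g_Lipschitz] by (intro choice) blast
  then obtain C where C: "\<And>i. C i \<ge> 0" "\<And>i x x' u. norm x \<le> R \<Longrightarrow> norm x' \<le> R \<Longrightarrow> \<bar>u\<bar> \<le> U \<Longrightarrow>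
    dist (g i x u) (g i x' u) \<le> C i * norm (x - x')"
    by blast
  have Cs: "C i \<le> sum C UNIV" for i
    by (rule member_le_sum) (use C(1) in auto)
  show ?thesis
  proof (intro exI[of _ "sum C UNIV"] conjI allI impI)
    show "sum C UNIV \<ge> 0" by (rule sum_nonneg) (use C(1) in auto)
    fix x x' :: "'n rvec" and u d assume *: "norm x \<le> R" "norm x' \<le> R" "\<bar>u\<bar> \<le> U"
    have "diag (\<chi> i. g i x u) *v d - diag (\<chi> i. g i x' u) *v d
        = diag (\<chi> i. g i x u - g i x' u) *v d"
      by (simp add: vec_eq_iff diag_mult_nth left_diff_distrib)
    also have "norm \<dots> \<le> (sum C UNIV * norm (x - x')) * norm d"
    proof (rule norm_diag_mult)
      fix i
      have "dist (g i x u) (g i x' u) \<le> C i * norm (x - x')" by (rule C(2)[OF *])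
      also have "\<dots> \<le> sum C UNIV * norm (x - x')" by (intro mult_right_mono Cs) auto
      finally show "\<bar>(\<chi> i. g i x u - g i x' u) $ i\<bar> \<le> sum C UNIV * norm (x - x')"
        by (simp add: dist_real_def)
    qed
    finally show "norm (diag (\<chi> i. g i x u) *v d - diag (\<chi> i. g i x' u) *v d)
        \<le> sum C UNIV * norm (x - x') * norm d" .
  qed
qed

lemma hold_intervals_cover: "\<exists>M::nat. t < real M * T2"
  using reals_Archimedean3[OF T2] by blast

end

text \<open>The whole loop is one functional equation for \<open>y = (x, z)\<close>: the input is a causal functional
  of the past of \<open>z\<close>, and \<open>w\<close> is the last sample plus an integral along \<open>z\<close>.\<close>

locale loop_data = sampled_loop f L n g G r \<tau> \<theta> T1 T2 p k l m
  for f :: "'n::{finite,linorder} \<Rightarrow> 'n rvec \<Rightarrow> real" and L n g G r \<tau> \<theta> T1 T2 p k l m +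
  fixes x0 :: "real \<Rightarrow> 'n rvec" and u0 :: "real \<Rightarrow> real" and z0 :: "'n rvec" and w0 :: real
    and \<xi> b :: "real \<Rightarrow> real" and d :: "real \<Rightarrow> 'n rvec"
  assumes x0: "continuous_on {-r..0} x0" and u0: "L_inf {-r-\<tau>..<0} u0"
    and \<xi>: "L_inf_loc {0..} \<xi>" and b: "L_inf_loc {0..} b" and d: "L_inf_loc {0..} d"
begin

abbreviation "st \<equiv> sampling_time T1 b"
abbreviation "six \<equiv> sample_index T1 b"

lemma u0': "L_inf {-hor..<0} u0" 
proof -
  have eq: "- hor = - r - \<tau>" by simp
  show ?thesis unfolding eq by (rule u0)
qed

definition feedback :: "(real \<Rightarrow> 'n rvec \<times> 'n rvec) \<Rightarrow> nat \<Rightarrow> (real \<Rightarrow> real) \<Rightarrow> real" where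
  "feedback y i u = k \<bullet> Phi_pred f l m hor (snd (y (real i * T2))) (shift (real i * T2) u)"

lemma feedback_cong:
  assumes "\<And>s. s \<in> {real i * T2 - hor..<real i * T2} \<Longrightarrow> u s = u' s"
  shows "feedback y i u = feedback y i u'"
  unfolding feedback_def
  by (rule arg_cong[where f = "\<lambda>v. k \<bullet> v"], rule Phi_pred_cong)
    (use delays m assms in \<open>auto simp: shift_def\<close>)

text \<open>Stage \<open>hold_index t + 1\<close> is final at \<open>t\<close>. For negative
  \<open>t\<close> the index defaults to 0 and the value is that of \<open>u0\<close>.\<close>

definition inp :: "(real \<Rightarrow> 'n rvec \<times> 'n rvec) \<Rightarrow> real \<Rightarrow> real" where
  "inp y t = held_input (feedback y) T2 u0 (Suc (hold_index t)) t"

text \<open>The functional equation starts at time 0, and before that its solution need not follow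
  the prescribed initial function; \<open>x0\<close> is therefore spliced in explicitly for the
  delayed measurements.\<close>

definition pos :: "(real \<Rightarrow> 'n rvec \<times> 'n rvec) \<Rightarrow> real \<Rightarrow> 'n rvec" where
  "pos y t = (if t < 0 then x0 t else fst (y t))"

definition jump :: "(real \<Rightarrow> 'n rvec \<times> 'n rvec) \<Rightarrow> nat \<Rightarrow> real" where
  "jump y i = (if i = 0 then w0 else first_unit \<bullet> pos y (st i - r) + \<xi> (st i))"

definition est :: "(real \<Rightarrow> 'n rvec \<times> 'n rvec) \<Rightarrow> real \<Rightarrow> real" where
  "est y t = jump y (six t) + integral {st (six t)..t} (\<lambda>s. first_unit \<bullet> drift (snd (y s)))"

definition rhs :: "real \<Rightarrow> (real \<Rightarrow> 'n rvec \<times> 'n rvec) \<Rightarrow> 'n rvec \<times> 'n rvec" where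
  "rhs s y =
    (drift (fst (y s)) + diag (\<chi> i. g i (fst (y s)) (inp y s)) *v d s + inp y (s - \<tau>) *\<^sub>R last_unit,
     drift (snd (y s)) + (first_unit \<bullet> snd (y s) - est y s) *\<^sub>R p\<theta> + inp y (s - hor) *\<^sub>R last_unit)"

lemma inp_eq_held:
  assumes "t < real M * T2"
  shows "inp y t = held_input (feedback y) T2 u0 M t"
proof (cases "t \<ge> 0")
  case True
  have "real (hold_index t) * T2 < real M * T2" using hold_index(1)[OF True] assms by linarith
  then have "Suc (hold_index t) \<le> M" using T2 by auto
  then show ?thesis
    unfolding inp_def using held_input_stable[OF T2 _ hold_index(2)[OF True], of M] by simp
next
  case False
  then have t: "t < real 0 * T2" by simp
  show ?thesis
    unfolding inp_def held_input_stable[OF T2 le0 t, of _ _ "Suc (hold_index t)"]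
      held_input_stable[OF T2 le0 t, of _ _ M] ..
qed

lemma inp_neg: "t < 0 \<Longrightarrow> inp y t = u0 t"
  using inp_eq_held[of t 0 y] by simp

lemma inp_cong:
  assumes "\<And>j. real j * T2 \<le> max 0 t \<Longrightarrow> y (real j * T2) = y' (real j * T2)"
  shows "inp y t = inp y' t"
  unfolding inp_def
proof (rule arg_cong[where f = "\<lambda>h. h t"], rule held_input_cong)
  fix j assume j: "j < Suc (hold_index t)"
  have "real j * T2 \<le> max 0 t"
  proof (cases "t \<ge> 0")
    case True
    have "real j * T2 \<le> real (hold_index t) * T2" using j T2 by (intro mult_right_mono) auto
    then show ?thesis using hold_index(1)[OF True] by linarith
  next
    case False
    then show ?thesis using j hold_index_neg[of t] by simp
  qed
  then show "feedback y j = feedback y' j"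
    unfolding feedback_def using assms[of j] by (simp add: fun_eq_iff)
qed

text \<open>The feedback value on interval \<open>i\<close> was computed from stage
  \<open>i\<close>, but it reads only the window before \<open>i * T2\<close>, where stage
  \<open>i\<close> already agrees with the final input.\<close>

lemma inp_held:
  assumes t: "t \<in> {real i * T2..<(real i + 1) * T2}"
  shows "inp y t = feedback y i (inp y)"
proof -
  have "hold_index t = i" by (rule hold_index_eqI) (use t in \<open>auto simp: add.commute\<close>)
  then have "inp y t = feedback y i (held_input (feedback y) T2 u0 i)"
    unfolding inp_def using t by simp
  also have "\<dots> = feedback y i (inp y)"
    by (rule feedback_cong, rule inp_eq_held[symmetric]) simp
  finally show ?thesis .
qed

lemma inp_integrable: "-hor \<le> a \<Longrightarrow> inp y absolutely_integrable_on {a..c}"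
proof -
  assume a: "-hor \<le> a"
  obtain M :: nat where M: "c < real M * T2" using hold_intervals_cover by blast
  show ?thesis
    by (rule absolutely_integrable_cong[OF held_input_integrable[OF u0' _ a,
          where \<kappa> = "feedback y" and S = T2 and i = M]])
      (use delays M in \<open>auto intro!: inp_eq_held\<close>)
qed

lemma inp_bounded: "\<exists>U\<ge>0. \<forall>t\<in>{-hor..<real i * T2}. \<bar>inp y t\<bar> \<le> U"
proof -
  obtain U where "U \<ge> 0" "\<forall>t\<ge>-hor. \<bar>held_input (feedback y) T2 u0 i t\<bar> \<le> U"
    using held_input_bounded[OF u0', of "feedback y" T2 i] by blast
  then show ?thesis using inp_eq_held[of _ i y] by (intro exI[of _ U]) auto
qed

lemma inp_shift_integrable:
  assumes "0 \<le> c" "c \<le> hor"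
  shows "(\<lambda>s. inp y (s - c) *\<^sub>R last_unit :: 'n rvec) absolutely_integrable_on {0..t}"
proof -
  have "inp y absolutely_integrable_on {-c..t-c}" by (rule inp_integrable) (use assms in auto)
  then have "(\<lambda>s. inp y (s + - c)) absolutely_integrable_on {-c - - c..t-c- - c}"
    by (rule absolutely_integrable_shift_real)
  then have "(\<lambda>s. inp y (s - c)) absolutely_integrable_on {0..t}" by simp
  then show ?thesis
    using absolutely_integrable_linear[OF _ bounded_linear_scaleR_left[of last_unit]]
    by (auto simp: o_def)
qed

text \<open>On one hold interval the input is a constant \<open>c\<close>, so the coefficients
  \<open>g j (x(s), c)\<close> are continuous in \<open>s\<close>; multiplied by \<open>d\<close>
  they stay integrable. The pieces are then joined.\<close>

lemma disturbance_integrable: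
  assumes y: "continuous_on UNIV y"
  shows "(\<lambda>s. diag (\<chi> i. g i (fst (y s)) (inp y s)) *v d s) absolutely_integrable_on {0..t}"
proof -
  have pieces: "(\<lambda>s. diag (\<chi> i. g i (fst (y s)) (inp y s)) *v d s)
      absolutely_integrable_on {real 0 * T2..real M * T2}" for M
  proof (rule absolutely_integrable_piecewise)
    show "real i * T2 \<le> real (Suc i) * T2" for i using T2 by (intro mult_right_mono) auto
    fix i
    define c where "c = feedback y i (inp y)"
    have cg: "continuous_on UNIV (\<lambda>s. g j (fst (y s)) c)" for j
    proof -
      have "continuous_on UNIV (\<lambda>s. (\<lambda>(x, u). g j x u) (fst (y s), c))"
        by (intro continuous_on_compose2[OF locally_Lipschitz_continuous[OF g_Lipschitz[of j]]]
            continuous_intros y) auto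
      then show ?thesis by simp
    qed
    have "(\<lambda>s. diag (\<chi> j. g j (fst (y s)) c) *v d s)
        absolutely_integrable_on {real i * T2..real (Suc i) * T2}"
    proof (rule absolutely_integrable_diag)
      show "continuous_on {real i * T2..real (Suc i) * T2} (\<lambda>s. (\<chi> j. g j (fst (y s)) c) $ j)" for j
        using continuous_on_subset[OF cg[of j]] by simp
      show "d absolutely_integrable_on {real i * T2..real (Suc i) * T2}"
        by (rule absolutely_integrable_on_subinterval[OF L_inf_locD(1)[OF d]]) (use T2 in auto)
    qed
    then show "(\<lambda>s. diag (\<chi> i. g i (fst (y s)) (inp y s)) *v d s)
        absolutely_integrable_on {real i * T2..real (Suc i) * T2}"
    proof (rule absolutely_integrable_spike[of _ _ "{real (Suc i) * T2}"])
      fix s assume "s \<in> {real i * T2..real (Suc i) * T2} - {real (Suc i) * T2}"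
      then have "inp y s = c" unfolding c_def by (intro inp_held) (auto simp: algebra_simps)
      then show "diag (\<chi> i. g i (fst (y s)) (inp y s)) *v d s
          = diag (\<chi> j. g j (fst (y s)) c) *v d s"
        by simp
    qed simp
  qed
  obtain M :: nat where "t < real M * T2" using hold_intervals_cover by blast
  then have "{0..t} \<subseteq> {real 0 * T2..real M * T2}" by auto
  then show ?thesis by (rule absolutely_integrable_on_subinterval[OF pieces])
qed

lemma continuous_on_output: "continuous_on UNIV y \<Longrightarrow>
    continuous_on S (\<lambda>s. first_unit \<bullet> drift (snd (y s)))"
  by (intro continuous_on_inner continuous_on_const continuous_on_drift continuous_on_snd)
    (erule continuous_on_subset, simp)

lemma est_eq:
  assumes "t \<in> {st i..<st (Suc i)}"
  shows "est y t = jump y i + integral {st i..t} (\<lambda>s. first_unit \<bullet> drift (snd (y s)))"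
  unfolding est_def using sample_index_eqI[OF T1, of b i t] assms by simp

text \<open>Between two samples \<open>est y\<close> is continuous, and the sampling times exhaust
  every bounded interval.\<close>

lemma est_integrable:
  assumes y: "continuous_on UNIV y"
  shows "est y absolutely_integrable_on {0..t}"
proof -
  have pieces: "est y absolutely_integrable_on {st 0..st M}" for M
  proof (rule absolutely_integrable_piecewise)
    show "st i \<le> st (Suc i)" for i using T1 by simp
    fix i
    have "(\<lambda>s. first_unit \<bullet> drift (snd (y s))) integrable_on {st i..st (Suc i)}"
      by (intro integrable_continuous_real continuous_on_output y)
    then have "(\<lambda>t. jump y i + integral {st i..t} (\<lambda>s. first_unit \<bullet> drift (snd (y s))))
        absolutely_integrable_on {st i..st (Suc i)}"
      by (intro absolutely_integrable_continuous_real continuous_on_add continuous_on_const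
          indefinite_integral_continuous_1)
    then show "est y absolutely_integrable_on {st i..st (Suc i)}"
      by (rule absolutely_integrable_spike[of _ _ "{st (Suc i)}"]) (use est_eq[of _ i y] in auto)
  qed
  obtain M where "t < st M" using sampling_time_unbounded[OF T1 b] by blast
  then have "{0..t} \<subseteq> {st 0..st M}" by auto
  then show ?thesis by (rule absolutely_integrable_on_subinterval[OF pieces])
qed

lemma rhs_integrable:
  assumes y: "continuous_on UNIV y"
  shows "(\<lambda>s. rhs s y) absolutely_integrable_on {0..t}"
proof -
  have cy: "continuous_on {0..t} y" by (rule continuous_on_subset[OF y]) simp
  have cf: "continuous_on {0..t} (\<lambda>s. first_unit \<bullet> snd (y s))" by (intro continuous_intros cy)
  have inj: "(\<lambda>s. (first_unit \<bullet> snd (y s) - est y s) *\<^sub>R p\<theta>) absolutely_integrable_on {0..t}"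
    using absolutely_integrable_linear[OF set_integral_diff(1)[OF
        absolutely_integrable_continuous_real[OF cf]
        est_integrable[OF y]] bounded_linear_scaleR_left[of p\<theta>]]
    by (simp add: o_def)
  show ?thesis
    unfolding rhs_def
    by (intro absolutely_integrable_Pair set_integral_add(1) inj disturbance_integrable[OF y]
        inp_shift_integrable absolutely_integrable_continuous_real continuous_on_drift
        continuous_on_fst continuous_on_snd cy) (use delays in auto)
qed

lemma rhs_causal:
  assumes s: "s \<ge> 0" and eq: "\<And>v. v \<in> {0..s} \<Longrightarrow> y v = y' v"
  shows "rhs s y = rhs s y'"
proof -
  have inp: "inp y v = inp y' v" if "v \<le> s" for v
    by (rule inp_cong) (use that s eq T2 in auto)
  have st: "st (six s) \<le> s" "0 \<le> st (six s)"
    using sample_index[OF T1 b s] sampling_time_nonneg[OF T1] by auto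
  have "integral {st (six s)..s} (\<lambda>s. first_unit \<bullet> drift (snd (y s)))
      = integral {st (six s)..s} (\<lambda>s. first_unit \<bullet> drift (snd (y' s)))"
    by (rule integral_cong) (use eq st in auto)
  moreover have "jump y (six s) = jump y' (six s)"
    unfolding jump_def pos_def using eq st delays by auto
  ultimately have "est y s = est y' s" unfolding est_def by simp
  then show ?thesis unfolding rhs_def using inp eq[of s] s delays by simp
qed

text \<open>Up to the end of hold interval \<open>i\<close> the input reads \<open>z\<close> only at
  hold instants up to \<open>i * T2\<close>. Within a stage it is thus a fixed function of time
  determined by the history, and no dependence of the predictor on its arguments has to be
  estimated.\<close>

lemma inp_stage:
  assumes y: "\<And>s. s \<le> real i * T2 \<Longrightarrow> y s = h s" and t: "t < real (Suc i) * T2"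
  shows "inp y t = inp h t"
proof (rule inp_cong, rule y)
  fix j assume j: "real j * T2 \<le> max 0 t"
  show "real j * T2 \<le> real i * T2"
  proof (cases "t \<ge> 0")
    case True
    then have "real j * T2 < real (Suc i) * T2" using j t by simp
    then have "j \<le> i" using T2 by simp
    then show ?thesis using T2 by simp
  next
    case False
    then have "real j * T2 \<le> 0" using j by simp
    then show ?thesis using T2 by (meson mult_nonneg_nonneg of_nat_0_le_iff order_trans less_imp_le)
  qed
qed

lemma est_bound:
  assumes y: "continuous_on UNIV y" and s: "0 \<le> s" "s \<le> t1"
    and X0: "\<And>v. v \<in> {-r..0} \<Longrightarrow> norm (x0 v) \<le> X0" and \<Xi>: "\<And>v. v \<in> {0..t1} \<Longrightarrow> \<bar>\<xi> v\<bar> \<le> \<Xi>"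
    and B: "\<And>v. v \<in> {0..s} \<Longrightarrow> norm (y v) \<le> B"
  shows "\<bar>est y s\<bar> \<le> \<bar>w0\<bar> + X0 + \<Xi> + B + L\<^sub>F * t1 * B"
proof -
  have st: "st (six s) \<le> s" "0 \<le> st (six s)"
    using sample_index[OF T1 b s(1)] sampling_time_nonneg[OF T1] by auto
  have nn: "0 \<le> B" "0 \<le> X0" "0 \<le> \<Xi>"
    using B[of s] X0[of 0] \<Xi>[of s] s delays order_trans[OF norm_ge_zero] order_trans[OF abs_ge_zero]
    by auto
  have "\<bar>jump y (six s)\<bar> \<le> \<bar>w0\<bar> + X0 + \<Xi> + B"
  proof (cases "six s = 0")
    case False
    define v where "v = st (six s) - r"
    have v: "v \<in> {-r..s}" unfolding v_def using st delays by auto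
    have "norm (pos y v) \<le> X0 + B"
    proof (cases "v < 0")
      case True
      then show ?thesis unfolding pos_def using X0[of v] v nn by auto
    next
      case False
      then show ?thesis
        unfolding pos_def using norm_fst_le[of "fst (y v)" "snd (y v)"] B[of v] v nn by auto
    qed
    then have "\<bar>first_unit \<bullet> pos y v\<bar> \<le> X0 + B" using abs_first_unit_inner_le order_trans by blast
    then show ?thesis
      unfolding jump_def v_def[symmetric] using False \<Xi>[of "st (six s)"] st s
        abs_triangle_ineq[of "first_unit \<bullet> pos y v" "\<xi> (st (six s))"] by auto
  qed (use nn in \<open>simp add: jump_def\<close>)
  moreover have "norm (integral {st (six s)..s} (\<lambda>s. first_unit \<bullet> drift (snd (y s))))
      \<le> integral {st (six s)..s} (\<lambda>_. L\<^sub>F * B)"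
  proof (rule integral_norm_bound_integral)
    fix v assume v: "v \<in> {st (six s)..s}"
    have "norm (snd (y v)) \<le> B"
      using norm_snd_le[of "snd (y v)" "fst (y v)"] B[of v] v st by auto
    then show "norm (first_unit \<bullet> drift (snd (y v))) \<le> L\<^sub>F * B"
      using abs_first_unit_inner_le[of "drift (snd (y v))"] norm_drift[of "snd (y v)"]
        mult_left_mono[OF _ Lambda_nonneg, of "norm (snd (y v))" B] by simp
  qed (auto intro!: integrable_continuous_real continuous_on_output y)
  moreover have "integral {st (six s)..s} (\<lambda>_. L\<^sub>F * B) \<le> L\<^sub>F * t1 * B"
  proof -
    have "(s - st (six s)) * (L\<^sub>F * B) \<le> t1 * (L\<^sub>F * B)"
      using st s nn Lambda_nonneg by (intro mult_right_mono) auto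
    then show ?thesis using st by (simp add: algebra_simps)
  qed
  ultimately show ?thesis
    unfolding est_def
    using abs_triangle_ineq[of "jump y (six s)"
        "integral {st (six s)..s} (\<lambda>s. first_unit \<bullet> drift (snd (y s)))"]
    by (simp only: real_norm_def)
qed

lemma est_Lipschitz:
  assumes y: "continuous_on UNIV y" "continuous_on UNIV y'" and s: "0 \<le> s" "s \<le> t1"
    and B: "\<And>v. v \<in> {0..s} \<Longrightarrow> norm (y v - y' v) \<le> B"
  shows "\<bar>est y s - est y' s\<bar> \<le> B + L\<^sub>F * t1 * B"
proof -
  have st: "st (six s) \<le> s" "0 \<le> st (six s)"
    using sample_index[OF T1 b s(1)] sampling_time_nonneg[OF T1] by auto
  have nn: "0 \<le> B"
    using B[of s] s order_trans[OF norm_ge_zero] by auto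
  have comp: "norm (fst (y v) - fst (y' v)) \<le> B" "norm (snd (y v) - snd (y' v))
      \<le> B" if "v \<in> {0..s}" for v
    using B[OF that] norm_fst_diff_le[of "y v" "y' v"] norm_snd_diff_le[of "y v" "y' v"]
        by linarith+
  have "\<bar>jump y (six s) - jump y' (six s)\<bar> \<le> B"
  proof (cases "six s = 0")
    case False
    define v where "v = st (six s) - r"
    have v: "v \<in> {-r..s}" unfolding v_def using st delays by auto
    have "norm (pos y v - pos y' v) \<le> B"
      unfolding pos_def using comp(1)[of v] v nn by auto
    then have "\<bar>first_unit \<bullet> (pos y v - pos y' v)\<bar> \<le> B"
        using abs_first_unit_inner_le order_trans by blast
    then show ?thesis
      unfolding jump_def v_def[symmetric] using False by (simp add: inner_diff_right)
  qed (use nn in \<open>simp add: jump_def\<close>)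
  moreover have "norm (integral {st (six s)..s} (\<lambda>s. first_unit \<bullet> drift (snd (y s)))
      - integral {st (six s)..s} (\<lambda>s. first_unit \<bullet> drift (snd (y' s)))) \<le> L\<^sub>F * t1 * B"
  proof -
    have i: "(\<lambda>s. first_unit \<bullet> drift (snd (y s))) integrable_on {st (six s)..s}"
       "(\<lambda>s. first_unit \<bullet> drift (snd (y' s))) integrable_on {st (six s)..s}"
      by (intro integrable_continuous_real continuous_on_output y)+
    have "norm (integral {st (six s)..s} (\<lambda>s. first_unit \<bullet> drift (snd (y s)) - first_unit \<bullet> drift
        (snd (y' s))))
      \<le> integral {st (six s)..s} (\<lambda>_. L\<^sub>F * B)"
    proof (rule integral_norm_bound_integral[OF integrable_diff[OF i]])
      fix v assume v: "v \<in> {st (six s)..s}"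
      then have "norm (snd (y v) - snd (y' v)) \<le> B" using st by (intro comp) auto
      then show "norm (first_unit \<bullet> drift (snd (y v)) - first_unit \<bullet> drift (snd (y' v))) \<le> L\<^sub>F * B"
        using abs_first_unit_inner_le[of "drift (snd (y v)) - drift (snd (y' v))"]
          drift_Lipschitz[of "snd (y v)" "snd (y' v)"]
          mult_left_mono[OF _ Lambda_nonneg, of "norm (snd (y v) - snd (y' v))" B]
        by (simp add: inner_diff_right)
    qed auto
    moreover have "(s - st (six s)) * (L\<^sub>F * B) \<le> t1 * (L\<^sub>F * B)"
      using st s nn Lambda_nonneg by (intro mult_right_mono) auto
    ultimately show ?thesis using st by (simp add: integral_diff[OF i] algebra_simps)
  qed
  ultimately show ?thesis unfolding est_def by (simp only: real_norm_def)
qed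

text \<open>The input is bounded by a constant of the history, and \<open>est\<close> is affine in
  the supremum of the whole past, which \<open>H + B\<close> bounds.\<close>

lemma rhs_growth:
  assumes h: "continuous_on UNIV h"
  shows "\<exists>C\<ge>0. \<forall>y s B. continuous_on UNIV y \<longrightarrow> (\<forall>s\<le>real i * T2. y s = h s) \<longrightarrow>
    s \<in> {real i * T2..<real (Suc i) * T2} \<longrightarrow> (\<forall>v\<in>{real i * T2..s}. norm (y v) \<le> B) \<longrightarrow>
    norm (rhs s y) \<le> C * (1 + B)"
proof -
  define t0 where "t0 = real i * T2"
  define t1 where "t1 = real (Suc i) * T2"
  have t01: "0 \<le> t0" "0 \<le> t1" "t0 \<le> t1" unfolding t0_def t1_def using T2 by auto
  obtain U where U: "U \<ge> 0" "\<And>t. t \<in> {-hor..<t1} \<Longrightarrow> \<bar>inp h t\<bar> \<le> U"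
    using inp_bounded[of "Suc i" h] unfolding t1_def by blast
  obtain D where D: "D \<ge> 0" "\<And>s. s \<in> {0..t1} \<Longrightarrow> norm (d s) \<le> D"
    using L_inf_locD(2)[OF d, of t1] by blast
  obtain \<Xi> where \<Xi>: "\<Xi> \<ge> 0" "\<And>s. s \<in> {0..t1} \<Longrightarrow> \<bar>\<xi> s\<bar> \<le> \<Xi>"
    using L_inf_locD(2)[OF \<xi>, of t1] by auto
  have "bounded (x0 ` {-r..0})" by (intro compact_imp_bounded compact_continuous_image x0) auto
  then obtain X0 where X0: "\<And>s. s \<in> {-r..0} \<Longrightarrow> norm (x0 s) \<le> X0" unfolding bounded_iff by blast
  have "bounded (h ` {0..t0})"
    by (intro compact_imp_bounded compact_continuous_image continuous_on_subset[OF h]) auto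
  then obtain H where H: "\<And>s. s \<in> {0..t0} \<Longrightarrow> norm (h s) \<le> H" unfolding bounded_iff by blast
  have H0: "H \<ge> 0" using H[of 0] t01 order_trans[OF norm_ge_zero] by auto
  have X00: "X0 \<ge> 0" using X0[of 0] delays order_trans[OF norm_ge_zero] by auto
  define E where "E = \<bar>w0\<bar> + X0 + \<Xi> + (H + L\<^sub>F * t1 * H)"
  define C where "C = L\<^sub>F * (H + 1) + G * D + U + L\<^sub>F * (H + 1) + ((H + 1) + (E + (1
      + L\<^sub>F * t1))) * norm p\<theta> + U"
  have E0: "E \<ge> 0" unfolding E_def using X00 \<Xi> H0 Lambda_nonneg t01 by simp
  have bnd: "norm (rhs s y) \<le> C * (1 + B)"
    if y: "continuous_on UNIV y" and eq: "\<And>s. s \<le> t0 \<Longrightarrow> y s = h s" and s: "s \<in> {t0..<t1}"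
      and B: "\<And>v. v \<in> {t0..s} \<Longrightarrow> norm (y v) \<le> B" for y s B
  proof -
    have B0: "B \<ge> 0" using B[of s] s order_trans[OF norm_ge_zero] by auto
    have all: "norm (y v) \<le> H + B" if "v \<in> {0..s}" for v
    proof (cases "v \<le> t0")
      case True
      then show ?thesis using eq[OF True] H[of v] that B0 by simp
    next
      case False
      then show ?thesis using B[of v] that H0 by simp
    qed
    have fs: "norm (fst (y s)) \<le> H + B" "norm (snd (y s)) \<le> H + B"
      using all[of s] s t01 norm_fst_le[of "fst (y s)" "snd (y s)"] norm_snd_le[of "snd (y s)"
          "fst (y s)"]
      by auto
    have HB: "H + B \<le> (H + 1) * (1 + B)" using H0 B0 by (simp add: algebra_simps)
    have dr: "norm (drift v) \<le> L\<^sub>F * (H + 1) * (1 + B)" if "norm v \<le> H + B" for v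
      using norm_drift[of v] mult_left_mono[OF order_trans[OF that HB] Lambda_nonneg]
      by (simp add: mult.assoc)
    have inp: "\<bar>inp y v\<bar> \<le> U * (1 + B)" if "v \<in> {-hor..s}" for v
    proof -
      have "inp y v = inp h v" by (rule inp_stage) (use eq s that in \<open>auto simp: t0_def t1_def\<close>)
      then have "\<bar>inp y v\<bar> \<le> U" using U(2)[of v] that s by auto
      also have "\<dots> \<le> U * (1 + B)" using U B0 by (simp add: distrib_left)
      finally show ?thesis .
    qed
    have dd: "norm (diag (\<chi> i. g i (fst (y s)) (inp y s)) *v d s) \<le> G * D * (1 + B)"
    proof -
      have "norm (diag (\<chi> i. g i (fst (y s)) (inp y s)) *v d s) \<le> G * norm (d s)"
          by (rule g_diag_bound)
      also have "\<dots> \<le> G * D" using D(2)[of s] s t01 G_nonneg by (intro mult_left_mono) auto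
      also have "\<dots> \<le> G * D * (1 + B)" using D G_nonneg B0 by (simp add: distrib_left)
      finally show ?thesis .
    qed
    have w: "\<bar>est y s\<bar> \<le> (E + (1 + L\<^sub>F * t1)) * (1 + B)"
    proof -
      have "\<bar>est y s\<bar> \<le> \<bar>w0\<bar> + X0 + \<Xi> + (H + B) + L\<^sub>F * t1 * (H + B)"
        by (rule est_bound[OF y]) (use s t01 X0 \<Xi>(2) all in auto)
      also have "\<dots> = E + (1 + L\<^sub>F * t1) * B" unfolding E_def by (simp add: algebra_simps)
      also have "\<dots> \<le> (E + (1 + L\<^sub>F * t1)) * (1 + B)"
      proof -
        have "E + c * B \<le> (E + c) * (1 + B)" if "c \<ge> 0" for c
          using that mult_nonneg_nonneg[OF E0 B0] by (simp add: algebra_simps)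
        moreover have "0 \<le> 1 + L\<^sub>F * t1" using mult_nonneg_nonneg[OF Lambda_nonneg t01(2)]
            by linarith
        ultimately show ?thesis by blast
      qed
      finally show ?thesis .
    qed
    have "norm (first_unit \<bullet> snd (y s) - est y s) \<le> ((H + 1) + (E + (1 + L\<^sub>F * t1))) * (1 + B)"
      using abs_first_unit_inner_le[of "snd (y s)"] fs(2) HB w
        abs_triangle_ineq4[of "first_unit \<bullet> snd (y s)" "est y s"]
      unfolding real_norm_def distrib_right[of "H + 1"] by linarith
    then have inj: "norm ((first_unit \<bullet> snd (y s) - est y s) *\<^sub>R p\<theta>)
        \<le> ((H + 1) + (E + (1 + L\<^sub>F * t1))) * norm p\<theta> * (1 + B)"
      by (intro norm_scaleR_le) simp
    have "norm (rhs s y) \<le> (L\<^sub>F * (H + 1) * (1 + B) + G * D * (1 + B) + U * (1 + B))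
        + (L\<^sub>F * (H + 1) * (1 + B) + ((H + 1) + (E + (1 + L\<^sub>F * t1))) * norm p\<theta> * (1 + B) + U * (1
            + B))"
      unfolding rhs_def
      by (rule order_trans[OF norm_Pair_le], intro add_mono norm_triangle_le dr fs dd inj)
        (use inp[of "s - \<tau>"] inp[of "s - hor"] s t01 delays in auto)
    also have "\<dots> = C * (1 + B)" unfolding C_def by algebra
    finally show ?thesis .
  qed
  have "C \<ge> 0"
    unfolding C_def using L H0 G_nonneg D(1) U(1) E0 t01
    by (intro add_nonneg_nonneg mult_nonneg_nonneg) auto
  then show ?thesis
    unfolding t0_def[symmetric] t1_def[symmetric] using bnd by (intro exI[of _ C]) blast
qed

text \<open>Two candidates with the same history have the same input, so the control terms cancel.
  What remains is the drift, the estimate of \<open>w\<close>, and the coefficients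
  \<open>g\<close>, whose Lipschitz constant exists because the states are bounded by
  \<open>R\<close> and the input by \<open>U\<close>.\<close>

lemma rhs_Lipschitz:
  assumes h: "continuous_on UNIV h"
  shows "\<exists>C\<ge>0. \<forall>y y' s B. continuous_on UNIV y \<longrightarrow> (\<forall>s\<le>real i * T2. y s = h s) \<longrightarrow>
    continuous_on UNIV y' \<longrightarrow> (\<forall>s\<le>real i * T2. y' s = h s) \<longrightarrow>
    s \<in> {real i * T2..<real (Suc i) * T2} \<longrightarrow>
    (\<forall>v\<in>{real i * T2..s}. norm (y v) \<le> R \<and> norm (y' v) \<le> R) \<longrightarrow>
    (\<forall>v\<in>{real i * T2..s}. norm (y v - y' v) \<le> B) \<longrightarrow> norm (rhs s y - rhs s y') \<le> C * B"
proof -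
  define t0 where "t0 = real i * T2"
  define t1 where "t1 = real (Suc i) * T2"
  have t01: "0 \<le> t0" "0 \<le> t1" "t0 \<le> t1" unfolding t0_def t1_def using T2 by auto
  obtain U where U: "U \<ge> 0" "\<And>t. t \<in> {-hor..<t1} \<Longrightarrow> \<bar>inp h t\<bar> \<le> U"
    using inp_bounded[of "Suc i" h] unfolding t1_def by blast
  obtain D where D: "D \<ge> 0" "\<And>s. s \<in> {0..t1} \<Longrightarrow> norm (d s) \<le> D"
    using L_inf_locD(2)[OF d, of t1] by blast
  obtain Cg where Cg: "Cg \<ge> 0" "\<And>x x' u d. norm x \<le> R \<Longrightarrow> norm x' \<le> R \<Longrightarrow> \<bar>u\<bar> \<le> U \<Longrightarrow>
    norm (diag (\<chi> i. g i x u) *v d - diag (\<chi> i. g i x' u) *v d) \<le> Cg * norm (x - x') * norm d"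
    using g_diag_Lipschitz[of R U] by blast
  define C where "C = L\<^sub>F + Cg * D + L\<^sub>F + (1 + (1 + L\<^sub>F * t1)) * norm p\<theta>"
  have bnd: "norm (rhs s y - rhs s y') \<le> C * B"
    if y: "continuous_on UNIV y" "continuous_on UNIV y'"
      and eq: "\<And>s. s \<le> t0 \<Longrightarrow> y s = h s" and eq': "\<And>s. s \<le> t0 \<Longrightarrow> y' s = h s" and s: "s \<in> {t0..<t1}"
      and R: "\<And>v. v \<in> {t0..s} \<Longrightarrow> norm (y v) \<le> R \<and> norm (y' v) \<le> R"
      and B: "\<And>v. v \<in> {t0..s} \<Longrightarrow> norm (y v - y' v) \<le> B" for y y' s B
  proof -
    have B0: "B \<ge> 0" using B[of s] s order_trans[OF norm_ge_zero] by auto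
    have all: "norm (y v - y' v) \<le> B" if "v \<in> {0..s}" for v
      using eq[of v] eq'[of v] B[of v] that B0 by (cases "v \<le> t0") auto
    have fs: "norm (fst (y s) - fst (y' s)) \<le> B" "norm (snd (y s) - snd (y' s)) \<le> B"
      using all[of s] s t01 norm_fst_diff_le[of "y s" "y' s"] norm_snd_diff_le[of "y s" "y' s"]
          by auto
    have fR: "norm (fst (y s)) \<le> R" "norm (fst (y' s)) \<le> R"
      using R[of s] s norm_fst_le[of "fst (y s)" "snd (y s)"] norm_fst_le[of "fst (y' s)"
          "snd (y' s)"] by auto
    have dr: "norm (drift v - drift v') \<le> L\<^sub>F * B" if "norm (v - v') \<le> B" for v v'
      using drift_Lipschitz[of v v'] mult_left_mono[OF that Lambda_nonneg] by linarith
    have inp: "inp y v = inp h v" "inp y' v = inp h v" if "v \<le> s" for v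
    proof -
      have v: "v < real (Suc i) * T2" using s that unfolding t1_def by auto
      show "inp y v = inp h v" by (rule inp_stage[OF eq[unfolded t0_def] v])
      show "inp y' v = inp h v" by (rule inp_stage[OF eq'[unfolded t0_def] v])
    qed
    have dd: "norm (diag (\<chi> i. g i (fst (y s)) (inp h s)) *v d s - diag (\<chi> i. g i (fst (y' s))
        (inp h s)) *v d s)
        \<le> Cg * D * B"
    proof -
      have "norm (diag (\<chi> i. g i (fst (y s)) (inp h s)) *v d s - diag (\<chi> i. g i (fst (y' s))
          (inp h s)) *v d s)
        \<le> Cg * norm (fst (y s) - fst (y' s)) * norm (d s)"
        by (rule Cg(2)[OF fR]) (use U(2)[of s] s t01 delays in auto)
      also have "\<dots> \<le> Cg * B * D"
        using D(2)[of s] s t01 Cg(1) B0 fs by (intro mult_mono) auto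
      finally show ?thesis by (simp add: mult_ac)
    qed
    have "\<bar>est y s - est y' s\<bar> \<le> B + L\<^sub>F * t1 * B"
      by (rule est_Lipschitz[OF y]) (use s t01 all in auto)
    then have "norm ((first_unit \<bullet> snd (y s) - est y s) - (first_unit \<bullet> snd (y' s) - est y' s))
        \<le> (1 + (1 + L\<^sub>F * t1)) * B"
      using abs_first_unit_inner_le[of "snd (y s) - snd (y' s)"] fs(2)
        abs_triangle_ineq4[of "first_unit \<bullet> (snd (y s) - snd (y' s))" "est y s - est y' s"]
      by (simp add: inner_diff_right distrib_right algebra_simps)
    then have inj: "norm ((first_unit \<bullet> snd (y s) - est y s) *\<^sub>R p\<theta> - (first_unit \<bullet> snd
        (y' s) - est y' s) *\<^sub>R p\<theta>)
        \<le> (1 + (1 + L\<^sub>F * t1)) * norm p\<theta> * B"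
      unfolding scaleR_diff_left[symmetric] by (intro norm_scaleR_le) simp
    have "rhs s y - rhs s y' =
      ((drift (fst (y s)) - drift (fst (y' s)))
          + (diag (\<chi> i. g i (fst (y s)) (inp h s)) *v d s - diag (\<chi> i. g i (fst (y' s))
          (inp h s)) *v d s),
       (drift (snd (y s)) - drift (snd (y' s)))
           + ((first_unit \<bullet> snd (y s) - est y s) *\<^sub>R p\<theta> - (first_unit \<bullet> snd
           (y' s) - est y' s) *\<^sub>R p\<theta>))"
      unfolding rhs_def using inp[of s] inp[of "s - \<tau>"] inp[of "s - hor"] delays by simp
    also have "norm \<dots> \<le> (L\<^sub>F * B + Cg * D * B) + (L\<^sub>F * B + (1 + (1 + L\<^sub>F * t1)) * norm p\<theta> * B)"
      by (rule order_trans[OF norm_Pair_le], intro add_mono norm_triangle_le dr fs dd inj)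
    also have "\<dots> = C * B" unfolding C_def by (simp add: distrib_right)
    finally show ?thesis .
  qed
  have "C \<ge> 0"
    unfolding C_def using L Cg(1) D(1) t01
    by (intro add_nonneg_nonneg mult_nonneg_nonneg) auto
  then show ?thesis
    unfolding t0_def[symmetric] t1_def[symmetric] using bnd by (intro exI[of _ C]) blast
qed

lemma closed_loop_exists:
  "\<exists>x u z w. closed_loop_solution f g r \<tau> p \<theta> T1 T2 l m k x0 u0 z0 w0 \<xi> b d x u z w"
proof -
  have "\<exists>y. continuous_on UNIV y \<and> y 0 = (x0 0, z0) \<and> ac_derivative_on {0..} y (\<lambda>s. rhs s y)"
    by (rule functional_ode_global[OF T2, where F = rhs and ?y0.0 = "(x0 0, z0)"])
      (fact rhs_causal, fact rhs_integrable, fact rhs_growth, fact rhs_Lipschitz, blast)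
  then obtain y where y: "continuous_on UNIV y" "y 0
      = (x0 0, z0)" "ac_derivative_on {0..} y (\<lambda>s. rhs s y)"
    by blast
  have Ici: "{s..t} \<subseteq> {0..}" if "s \<in> {0..}" for s t :: real using that by auto
  have plant: "plant_solution f g \<tau> d (inp y) (pos y)"
    unfolding plant_solution_def
    by (rule ac_derivative_on_cong[OF ac_derivative_on_linear[OF y(3) bounded_linear_fst]])
      (auto simp: pos_def rhs_def drift_def algebra_simps intro: Ici)
  have z: "ac_derivative_on {0..} (\<lambda>t. snd (y t)) (\<lambda>t. fvec f (snd (y t)) + chain *v snd (y t)
      + (\<chi> i. \<theta> ^ idx i * p $ i * (first_unit \<bullet> snd (y t) - est y t))
          + inp y (t - r - \<tau>) *\<^sub>R last_unit)"
    unfolding injection_eq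
    by (rule ac_derivative_on_cong[OF ac_derivative_on_linear[OF y(3) bounded_linear_snd]])
      (auto simp: rhs_def drift_def algebra_simps intro: Ici)
  have w: "ac_derivative_on {st i..<st (Suc i)} (est y)
      (\<lambda>t. first_unit \<bullet> (fvec f (snd (y t)) + chain *v snd (y t)))" for i
    unfolding ac_derivative_on_def drift_def[symmetric]
  proof (intro ballI impI conjI)
    fix s t assume st: "s \<in> {st i..<st (Suc i)}" "t \<in> {st i..<st (Suc i)}" "s \<le> t"
    show "(\<lambda>t. first_unit \<bullet> drift (snd (y t))) absolutely_integrable_on {s..t}"
      by (intro absolutely_integrable_continuous_real continuous_on_output y)
    have "integral {st i..s} (\<lambda>t. first_unit \<bullet> drift (snd (y t)))
        + integral {s..t} (\<lambda>t. first_unit \<bullet> drift (snd (y t)))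
        = integral {st i..t} (\<lambda>t. first_unit \<bullet> drift (snd (y t)))"
      by (rule Henstock_Kurzweil_Integration.integral_combine)
        (use st in \<open>auto intro!: integrable_continuous_real continuous_on_output y\<close>)
    then show "est y t = est y s + integral {s..t} (\<lambda>t. first_unit \<bullet> drift (snd (y t)))"
      using est_eq[OF st(1), of y] est_eq[OF st(2), of y] by simp
  qed
  have jumps: "est y (st (Suc i)) = first_unit \<bullet> pos y (st (Suc i) - r) + \<xi> (st (Suc i))" for i
  proof -
    have "st (Suc i) \<in> {st (Suc i)..<st (Suc (Suc i))}" using T1 by simp
    from est_eq[OF this, of y] show ?thesis by (simp add: jump_def)
  qed
  have "est y 0 = w0"
    using est_eq[of 0 0 y] T1 by (simp add: jump_def)
  moreover have "control_law f l m (r + \<tau>) T2 k (\<lambda>t. snd (y t)) (inp y)"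
    unfolding control_law_def using inp_held unfolding feedback_def by blast
  moreover have "observer_solution f p \<theta> T1 r \<tau> \<xi> b (pos y) (inp y) (\<lambda>t. snd (y t)) (est y)"
    unfolding observer_solution_def using z w jumps by blast
  ultimately have "closed_loop_solution f g r \<tau> p \<theta> T1 T2 l m k x0 u0 z0 w0 \<xi> b d
      (pos y) (inp y) (\<lambda>t. snd (y t)) (est y)"
    unfolding closed_loop_solution_def using plant y(2) by (auto simp: pos_def inp_neg)
  then show ?thesis by blast
qed

end

section \<open>Bounds on bounded time intervals\<close>

lemma exp_mult_imp_le: "exp (\<sigma> * s) * c \<le> E \<Longrightarrow> c \<le> exp (- \<sigma> * s) * (E :: real)"
  by (simp add: exp_minus field_simps)

context sampled_loop
begin

text \<open>The initial data are read off from the signals themselves, so that the estimates need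
  not mention them separately.\<close>

definition traj :: "(real \<Rightarrow> real) \<Rightarrow> (real \<Rightarrow> real) \<Rightarrow> (real \<Rightarrow> 'n rvec) \<Rightarrow>
    (real \<Rightarrow> 'n rvec) \<Rightarrow> (real \<Rightarrow> real) \<Rightarrow> (real \<Rightarrow> 'n rvec) \<Rightarrow> (real \<Rightarrow> real) \<Rightarrow> bool" where
  "traj \<xi> b d x u z w \<longleftrightarrow> continuous_on {-r..0} x \<and> L_inf {-hor..<0} u \<and>
     L_inf_loc {0..} b \<and> (\<forall>s\<ge>0. b s \<ge> 0) \<and> L_inf_loc {0..} d \<and>
     plant_solution f g \<tau> d u x \<and> observer_solution f p \<theta> T1 r \<tau> \<xi> b x u z w \<and>
     control_law f l m hor T2 k z u"

definition data_bound :: "real \<Rightarrow> real \<Rightarrow> real \<Rightarrow> (real \<Rightarrow> real) \<Rightarrow> (real \<Rightarrow> 'n rvec) \<Rightarrow>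
    (real \<Rightarrow> 'n rvec) \<Rightarrow> (real \<Rightarrow> real) \<Rightarrow> (real \<Rightarrow> 'n rvec) \<Rightarrow> (real \<Rightarrow> real) \<Rightarrow> bool" where
  "data_bound \<sigma> E t \<xi> d x u z w \<longleftrightarrow>
     (\<forall>s\<in>{0..t}. exp (\<sigma> * s) * \<bar>\<xi> s\<bar> \<le> E \<and> exp (\<sigma> * s) * norm (d s) \<le> E) \<and>
     (\<forall>s\<in>{-r..0}. norm (x s) \<le> E) \<and> (\<forall>s\<in>{-hor..<0}. \<bar>u s\<bar> \<le> E) \<and>
     norm (z 0) \<le> E \<and> \<bar>w 0\<bar> \<le> E"

lemma data_bound_mono:
  assumes "data_bound \<sigma> E t \<xi> d x u z w" "t' \<le> t" "0 \<le> \<sigma>' " "\<sigma>' \<le> \<sigma>"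
  shows "data_bound \<sigma>' E t' \<xi> d x u z w"
proof -
  have "exp (\<sigma>' * s) * c \<le> E" if "0 \<le> s" "0 \<le> c" "exp (\<sigma> * s) * c \<le> E" for s c
  proof -
    have "exp (\<sigma>' * s) * c \<le> exp (\<sigma> * s) * c"
      using assms(3,4) that by (intro mult_right_mono) (auto intro: mult_right_mono)
    then show ?thesis using that by linarith
  qed
  then show ?thesis using assms unfolding data_bound_def by auto
qed

lemma data_bound_nonneg: "data_bound \<sigma> E t \<xi> d x u z w \<Longrightarrow> 0 \<le> E"
  unfolding data_bound_def using norm_ge_zero order_trans by blast

lemma data_boundD:
  assumes "data_bound 0 E t \<xi> d x u z w"
  shows "s \<in> {0..t} \<Longrightarrow> \<bar>\<xi> s\<bar> \<le> E" "s \<in> {0..t} \<Longrightarrow> norm (d s) \<le> E"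
    "s \<in> {-r..0} \<Longrightarrow> norm (x s) \<le> E" "s \<in> {-hor..<0} \<Longrightarrow> \<bar>u s\<bar> \<le> E" "norm (z 0) \<le> E" "\<bar>w 0\<bar> \<le> E"
  using assms unfolding data_bound_def by auto

context
  fixes \<xi> b :: "real \<Rightarrow> real" and d x :: "real \<Rightarrow> 'n rvec" and u :: "real \<Rightarrow> real"
    and z :: "real \<Rightarrow> 'n rvec" and w :: "real \<Rightarrow> real"
  assumes tr: "traj \<xi> b d x u z w"
begin

abbreviation "\<delta> \<equiv> \<lambda>s. diag (\<chi> i. g i (x s) (u s)) *v d s"

lemma plant_ac: "ac_derivative_on {0..} x (\<lambda>t. drift (x t) + \<delta> t + u (t - \<tau>) *\<^sub>R last_unit)"
  using tr unfolding traj_def plant_solution_def drift_def by simp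

lemma observer_ac: "ac_derivative_on {0..} z
   (\<lambda>t. drift (z t) + (first_unit \<bullet> z t - w t) *\<^sub>R p\<theta> + u (t - hor) *\<^sub>R last_unit)"
  using tr unfolding traj_def observer_solution_def drift_def injection_eq
      by (simp add: diff_diff_eq)

lemma traj_sampling: "L_inf_loc {0..} b" "s \<ge> 0 \<Longrightarrow> b s \<ge> 0" "L_inf_loc {0..} d"
  using tr unfolding traj_def by auto

lemma w_eq:
  assumes "s \<in> {sampling_time T1 b i..<sampling_time T1 b (Suc i)}"
  shows "(\<lambda>s. first_unit \<bullet> drift (z s)) integrable_on {sampling_time T1 b i..s}"
    "w s = w (sampling_time T1 b i) + integral {sampling_time T1 b i..s} (\<lambda>s. first_unit \<bullet> drift
        (z s))"
proof -
  have ac: "ac_derivative_on {sampling_time T1 b i..<sampling_time T1 b (Suc i)} w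
      (\<lambda>t. first_unit \<bullet> drift (z t))"
    using tr unfolding traj_def observer_solution_def drift_def by blast
  have i: "sampling_time T1 b i \<in> {sampling_time T1 b i..<sampling_time T1 b (Suc i)}"
      using T1 by simp
  show "(\<lambda>s. first_unit \<bullet> drift (z s)) integrable_on {sampling_time T1 b i..s}"
    "w s = w (sampling_time T1 b i) + integral {sampling_time T1 b i..s} (\<lambda>s. first_unit \<bullet> drift
        (z s))"
    using ac_derivative_onD(2,3)[OF ac i assms] assms by auto
qed

lemma w_sample: "w (sampling_time T1 b (Suc i))
    = first_unit \<bullet> x (sampling_time T1 b (Suc i) - r) + \<xi> (sampling_time T1 b (Suc i))"
  using tr unfolding traj_def observer_solution_def by blast

lemma u_held: "t \<in> {real i * T2..<real (Suc i) * T2} \<Longrightarrow>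
    u t = k \<bullet> Phi_pred f l m hor (z (real i * T2)) (shift (real i * T2) u)"
  using tr unfolding traj_def control_law_def by (simp add: add.commute)

lemma u_integrable:
  assumes "-hor \<le> c"
  shows "u absolutely_integrable_on {c..t}"
proof -
  have pieces: "u absolutely_integrable_on {real 0 * T2..real M * T2}" for M
  proof (rule absolutely_integrable_piecewise)
    show "real i * T2 \<le> real (Suc i) * T2" for i using T2 by (intro mult_right_mono) auto
    fix i
    have "(\<lambda>_. k \<bullet> Phi_pred f l m hor (z (real i * T2)) (shift (real i * T2) u))
        absolutely_integrable_on {real i * T2..real (Suc i) * T2}"
      by (intro absolutely_integrable_continuous_real continuous_on_const)
    then show "u absolutely_integrable_on {real i * T2..real (Suc i) * T2}"
      by (rule absolutely_integrable_spike[of _ _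
          "{real (Suc i) * T2}"]) (use u_held[of _ i] in auto)
  qed
  have neg: "u absolutely_integrable_on {-hor..0}"
    using tr unfolding traj_def by (intro L_infD(1)) auto
  obtain M :: nat where M: "t < real M * T2" using hold_intervals_cover by blast
  have "u absolutely_integrable_on {-hor..real M * T2}"
    by (rule absolutely_integrable_on_combine[OF neg]) (use pieces[of M] delays T2 in auto)
  then show ?thesis
    by (rule absolutely_integrable_on_subinterval) (use assms M in auto)
qed

lemma z_continuous: "continuous_on {0..} z"
  by (rule ac_derivative_on_continuous_atLeast[OF observer_ac])

lemma x_bound:
  assumes D: "data_bound 0 E t \<xi> d x u z w" and t: "t \<le> S" and U: "\<And>s. s \<in> {-hor..<t} \<Longrightarrow> \<bar>u s\<bar> \<le> U"
    and s: "s \<in> {0..t}"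
  shows "norm (x s) \<le> (E + (G * E + U) * S) * exp (L\<^sub>F * S)"
proof -
  note DD = data_boundD[OF D] and E0 = data_bound_nonneg[OF D]
  have U0: "U \<ge> 0"
    by (rule order_trans[OF abs_ge_zero U[of "-hor"]]) (use s delays in auto)
  have GE: "G * E + U \<ge> 0" using G_nonneg E0 U0 by simp
  \<comment> \<open>If \<tau> = 0, the derivative at \<open>t\<close> involves \<open>u t\<close>,
    which the bound \<open>U\<close> does not cover. The derivative is set to 0 at this one
    point.\<close>
  have "ac_derivative_on {0..t} x (\<lambda>s. if s < t then drift (x s) + \<delta> s
      + u (s - \<tau>) *\<^sub>R last_unit else 0)"
    by (rule ac_derivative_on_spike[OF ac_derivative_on_subset[OF plant_ac], of _ "{t}"]) auto
  then have "norm (x s) \<le> (norm (x 0) + (G * E + U) * (t - 0)) * exp (L\<^sub>F * (t - 0))"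
  proof (rule ac_derivative_on_gronwall[OF _ Lambda_nonneg GE _ s])
    fix v assume v: "v \<in> {0..t}"
    show "norm (if v < t then drift (x v) + \<delta> v + u (v - \<tau>) *\<^sub>R last_unit else 0)
        \<le> L\<^sub>F * norm (x v) + (G * E + U)"
    proof (cases "v < t")
      case True
      have "norm (\<delta> v) \<le> G * E"
        using g_diag_bound order_trans mult_left_mono[OF DD(2)[OF v] G_nonneg] by blast
      moreover have "norm (u (v - \<tau>) *\<^sub>R last_unit :: 'n rvec) \<le> U"
          using U[of "v - \<tau>"] True v delays by auto
      moreover have "norm (drift (x v) + \<delta> v + u (v - \<tau>) *\<^sub>R last_unit)
          \<le> norm (drift (x v)) + norm (\<delta> v) + norm (u (v - \<tau>) *\<^sub>R last_unit :: 'n rvec)"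
        by (intro norm_triangle_le add_mono) auto
      ultimately have "norm (drift (x v) + \<delta> v + u (v - \<tau>) *\<^sub>R last_unit)
          \<le> L\<^sub>F * norm (x v) + (G * E + U)"
        using norm_drift[of "x v"] by linarith
      then show ?thesis using True by simp
    next
      case False
      have "0 \<le> L\<^sub>F * norm (x v) + (G * E + U)"
        using GE mult_nonneg_nonneg[OF Lambda_nonneg norm_ge_zero[of "x v"]] by linarith
      then show ?thesis using False by simp
    qed
  qed
  also have "\<dots> \<le> (E + (G * E + U) * S) * exp (L\<^sub>F * S)"
  proof (rule mult_mono)
    show "norm (x 0) + (G * E + U) * (t - 0) \<le> E + (G * E + U) * S"
      using DD(3)[of 0] delays GE t by (intro add_mono mult_left_mono) auto
    show "exp (L\<^sub>F * (t - 0)) \<le> exp (L\<^sub>F * S)"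
      using mult_left_mono[OF t Lambda_nonneg] by simp
  qed (use E0 GE s t in auto)
  finally show ?thesis .
qed

lemma w_bound:
  assumes D: "data_bound 0 E t \<xi> d x u z w" and X: "\<And>s. s \<in> {0..t} \<Longrightarrow> norm (x s) \<le> X"
    and s: "s \<in> {0..t}"
  shows "\<bar>w s\<bar> \<le> 2 * E + X + L\<^sub>F * integral {0..s} (\<lambda>v. norm (z v))"
proof -
  note DD = data_boundD[OF D] and E0 = data_bound_nonneg[OF D]
  have X0: "X \<ge> 0" by (rule order_trans[OF norm_ge_zero X[OF s]])
  define i where "i = sample_index T1 b s"
  define v0 where "v0 = sampling_time T1 b i"
  have s0: "s \<ge> 0" using s by auto
  have i: "v0 \<le> s" "s < sampling_time T1 b (Suc i)" "v0 \<ge> 0"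
    using sample_index[OF T1 traj_sampling(1) s0] sampling_time_nonneg[OF T1] unfolding i_def
        v0_def by auto
  have zi: "(\<lambda>v. norm (z v)) integrable_on {c..s}" if "c \<ge> 0" for c
    by (intro integrable_continuous_real continuous_on_norm continuous_on_subset[OF z_continuous])
        (use that in auto)
  have "\<bar>w v0\<bar> \<le> 2 * E + X"
  proof (cases i)
    case 0
    then show ?thesis unfolding v0_def using DD(6) E0 X0 by simp
  next
    case (Suc j)
    have v0: "v0 \<in> {0..t}" using i s by auto
    have "norm (x (v0 - r)) \<le> E + X"
      using DD(3)[of "v0 - r"] X[of "v0 - r"] v0 delays E0 X0 by (cases "v0 - r \<le> 0") auto
    then show ?thesis
      using w_sample[of j] DD(1)[OF v0] abs_first_unit_inner_le[of "x (v0 - r)"]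
        abs_triangle_ineq[of "first_unit \<bullet> x (v0 - r)" "\<xi> v0"] E0 unfolding v0_def Suc by linarith
  qed
  moreover have "norm (integral {v0..s} (\<lambda>s. first_unit \<bullet> drift (z s)))
      \<le> integral {v0..s} (\<lambda>v. L\<^sub>F * norm (z v))"
  proof (rule integral_norm_bound_integral)
    show "(\<lambda>s. first_unit \<bullet> drift (z s)) integrable_on {v0..s}"
      using w_eq(1)[of s i] i unfolding v0_def by auto
    show "(\<lambda>v. L\<^sub>F * norm (z v)) integrable_on {v0..s}" by (intro integrable_on_mult_right zi i)
    show "norm (first_unit \<bullet> drift (z v)) \<le> L\<^sub>F * norm (z v)" for v
      using abs_first_unit_inner_le[of "drift (z v)"] norm_drift[of "z v"]
          by (simp only: real_norm_def)
  qed
  moreover have "integral {v0..s} (\<lambda>v. L\<^sub>F * norm (z v)) \<le> L\<^sub>F * integral {0..s} (\<lambda>v. norm (z v))"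
    using integral_subset_le[of "{v0..s}" "{0..s}" "\<lambda>v. norm (z v)"] i zi Lambda_nonneg
    by (simp add: mult_left_mono)
  moreover have "w s = w v0 + integral {v0..s} (\<lambda>s. first_unit \<bullet> drift (z s))"
    using w_eq(2)[of s i] i unfolding v0_def by auto
  ultimately show ?thesis
    using abs_triangle_ineq[of "w v0" "integral {v0..s} (\<lambda>s. first_unit \<bullet> drift (z s))"]
    unfolding real_norm_def by linarith
qed

text \<open>Inserting \<open>w_bound\<close> leaves an integral of |z| inside the integral over
  time. Replacing the inner one by its value \<open>J\<close> at the final time turns the inequality
  into an ordinary Gronwall inequality, at the price of the term
  \<open>norm p\<theta> * L\<^sub>F * S\<close> in the rate.\<close>

lemma z_bound:
  assumes D: "data_bound 0 E t \<xi> d x u z w" and t: "t \<le> S" and X: "\<And>s. s \<in> {0..t} \<Longrightarrow> norm (x s) \<le> X"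
    and U: "\<And>s. s \<in> {-hor..<t} \<Longrightarrow> \<bar>u s\<bar> \<le> U" and s: "s \<in> {0..t}"
  shows "norm (z s) \<le> (E + (norm p\<theta> * (2 * E + X) + U) * S)
    * exp ((L\<^sub>F + norm p\<theta> + norm p\<theta> * L\<^sub>F * S) * S)"
proof -
  note DD = data_boundD[OF D] and E0 = data_bound_nonneg[OF D]
  define N where "N = norm p\<theta>"
  define C where "C = L\<^sub>F + N + N * L\<^sub>F * S"
  define A where "A = E + (N * (2 * E + X) + U) * S"
  have N0: "N \<ge> 0" unfolding N_def by simp
  have S0: "S \<ge> 0" using s t by auto
  have X0: "X \<ge> 0" by (rule order_trans[OF norm_ge_zero X[OF s]])
  have U0: "U \<ge> 0"
    by (rule order_trans[OF abs_ge_zero U[of "-hor"]]) (use s delays in auto)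
  have C0: "C \<ge> 0" unfolding C_def using N0 S0 L
      by (intro add_nonneg_nonneg mult_nonneg_nonneg) auto
  have A0: "A \<ge> 0" unfolding A_def using N0 S0 E0 X0 U0
      by (intro add_nonneg_nonneg mult_nonneg_nonneg) auto
  have zc: "continuous_on {0..t} (\<lambda>s. norm (z s))"
    by (intro continuous_on_norm continuous_on_subset[OF z_continuous]) auto
  have "norm (z v) \<le> A + C * integral {0..v} (\<lambda>v. norm (z v))" if v: "v \<in> {0..t}" for v
  proof -
    define J where "J = integral {0..v} (\<lambda>v. norm (z v))"
    have zi: "(\<lambda>v. norm (z v)) integrable_on {0..c}" if "c \<le> v" for c
      by (intro integrable_continuous_real continuous_on_subset[OF zc]) (use v that in auto)
    have J0: "J \<ge> 0" unfolding J_def by (intro integral_nonneg zi) auto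
    define B where "B = N * (2 * E + X + L\<^sub>F * J) + U"
    have i: "(\<lambda>t. drift (z t) + (first_unit \<bullet> z t - w t) *\<^sub>R p\<theta>
        + u (t - hor) *\<^sub>R last_unit) integrable_on {0..v}"
      and zv: "z v = z 0 + integral {0..v} (\<lambda>t. drift (z t) + (first_unit \<bullet> z t - w t) *\<^sub>R p\<theta>
          + u (t - hor) *\<^sub>R last_unit)"
      by (rule ac_derivative_onD[OF observer_ac]; use v in simp)+
    have "norm (integral {0..v} (\<lambda>t. drift (z t) + (first_unit \<bullet> z t - w t) *\<^sub>R p\<theta>
        + u (t - hor) *\<^sub>R last_unit))
      \<le> integral {0..v} (\<lambda>c. (L\<^sub>F + N) * norm (z c) + B)"
    proof (rule integral_norm_bound_integral[OF i])
      show "(\<lambda>c. (L\<^sub>F + N) * norm (z c) + B) integrable_on {0..v}"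
        by (intro integrable_add integrable_on_mult_right zi) auto
      fix c assume c: "c \<in> {0..v}"
      have "\<bar>w c\<bar> \<le> 2 * E + X + L\<^sub>F * integral {0..c} (\<lambda>v. norm (z v))"
        by (rule w_bound[OF D X]) (use c v in auto)
      also have "\<dots> \<le> 2 * E + X + L\<^sub>F * J"
        unfolding J_def
        by (intro add_left_mono mult_left_mono Lambda_nonneg integral_subset_le zi) (use c in auto)
      finally have "\<bar>first_unit \<bullet> z c - w c\<bar> \<le> norm (z c) + (2 * E + X + L\<^sub>F * J)"
        using abs_first_unit_inner_le[of "z c"] abs_triangle_ineq4[of "first_unit \<bullet> z c" "w c"]
            by linarith
      then have "norm ((first_unit \<bullet> z c - w c) *\<^sub>R p\<theta>) \<le> N * (norm (z c) + (2 * E + X + L\<^sub>F * J))"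
        unfolding N_def norm_scaleR mult.commute[of _ "norm p\<theta>"] by (rule mult_left_mono) simp
      moreover have "norm (u (c - hor) *\<^sub>R last_unit :: 'n rvec) \<le> U"
        using U[of "c - hor"] c v delays by auto
      moreover have "norm (drift (z c) + (first_unit \<bullet> z c - w c) *\<^sub>R p\<theta>
          + u (c - hor) *\<^sub>R last_unit)
         \<le> norm (drift (z c)) + norm ((first_unit \<bullet> z c - w c) *\<^sub>R p\<theta>)
             + norm (u (c - hor) *\<^sub>R last_unit :: 'n rvec)"
        by (intro norm_triangle_le add_mono) auto
      ultimately have "norm (drift (z c) + (first_unit \<bullet> z c - w c) *\<^sub>R p\<theta>
          + u (c - hor) *\<^sub>R last_unit)
         \<le> L\<^sub>F * norm (z c) + N * (norm (z c) + (2 * E + X + L\<^sub>F * J)) + U"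
        using norm_drift[of "z c"] by linarith
      also have "\<dots> = (L\<^sub>F + N) * norm (z c) + B" unfolding B_def by algebra
      finally show "norm (drift (z c) + (first_unit \<bullet> z c - w c) *\<^sub>R p\<theta> + u (c - hor) *\<^sub>R last_unit)
         \<le> (L\<^sub>F + N) * norm (z c) + B" .
    qed
    also have "\<dots> = (L\<^sub>F + N) * J + B * v"
      using v zi unfolding J_def by (subst integral_add) (auto intro!: integrable_on_mult_right)
    also have "\<dots> \<le> (L\<^sub>F + N) * J + B * S"
      unfolding B_def using N0 X0 E0 J0 U0 L v t
      by (intro add_left_mono mult_left_mono add_nonneg_nonneg mult_nonneg_nonneg) auto
    also have "\<dots> = (A - E) + C * J"
      unfolding A_def B_def C_def by algebra
    finally show ?thesis
      using arg_cong[OF zv, of norm] DD(5) norm_triangle_ineq[of "z 0"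
          "integral {0..v} (\<lambda>t. drift (z t) + (first_unit \<bullet> z t - w t) *\<^sub>R p\<theta>
          + u (t - hor) *\<^sub>R last_unit)"]
      unfolding J_def by linarith
  qed
  from gronwall[OF zc C0 this s] have "norm (z s) \<le> A * exp (C * (s - 0))" .
  also have "\<dots> \<le> A * exp (C * S)"
    using A0 C0 s t by (intro mult_left_mono) (auto intro: mult_left_mono)
  finally show ?thesis unfolding A_def C_def N_def .
qed

end

text \<open>Quantifying over all trajectories inside the predicate makes one constant serve every
  \<open>b\<close>, every disturbance and every \<open>t\<close> up to \<open>S\<close>.\<close>

definition state_const :: "real \<Rightarrow> real \<Rightarrow> bool" where
  "state_const S C \<longleftrightarrow> C \<ge> 0 \<and> (\<forall>\<xi> b d x u z w E U t. traj \<xi> b d x u z w \<longrightarrow>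
     data_bound 0 E t \<xi> d x u z w \<longrightarrow> t \<le> S \<longrightarrow> (\<forall>s\<in>{-hor..<t}. \<bar>u s\<bar> \<le> U) \<longrightarrow>
     (\<forall>s\<in>{0..t}. norm (x s) \<le> C * (E + U) \<and> norm (z s) \<le> C * (E + U) \<and> \<bar>w s\<bar> \<le> C * (E + U)))"

lemma state_constD:
  assumes "state_const S C" "traj \<xi> b d x u z w" "data_bound 0 E t \<xi> d x u z w" "t \<le> S"
    "\<forall>s\<in>{-hor..<t}. \<bar>u s\<bar> \<le> U" "s \<in> {0..t}"
  shows "norm (x s) \<le> C * (E + U) \<and> norm (z s) \<le> C * (E + U) \<and> \<bar>w s\<bar> \<le> C * (E + U)"
  using assms unfolding state_const_def by blast

lemma state_const_exists:
  assumes "S \<ge> 0"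
  shows "\<exists>C. state_const S C"
proof -
  define N where "N = norm p\<theta>"
  have N0: "N \<ge> 0" unfolding N_def by simp
  define C1 where "C1 = (1 + (G + 1) * S) * exp (L\<^sub>F * S)"
  define C2 where "C2 = (1 + (N * (2 + C1) + 1) * S) * exp ((L\<^sub>F + N + N * L\<^sub>F * S) * S)"
  define C3 where "C3 = 2 + C1 + L\<^sub>F * (S * C2)"
  have C1: "C1 \<ge> 0" unfolding C1_def using assms G_nonneg by simp
  have C2: "C2 \<ge> 0" unfolding C2_def using assms N0 C1 by simp
  have C3: "C3 \<ge> 0" unfolding C3_def using assms C1 C2 L by simp
  show ?thesis
    unfolding state_const_def
  proof (intro exI[of _ "C1 + C2 + C3"] conjI allI impI ballI)
    show "C1 + C2 + C3 \<ge> 0" using C1 C2 C3 by simp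
    fix \<xi> b d x u z w E U t s
    assume tr: "traj \<xi> b d x u z w" and D: "data_bound 0 E t \<xi> d x u z w" and t: "t \<le> S"
      and "\<forall>s\<in>{-hor..<t}. \<bar>u s\<bar> \<le> U" and s: "s \<in> {0..t}"
    then have U: "\<And>s. s \<in> {-hor..<t} \<Longrightarrow> \<bar>u s\<bar> \<le> U" by blast
    have E0: "E \<ge> 0" by (rule data_bound_nonneg[OF D])
    have U0: "U \<ge> 0"
      by (rule order_trans[OF abs_ge_zero U[of "-hor"]]) (use s delays in auto)
    have x: "norm (x v) \<le> C1 * (E + U)" if v: "v \<in> {0..t}" for v
    proof -
      have "norm (x v) \<le> (E + (G * E + U) * S) * exp (L\<^sub>F * S)"
        by (rule x_bound[OF tr D t U v])
      also have "\<dots> \<le> ((1 + (G + 1) * S) * (E + U)) * exp (L\<^sub>F * S)"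
      proof (rule mult_right_mono)
        have "0 \<le> U + G * U * S + E * S" using U0 E0 G_nonneg assms by simp
        then show "E + (G * E + U) * S \<le> (1 + (G + 1) * S) * (E + U)" by (simp add: algebra_simps)
      qed simp
      finally show ?thesis unfolding C1_def by (simp only: mult_ac)
    qed
    have z: "norm (z v) \<le> C2 * (E + U)" if v: "v \<in> {0..t}" for v
    proof -
      have "norm (z v) \<le> (E + (N * (2 * E + C1 * (E + U)) + U) * S) * exp ((L\<^sub>F + N
          + N * L\<^sub>F * S) * S)"
        unfolding N_def by (rule z_bound[OF tr D t x U v])
      also have "\<dots> \<le> ((1 + (N * (2 + C1) + 1) * S) * (E + U)) * exp ((L\<^sub>F + N + N * L\<^sub>F * S) * S)"
      proof (rule mult_right_mono)
        have "0 \<le> U + 2 * N * U * S + E * S" using U0 E0 N0 assms by simp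
        then show "E + (N * (2 * E + C1 * (E + U)) + U) * S
            \<le> (1 + (N * (2 + C1) + 1) * S) * (E + U)"
          by (simp add: algebra_simps)
      qed simp
      finally show ?thesis unfolding C2_def by (simp only: mult_ac)
    qed
    have w: "\<bar>w s\<bar> \<le> C3 * (E + U)"
    proof -
      have zi: "(\<lambda>v. norm (z v)) integrable_on {0..s}"
        by (intro integrable_continuous_real continuous_on_norm continuous_on_subset[OF
            z_continuous[OF tr]]) auto
      have "integral {0..s} (\<lambda>v. norm (z v)) \<le> integral {0..s} (\<lambda>_. C2 * (E + U))"
        by (rule integral_le[OF zi]) (use z s in auto)
      also have "\<dots> = s * (C2 * (E + U))" using s by simp
      also have "\<dots> \<le> S * (C2 * (E + U))"
        using s t C2 E0 U0 by (intro mult_right_mono) auto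
      finally have "L\<^sub>F * integral {0..s} (\<lambda>v. norm (z v)) \<le> L\<^sub>F * (S * (C2 * (E + U)))"
        by (rule mult_left_mono[OF _ Lambda_nonneg])
      then have "\<bar>w s\<bar> \<le> 2 * E + C1 * (E + U) + L\<^sub>F * (S * (C2 * (E + U)))"
        using w_bound[OF tr D x s] by linarith
      also have "\<dots> = C3 * (E + U) - 2 * U" unfolding C3_def by algebra
      finally show ?thesis using U0 by linarith
    qed
    have "C * (E + U) \<le> (C1 + C2 + C3) * (E + U)" if "C \<in> {C1, C2, C3}" for C
      using that C1 C2 C3 E0 U0 by (intro mult_right_mono) auto
    then show "norm (x s) \<le> (C1 + C2 + C3) * (E + U)" "norm (z s) \<le> (C1 + C2 + C3) * (E + U)"
      "\<bar>w s\<bar> \<le> (C1 + C2 + C3) * (E + U)"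
      using x[OF s] z[OF s] w by (meson insertCI order_trans)+
  qed
qed

end

section \<open>Transient bounds for the loop closed through the predictor\<close>

locale predictor_loop = sampled_loop f L n g G r \<tau> \<theta> T1 T2 p k l m
  for f :: "'n::{finite,linorder} \<Rightarrow> 'n rvec \<Rightarrow> real" and L n g G r \<tau> \<theta> T1 T2 p k l m +
  fixes K :: real
  assumes l: "l \<ge> 1"
    and K: "predictor_accuracy_constant f L m hor K"
    and contraction: "L\<^sub>F * (hor / real m) < 1"
begin

definition \<epsilon> :: real where
  "\<epsilon> = K * ((L\<^sub>F * (hor / real m)) ^ (l + 1) / (1 - L\<^sub>F * (hor / real m)))"

lemma eps_nonneg: "\<epsilon> \<ge> 0"
  using K contraction delays Lambda_nonneg unfolding \<epsilon>_def predictor_accuracy_constant_def by simp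

text \<open>The zero function is the comparison trajectory: it solves the perturbed equation whose
  perturbation cancels the input, so the perturbation is bounded by \<open>U\<close>.\<close>

lemma Phi_bound:
  assumes u: "u absolutely_integrable_on {c - hor..c}" "\<And>s. s \<in> {c - hor..<c} \<Longrightarrow> \<bar>u s\<bar> \<le> U"
  shows "norm (Phi_pred f l m hor x (shift c u)) \<le> (\<epsilon> + (1 + hor) * exp (L\<^sub>F * hor)) * (norm x + U)"
proof -
  have U0: "U \<ge> 0"
    by (rule order_trans[OF abs_ge_zero u(2)[of "c - hor"]]) (use delays in auto)
  have int: "shift c u absolutely_integrable_on {-hor..0}"
    using absolutely_integrable_shift_real[OF u(1), of c] unfolding shift_def
        by (simp add: add.commute)
  have "norm (Phi_pred f l m hor x (shift c u) - 0)
    \<le> K * ((L\<^sub>F * (hor / real m)) ^ (l + 1) / (1 - L\<^sub>F * (hor / real m))) * (norm x + U)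
      + (norm (x - 0) + U * hor) * exp (L\<^sub>F * hor)"
  proof (rule Phi_pred_error[OF K delays(3) l contraction int, where y = "\<lambda>_. 0"
        and \<delta> = "\<lambda>t. - (shift c u (t - hor) *\<^sub>R last_unit)"])
    show "\<bar>shift c u s\<bar> \<le> U" if "s \<in> {-hor..<0}" for s
      unfolding shift_def using that by (intro u(2)) auto
    show "ac_derivative_on {0..hor} (\<lambda>_. 0) (\<lambda>t. drift 0 + shift c u (t - hor) *\<^sub>R last_unit
        + - (shift c u (t - hor) *\<^sub>R last_unit))"
      unfolding ac_derivative_on_def by (auto intro!: absolutely_integrable_continuous_real)
    show "norm (- (shift c u (t - hor) *\<^sub>R last_unit) :: 'n rvec) \<le> U" if "t \<in> {0..<hor}" for t
      using that u(2)[of "c + (t - hor)"] by (simp add: shift_def)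
  qed
  also have "\<dots> \<le> \<epsilon> * (norm x + U) + ((1 + hor) * (norm x + U)) * exp (L\<^sub>F * hor)"
  proof (intro add_mono mult_right_mono)
    have "0 \<le> U + hor * norm x" using U0 delays by simp
    then show "norm (x - 0) + U * hor \<le> (1 + hor) * (norm x + U)" by (simp add: algebra_simps)
    show "0 \<le> norm x + U" using U0 by simp
  qed (auto simp: \<epsilon>_def)
  also have "\<dots> = (\<epsilon> + (1 + hor) * exp (L\<^sub>F * hor)) * (norm x + U)" by algebra
  finally show ?thesis by simp
qed

definition input_const :: "nat \<Rightarrow> real \<Rightarrow> bool" where
  "input_const N C \<longleftrightarrow> C \<ge> 0 \<and> (\<forall>\<xi> b d x u z w E t. traj \<xi> b d x u z w \<longrightarrow>
     data_bound 0 E t \<xi> d x u z w \<longrightarrow> (\<forall>s\<in>{-hor..t}. s < real N * T2 \<longrightarrow> \<bar>u s\<bar> \<le> C * E))"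

lemma input_constD:
  assumes "input_const N C" "traj \<xi> b d x u z w" "data_bound 0 E t \<xi> d x u z w"
    "s \<in> {-hor..t}" "s < real N * T2"
  shows "\<bar>u s\<bar> \<le> C * E"
  using assms unfolding input_const_def by blast

text \<open>Induction over hold intervals: the value held on interval \<open>N\<close> is computed
  from the earlier input, bounded by induction, and from \<open>z\<close> at \<open>N * T2\<close>,
  which is bounded by that input through \<open>state_const\<close>.\<close>

lemma input_const_exists: "\<exists>C. input_const N C"
proof (induction N)
  case 0
  show ?case unfolding input_const_def by (intro exI[of _ 1]) (auto simp: data_bound_def)
next
  case (Suc N)
  then obtain C where NC: "input_const N C" by blast
  then have C: "C \<ge> 0" unfolding input_const_def by simp
  note uC = input_constD[OF NC]
  have "real N * T2 \<ge> 0" using T2 by simp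
  then obtain C' where NC': "state_const (real N * T2) C'" using state_const_exists by blast
  then have C': "C' \<ge> 0" unfolding state_const_def by simp
  note zC = state_constD[OF NC']
  define C\<phi> where "C\<phi> = \<epsilon> + (1 + hor) * exp (L\<^sub>F * hor)"
  have C\<phi>: "C\<phi> \<ge> 0" unfolding C\<phi>_def using eps_nonneg delays by simp
  define D where "D = norm k * (C\<phi> * (C' * (1 + C) + C))"
  have D: "D \<ge> 0" unfolding D_def using C C' C\<phi> by simp
  show ?case
    unfolding input_const_def
  proof (intro exI[of _ "C + D"] conjI allI impI ballI)
    show "C + D \<ge> 0" using C D by simp
    fix \<xi> b d x u z w E t s
    assume tr: "traj \<xi> b d x u z w" and dat: "data_bound 0 E t \<xi> d x u z w"
      and s: "s \<in> {-hor..t}" "s < real (Suc N) * T2"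
    have E0: "E \<ge> 0" by (rule data_bound_nonneg[OF dat])
    show "\<bar>u s\<bar> \<le> (C + D) * E"
    proof (cases "s < real N * T2")
      case True
      then have "\<bar>u s\<bar> \<le> C * E" using uC[OF tr dat s(1)] by simp
      then show ?thesis using mult_nonneg_nonneg[OF D E0] by (simp add: distrib_right)
    next
      case False
      define c where "c = real N * T2"
      have c: "c \<ge> 0" "c \<le> t" unfolding c_def using T2 False s by auto
      have uc: "\<bar>u v\<bar> \<le> C * E" if "v \<in> {-hor..<c}" for v
        by (rule uC[OF tr dat]) (use that c in \<open>auto simp: c_def\<close>)
      have zc: "norm (z c) \<le> C' * (E + C * E)"
        using zC[OF tr data_bound_mono[OF dat c(2), of 0], of "C * E" c] uc c unfolding c_def
            by auto
      have "norm (Phi_pred f l m hor (z c) (shift c u)) \<le> C\<phi> * (norm (z c) + C * E)"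
        unfolding C\<phi>_def
        by (rule Phi_bound) (use c uc in \<open>auto intro!: u_integrable[OF tr]\<close>)
      also have "\<dots> \<le> C\<phi> * (C' * (E + C * E) + C * E)"
        using zc C\<phi> by (intro mult_left_mono) auto
      finally have ph: "norm (Phi_pred f l m hor (z c) (shift c u))
          \<le> C\<phi> * (C' * (E + C * E) + C * E)" .
      have "u s = k \<bullet> Phi_pred f l m hor (z c) (shift c u)"
        unfolding c_def by (rule u_held[OF tr]) (use s False in auto)
      then have "\<bar>u s\<bar> \<le> norm k * norm (Phi_pred f l m hor (z c) (shift c u))"
        using Cauchy_Schwarz_ineq2 by metis
      also have "\<dots> \<le> norm k * (C\<phi> * (C' * (E + C * E) + C * E))"
        by (rule mult_left_mono[OF ph]) simp
      also have "\<dots> = D * E" unfolding D_def by algebra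
      finally show ?thesis using mult_nonneg_nonneg[OF C E0] by (simp add: distrib_right)
    qed
  qed
qed

definition transient_const :: "real \<Rightarrow> real \<Rightarrow> bool" where
  "transient_const S C \<longleftrightarrow> C \<ge> 0 \<and> (\<forall>\<xi> b d x u z w E t s. traj \<xi> b d x u z w \<longrightarrow>
     data_bound 0 E t \<xi> d x u z w \<longrightarrow> s \<le> t \<longrightarrow> s \<le> S \<longrightarrow>
     (-r \<le> s \<longrightarrow> norm (x s) \<le> C * E) \<and> (-hor \<le> s \<longrightarrow> \<bar>u s\<bar> \<le> C * E) \<and>
     (0 \<le> s \<longrightarrow> norm (z s) \<le> C * E \<and> \<bar>w s\<bar> \<le> C * E))"

lemma transient_constD:
  assumes "transient_const S C" "traj \<xi> b d x u z w" "data_bound 0 E t \<xi> d x u z w" "s \<le> t" "s \<le> S"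
  shows "(-r \<le> s \<longrightarrow> norm (x s) \<le> C * E) \<and> (-hor \<le> s \<longrightarrow> \<bar>u s\<bar> \<le> C * E) \<and>
    (0 \<le> s \<longrightarrow> norm (z s) \<le> C * E \<and> \<bar>w s\<bar> \<le> C * E)"
  using assms unfolding transient_const_def by blast

lemma transient_const_exists: "\<exists>C. transient_const S C"
proof -
  obtain N :: nat where N: "S < real N * T2" using hold_intervals_cover by blast
  obtain C where NC: "input_const N C" using input_const_exists by blast
  then have C: "C \<ge> 0" unfolding input_const_def by simp
  note uC = input_constD[OF NC]
  have "real N * T2 \<ge> 0" using T2 by simp
  then obtain C' where NC': "state_const (real N * T2) C'" using state_const_exists by blast
  then have C': "C' \<ge> 0" unfolding state_const_def by simp
  note zC = state_constD[OF NC']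
  define D where "D = 1 + C + C' * (1 + C)"
  have D: "D \<ge> 1" unfolding D_def using C C' by simp
  show ?thesis
    unfolding transient_const_def
  proof (intro exI[of _ D] conjI allI impI)
    show "D \<ge> 0" using D by simp
    fix \<xi> b d x u z w E t s
    assume tr: "traj \<xi> b d x u z w" and dat: "data_bound 0 E t \<xi> d x u z w" and s: "s \<le> t" "s \<le> S"
    have E0: "E \<ge> 0" by (rule data_bound_nonneg[OF dat])
    have DE: "E \<le> D * E" "C * E \<le> D * E" "C' * (E + C * E) \<le> D * E"
    proof -
      have "0 \<le> C * E" "0 \<le> C' * E" "0 \<le> C' * (C * E)" using C C' E0 by auto
      then show "E \<le> D * E" "C * E \<le> D * E" "C' * (E + C * E) \<le> D * E"
        unfolding D_def using E0 by (auto simp: algebra_simps)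
    qed
    show "\<bar>u s\<bar> \<le> D * E" if "-hor \<le> s"
      using uC[OF tr dat, of s] that s N DE by auto
    have st: "norm (x s) \<le> D * E \<and> norm (z s) \<le> D * E \<and> \<bar>w s\<bar> \<le> D * E" if s0: "0 \<le> s"
    proof -
      have u: "\<forall>v\<in>{-hor..<s}. \<bar>u v\<bar> \<le> C * E"
        using uC[OF tr dat] s N by auto
      have "norm (x s) \<le> C' * (E + C * E) \<and> norm (z s) \<le> C' * (E + C * E) \<and>
          \<bar>w s\<bar> \<le> C' * (E + C * E)"
        by (rule zC[OF tr data_bound_mono[OF dat s(1)] _ u]) (use s0 s N in auto)
      then show ?thesis using DE(3) by linarith
    qed
    show "norm (x s) \<le> D * E" if "-r \<le> s"
      using st data_boundD(3)[OF dat, of s] that DE(1) by (cases "s \<le> 0") auto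
    show "norm (z s) \<le> D * E" "\<bar>w s\<bar> \<le> D * E" if "0 \<le> s" using st[OF that] by auto
  qed
qed

end

section \<open>Quadratic forms\<close>

lemma symmetric_form: "transpose B = B \<Longrightarrow> u \<bullet> (B *v v) = v \<bullet> (B *v (u :: real ^ 'm))"
  by (metis dot_lmul_matrix inner_commute transpose_matrix_vector)

lemma inner_transpose: "x \<bullet> (transpose B *v y) = (B *v x) \<bullet> (y :: real ^ 'm)"
  by (metis dot_lmul_matrix inner_commute transpose_matrix_vector)

lemma norm_matrix_vector_le: "norm (B *v x) \<le> matrix_norm B * norm (x :: real ^ 'm)"
  unfolding matrix_norm_def by (rule onorm[OF matrix_vector_mul_bounded_linear])

lemma outer_mult: "outer v w *v x = (w \<bullet> x) *\<^sub>R v"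
  unfolding outer_def matrix_vector_mult_def inner_vec_def
  by (simp add: vec_eq_iff sum_distrib_left mult_ac)

lemma transpose_outer: "transpose (outer v w) = outer w v"
  unfolding outer_def transpose_def by (simp add: vec_eq_iff mult.commute)

lemma transpose_add: "transpose (A + B) = transpose A + transpose (B :: real ^ 'm ^ 'm)"
  unfolding transpose_def by (simp add: vec_eq_iff)

text \<open>The form is nonnegative at \<open>x - e y\<close>; the chosen \<open>e\<close> minimises
  its value.\<close>

lemma form_Cauchy_Schwarz:
  fixes B :: "real ^ 'm ^ 'm"
  assumes B: "sym_pos_def B"
  shows "(x \<bullet> (B *v y))\<^sup>2 \<le> (x \<bullet> (B *v x)) * (y \<bullet> (B *v y))"
proof (cases "y = 0")
  case False
  define c where "c = y \<bullet> (B *v y)"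
  define e where "e = (x \<bullet> (B *v y)) / c"
  have c: "c > 0" using B False unfolding sym_pos_def_def c_def by blast
  have sym: "y \<bullet> (B *v x) = x \<bullet> (B *v y)"
    using B unfolding sym_pos_def_def by (intro symmetric_form) auto
  have "0 \<le> (x - e *\<^sub>R y) \<bullet> (B *v (x - e *\<^sub>R y))"
    using B unfolding sym_pos_def_def by (cases "x - e *\<^sub>R y = 0") (auto simp: less_imp_le)
  also have "\<dots> = x \<bullet> (B *v x) - 2 * e * (x \<bullet> (B *v y)) + e\<^sup>2 * c"
    unfolding c_def using sym
    by (simp add: matrix_vector_mult_diff_distrib matrix_vector_mult_scaleR inner_diff_left
        inner_diff_right
        power2_eq_square algebra_simps)
  also have "\<dots> = x \<bullet> (B *v x) - (x \<bullet> (B *v y))\<^sup>2 / c"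
    unfolding e_def using c by (simp add: power2_eq_square field_simps)
  finally show ?thesis using c unfolding c_def[symmetric] by (simp add: field_simps)
qed simp

text \<open>A weighted bound at a time \<open>c\<close> no more than \<open>h\<close> before
  \<open>s\<close> is moved to the weight at \<open>s\<close> at the cost of
  \<open>exp (\<sigma> * h)\<close>. Delays, sampling and hold periods enter the gains through this
  factor.\<close>

lemma exp_window:
  fixes \<sigma> :: real
  assumes "exp (\<sigma> * c) * A \<le> B" "s - h \<le> c" "0 \<le> \<sigma>" "0 \<le> B"
  shows "A \<le> exp (- \<sigma> * s) * (exp (\<sigma> * h) * B)"
proof -
  have "A \<le> exp (- \<sigma> * c) * B" using assms(1) by (simp add: exp_minus field_simps)
  also have "\<dots> \<le> exp (- \<sigma> * s + \<sigma> * h) * B"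
  proof (intro mult_right_mono assms)
    have "\<sigma> * (s - h) \<le> \<sigma> * c" using assms(2,3) by (rule mult_left_mono)
    then show "exp (- \<sigma> * c) \<le> exp (- \<sigma> * s + \<sigma> * h)" by (simp add: algebra_simps)
  qed
  finally show ?thesis unfolding exp_add mult.assoc .
qed

section \<open>The observer error\<close>

locale stable_loop = predictor_loop f L n g G r \<tau> \<theta> T1 T2 p k l m K
  for f :: "'n::{finite,linorder} \<Rightarrow> 'n rvec \<Rightarrow> real" and L n g G r \<tau> \<theta> T1 T2 p k l m K +
  fixes Q P :: "'n rmat" and q \<mu> \<gamma> a K1 K2 :: real
  assumes Q: "sym_pos_def Q" and q: "q > 0"
    and Q_ineq: "neg_semidef (Q ** (chain + outer p first_unit)
          + (transpose chain + outer first_unit p) ** Q + (2 * q) *\<^sub>R mat 1)"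
    and a: "a > 0" "\<And>x. a * (norm x)\<^sup>2 \<le> x \<bullet> (Q *v x)"
    and T1_small: "4 * norm (Q *v p) * (L + \<theta>) * T1 * sqrt (matrix_norm Q / a) < q"
    and \<theta>_large: "\<theta> \<ge> max 1 (2 * matrix_norm Q * L * sqrt (real n) / q)"
    and P: "sym_pos_def P" and \<mu>: "\<mu> > 0" and \<gamma>: "\<gamma> > 0"
    and P_ineq: "\<And>x d u. x \<bullet> ((P ** (chain + outer last_unit k)) *v x) + x \<bullet> (P *v fvec f x)
          + x \<bullet> (P *v (diag (\<chi> i. g i x u) *v d))
          \<le> - 2 * \<mu> * (x \<bullet> (P *v x)) + \<gamma> * (norm d)\<^sup>2"
    and K1: "K1 > 0" "\<And>x. K1 * (norm x)\<^sup>2 \<le> x \<bullet> (P *v x)"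
    and K2: "K2 > 0" "\<And>x. x \<bullet> (P *v x) \<le> K2 * (norm x)\<^sup>2"
    and T2_small: "((L\<^sub>F + norm k)
            * sqrt ((last_unit \<bullet> (P *v last_unit)) / (2 * K1)) + \<mu>) * norm k * (T2 + \<epsilon>) < \<mu>"
begin

abbreviation "nQ \<equiv> matrix_norm Q"

lemma \<theta>1: "\<theta> \<ge> 1" using \<theta>_large by simp

lemma \<theta>0: "\<theta> > 0" using \<theta>1 by simp

lemma nQ_pos: "nQ > 0"
proof -
  have "a * (norm (last_unit :: 'n rvec))\<^sup>2 \<le> norm (last_unit :: 'n rvec) * norm (Q *v last_unit)"
    using a(2)[of last_unit] norm_cauchy_schwarz[of last_unit "Q *v last_unit"] by linarith
  then show ?thesis using norm_matrix_vector_le[of Q last_unit] a(1) by simp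
qed

lemma form_Q_le: "x \<bullet> (Q *v x) \<le> nQ * (norm x)\<^sup>2"
  using norm_cauchy_schwarz[of x "Q *v x"] mult_left_mono[OF norm_matrix_vector_le[of Q x]
      norm_ge_zero[of x]]
  by (simp add: power2_eq_square mult_ac)

text \<open>By symmetry of \<open>Q\<close> the two products in the matrix inequality contribute the
  same number at \<open>e\<close>, so the inequality is twice the one stated here.\<close>

lemma Q_decay: "(chain *v e + (first_unit \<bullet> e) *\<^sub>R p) \<bullet> (Q *v e) \<le> - q * (norm e)\<^sup>2"
proof -
  define A where "A = chain + outer p first_unit"
  have Ae: "A *v e = chain *v e + (first_unit \<bullet> e) *\<^sub>R p"
    unfolding A_def by (simp add: matrix_vector_mult_add_rdistrib outer_mult)
  have At: "transpose chain + outer first_unit p = transpose A"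
    unfolding A_def by (simp add: transpose_add transpose_outer)
  have "e \<bullet> ((Q ** A + transpose A ** Q + (2 * q) *\<^sub>R mat 1) *v e) \<le> 0"
    using Q_ineq unfolding At A_def[symmetric] neg_semidef_def by blast
  moreover have "((2 * q) *\<^sub>R mat 1) *v e = (2 * q) *\<^sub>R e"
    by (simp add: scaleR_matrix_vector_assoc[symmetric])
  moreover have "e \<bullet> (Q *v (A *v e)) = (A *v e) \<bullet> (Q *v e)"
    using Q unfolding sym_pos_def_def by (intro symmetric_form) auto
  moreover note inner_transpose[of e A "Q *v e"]
  ultimately have "2 * ((A *v e) \<bullet> (Q *v e)) + 2 * q * (e \<bullet> e) \<le> 0"
    unfolding matrix_vector_mult_add_rdistrib matrix_vector_mul_assoc[symmetric] inner_add_right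
        by simp
  then show ?thesis unfolding Ae by (simp add: power2_norm_eq_inner)
qed

text \<open>High-gain coordinates \<open>\<epsilon>\<^sub>i = \<theta>\<^sup>-\<^sup>i e\<^sub>i\<close>: they turn the injection term into \<open>p\<close> and speed up the
  linear part by the factor \<open>\<theta>\<close>, while the triangular nonlinearity keeps its Lipschitz constant.\<close>

definition Sc :: "'n rvec \<Rightarrow> 'n rvec" where "Sc v = (\<chi> i. v $ i / \<theta> ^ idx i)"

lemma bounded_linear_Sc: "bounded_linear Sc"
  unfolding linear_conv_bounded_linear[symmetric]
  by (rule linearI) (auto simp: Sc_def vec_eq_iff add_divide_distrib)

lemma Sc_diff: "Sc (v - v') = Sc v - Sc v'" and Sc_add: "Sc (v + v') = Sc v + Sc v'"
  and Sc_scaleR: "Sc (c *\<^sub>R v) = c *\<^sub>R Sc v"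
  using linear_simps[OF bounded_linear_Sc] by auto

lemma Sc_chain: "Sc (chain *v v) = \<theta> *\<^sub>R (chain *v Sc v)"
proof -
  have "(\<Sum>j\<in>UNIV. (if idx j = idx i + 1 then 1 else 0) * v $ j) / \<theta> ^ idx i
      = \<theta> * (\<Sum>j\<in>UNIV. (if idx j = idx i + 1 then 1 else 0) * (v $ j / \<theta> ^ idx j))" for i :: 'n
    unfolding sum_divide_distrib sum_distrib_left
    by (rule sum.cong) (use \<theta>0 in auto)
  then show ?thesis
    unfolding Sc_def chain_def matrix_vector_mult_def by (simp add: vec_eq_iff)
qed

lemma Sc_p\<theta>: "Sc p\<theta> = p"
  unfolding Sc_def p\<theta>_def using \<theta>0 by (simp add: vec_eq_iff)

lemma first_Sc: "first_unit \<bullet> v = \<theta> * (first_unit \<bullet> Sc v)"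
  unfolding first_unit_inner Sc_def using \<theta>0 by (simp add: idx_Min)

lemma idx_le_n: "idx i \<le> n" for i :: 'n
  unfolding idx_def n by (rule card_mono) auto

lemma norm_Sc_le: "norm (Sc v) \<le> norm v"
proof (rule norm_le_componentwise_cart)
  fix i :: 'n
  have "1 \<le> \<theta> ^ idx i" by (rule one_le_power[OF \<theta>1])
  then show "norm (Sc v $ i) \<le> norm (v $ i)"
    unfolding Sc_def using \<theta>0 by (simp add: abs_divide divide_le_eq mult_le_cancel_left1)
qed

text \<open>This is where triangularity pays off: the first \<open>i\<close> coordinates carry only
  powers of \<theta> up to the i-th, since \<theta> is at least 1. Dividing component
  \<open>i\<close> by its own power removes \<theta> from the Lipschitz bound of the rescaled
  nonlinearity.\<close>

lemma norm_head_Sc: "norm (head i v) \<le> \<theta> ^ idx i * norm (Sc v)"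
proof -
  have "norm (head i v) \<le> norm (\<theta> ^ idx i *\<^sub>R Sc v)"
  proof (rule norm_le_componentwise_cart)
    fix j :: 'n
    have "\<theta> ^ idx j \<le> \<theta> ^ idx i" if "j \<le> i"
      by (rule power_increasing[OF idx_mono[OF that] \<theta>1])
    then show "norm (head i v $ j) \<le> norm ((\<theta> ^ idx i *\<^sub>R Sc v) $ j)"
      unfolding head_def Sc_def using \<theta>0
      by (auto simp: abs_mult abs_divide le_divide_eq mult.commute[of
          "\<bar>v $ j\<bar>"] intro!: mult_right_mono)
  qed
  then show ?thesis using \<theta>0 by simp
qed

lemma norm_le_Sc: "norm v \<le> \<theta> ^ n * norm (Sc v)"
proof -
  have "norm v \<le> norm (\<theta> ^ n *\<^sub>R Sc v)"
  proof (rule norm_le_componentwise_cart)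
    fix j :: 'n
    have "\<theta> ^ idx j \<le> \<theta> ^ n" by (rule power_increasing[OF idx_le_n \<theta>1])
    then show "norm (v $ j) \<le> norm ((\<theta> ^ n *\<^sub>R Sc v) $ j)"
      unfolding Sc_def using \<theta>0
      by (auto simp: abs_mult abs_divide le_divide_eq mult.commute[of
          "\<bar>v $ j\<bar>"] intro!: mult_right_mono)
  qed
  then show ?thesis using \<theta>0 by simp
qed

lemma fvec_diff_nth: "\<bar>(fvec f z - fvec f x) $ i\<bar> \<le> L * (\<theta> ^ idx i * norm (Sc (z - x)))"
proof -
  have "\<bar>f i (head i z) - f i (head i x)\<bar> \<le> L * norm (head i (z - x))"
    using f_Lipschitz[of i z x] unfolding head_diff .
  also have "\<dots> \<le> L * (\<theta> ^ idx i * norm (Sc (z - x)))" by (intro mult_left_mono norm_head_Sc L)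
  finally show ?thesis by (simp add: fvec_def)
qed

lemma norm_Sc_fvec_diff: "norm (Sc (fvec f z - fvec f x)) \<le> sqrt (real n) * (L * norm (Sc (z - x)))"
  unfolding n
proof (rule norm_vec_le_sqrt_card)
  fix i
  have "\<bar>Sc (fvec f z - fvec f x) $ i\<bar> = \<bar>(fvec f z - fvec f x) $ i\<bar> / \<theta> ^ idx i"
    unfolding Sc_def using \<theta>0 by (simp add: abs_divide)
  also have "\<dots> \<le> L * norm (Sc (z - x))"
    using fvec_diff_nth[of z x i] \<theta>0 by (simp add: divide_le_eq mult_ac)
  finally show "\<bar>Sc (fvec f z - fvec f x) $ i\<bar> \<le> L * norm (Sc (z - x))" .
qed

text \<open>The first component of the nonlinearity gives L \<theta>, and the second coordinate,
  rescaled by the square of \<theta>, gives the rest. This sum is the growth rate of the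
  inter-sample error and the source of L + \<theta> in the condition on T1.\<close>

lemma first_drift_diff:
  "\<bar>first_unit \<bullet> (drift z - drift x)\<bar> \<le> \<theta> * (L + \<theta>) * norm (Sc (z - x))"
proof -
  have 1: "\<bar>first_unit \<bullet> (fvec f z - fvec f x)\<bar> \<le> L * (\<theta> * norm (Sc (z - x)))"
    unfolding first_unit_inner using fvec_diff_nth[of z x "Min UNIV"] by (simp add: idx_Min)
  have "first_unit \<bullet> (chain *v z - chain *v x) = \<theta> * (\<theta> * (first_unit \<bullet> (chain *v Sc (z - x))))"
    unfolding matrix_vector_mult_diff_distrib[symmetric] first_Sc[of "chain *v (z - x)"] Sc_chain
        by simp
  moreover have "\<bar>first_unit \<bullet> (chain *v Sc (z - x))\<bar> \<le> norm (Sc (z - x))"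
    using abs_first_unit_inner_le[of "chain *v Sc (z - x)"] norm_chain[of "Sc (z - x)"] by linarith
  ultimately have 2: "\<bar>first_unit \<bullet> (chain *v z - chain *v x)\<bar> \<le> \<theta> * (\<theta> * norm (Sc (z - x)))"
    using \<theta>0 by (simp add: abs_mult)
  have "first_unit \<bullet> (drift z - drift x)
      = first_unit \<bullet> (fvec f z - fvec f x) + first_unit \<bullet> (chain *v z - chain *v x)"
    unfolding drift_def by (simp add: inner_diff_right inner_add_right)
  then have "\<bar>first_unit \<bullet> (drift z - drift x)\<bar>
      \<le> L * (\<theta> * norm (Sc (z - x))) + \<theta> * (\<theta> * norm (Sc (z - x)))"
    using 1 2 by linarith
  also have "\<dots> = \<theta> * (L + \<theta>) * norm (Sc (z - x))" by algebra
  finally show ?thesis .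
qed

text \<open>Half of the margin q \<theta> compensates the nonlinearity and another quarter, by
  Young's inequality, the forcing; after doubling, q \<theta> / 2 times the squared error remains,
  and the squared error is at least the Lyapunov function divided by |Q|.\<close>

definition decay :: real where "decay = q * \<theta> / (4 * nQ)"

lemma decay_pos: "decay > 0" unfolding decay_def using q \<theta>0 nQ_pos by simp

text \<open>\<open>\<nu>\<close> stands for the output error of \<open>w\<close> and
  \<open>dd\<close> for the delayed disturbance term. In the rescaled coordinates the linear part
  yields -q \<theta> |e|^2, the lower bound on \<theta> halves this at most, and Young's inequality
  separates the forcing.\<close>

lemma observer_rate:
  fixes z x dd :: "'n rvec" and \<nu> :: real
  defines "e \<equiv> Sc (z - x)"
  shows "2 * (Sc (drift z - drift x + (first_unit \<bullet> (z - x) - \<nu>) *\<^sub>R p\<theta> - dd) \<bullet> (Q *v e))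
    \<le> - 2 * decay * (e \<bullet> (Q *v e)) + 2 / (q * \<theta>) * (norm (Q *v p) * \<bar>\<nu>\<bar> + nQ * norm dd)\<^sup>2"
proof -
  define R where "R = norm (Q *v p) * \<bar>\<nu>\<bar> + nQ * norm dd"
  define N where "N = norm e"
  have N0: "N \<ge> 0" unfolding N_def by simp
  have Qe: "norm (Q *v e) \<le> nQ * N" unfolding N_def by (rule norm_matrix_vector_le)
  have dec: "Sc (drift z - drift x + (first_unit \<bullet> (z - x) - \<nu>) *\<^sub>R p\<theta> - dd)
    = Sc (fvec f z - fvec f x) + \<theta> *\<^sub>R (chain *v e + (first_unit \<bullet> e) *\<^sub>R p) - \<nu> *\<^sub>R p - Sc dd"
  proof -
    have split: "Sc (A + B + C - D) = Sc A + Sc B + Sc C - Sc D" for A B C D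
      by (simp add: Sc_diff Sc_add)
    have "drift z - drift x + (first_unit \<bullet> (z - x) - \<nu>) *\<^sub>R p\<theta> - dd
      = (fvec f z - fvec f x) + chain *v (z - x) + (\<theta> * (first_unit \<bullet> e) - \<nu>) *\<^sub>R p\<theta> - dd"
      unfolding drift_def e_def first_Sc[of "z - x"] by (simp add: matrix_vector_mult_diff_distrib)
    then show ?thesis
      by (simp only: split Sc_scaleR Sc_p\<theta> Sc_chain e_def[symmetric])
        (simp add: scaleR_diff_left scaleR_add_right)
  qed
  have t1: "Sc (fvec f z - fvec f x) \<bullet> (Q *v e) \<le> q * \<theta> / 2 * N\<^sup>2"
  proof -
    have "Sc (fvec f z - fvec f x) \<bullet> (Q *v e) \<le> norm (Sc (fvec f z - fvec f x)) * norm (Q *v e)"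
      by (rule norm_cauchy_schwarz)
    also have "\<dots> \<le> (sqrt (real n) * (L * N)) * (nQ * N)"
      unfolding N_def e_def
      by (rule mult_mono[OF norm_Sc_fvec_diff Qe[unfolded N_def e_def]]) (use L in auto)
    also have "\<dots> = (nQ * L * sqrt (real n)) * N\<^sup>2" by (simp add: power2_eq_square mult_ac)
    also have "\<dots> \<le> (q * \<theta> / 2) * N\<^sup>2"
    proof (rule mult_right_mono)
      have "2 * nQ * L * sqrt (real n) / q \<le> \<theta>" using \<theta>_large by simp
      then show "nQ * L * sqrt (real n) \<le> q * \<theta> / 2" using q by (simp add: field_simps)
    qed simp
    finally show ?thesis .
  qed
  have t2: "(\<theta> *\<^sub>R (chain *v e + (first_unit \<bullet> e) *\<^sub>R p)) \<bullet> (Q *v e) \<le> - \<theta> * q * N\<^sup>2"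
    using mult_left_mono[OF Q_decay[of e] less_imp_le[OF \<theta>0]] unfolding N_def by simp
  have t3: "- ((\<nu> *\<^sub>R p) \<bullet> (Q *v e)) \<le> norm (Q *v p) * \<bar>\<nu>\<bar> * N"
  proof -
    have "p \<bullet> (Q *v e) = e \<bullet> (Q *v p)" using Q unfolding sym_pos_def_def
        by (intro symmetric_form) auto
    then have "\<bar>p \<bullet> (Q *v e)\<bar> \<le> N * norm (Q *v p)"
      unfolding N_def using Cauchy_Schwarz_ineq2[of e "Q *v p"] by simp
    then have "\<bar>\<nu>\<bar> * \<bar>p \<bullet> (Q *v e)\<bar> \<le> \<bar>\<nu>\<bar> * (N * norm (Q *v p))" by (rule mult_left_mono) simp
    moreover have "- ((\<nu> *\<^sub>R p) \<bullet> (Q *v e)) \<le> \<bar>\<nu>\<bar> * \<bar>p \<bullet> (Q *v e)\<bar>"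
      unfolding abs_mult[symmetric] by simp
    ultimately show ?thesis by (simp add: mult_ac)
  qed
  have t4: "- (Sc dd \<bullet> (Q *v e)) \<le> nQ * norm dd * N"
  proof -
    have "\<bar>Sc dd \<bullet> (Q *v e)\<bar> \<le> norm (Sc dd) * norm (Q *v e)" by (rule Cauchy_Schwarz_ineq2)
    also have "\<dots> \<le> norm dd * (nQ * N)" by (rule mult_mono[OF norm_Sc_le Qe]) auto
    finally show ?thesis by (simp add: mult_ac)
  qed
  have "Sc (drift z - drift x + (first_unit \<bullet> (z - x) - \<nu>) *\<^sub>R p\<theta> - dd) \<bullet> (Q *v e)
      \<le> - (q * \<theta> / 2) * N\<^sup>2 + R * N"
    unfolding dec inner_diff_left inner_add_left R_def distrib_right[of _ _ N]
    using t1 t2 t3 t4 by (simp add: field_simps)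
  moreover have "2 * (R * N) \<le> q * \<theta> / 2 * N\<^sup>2 + 2 / (q * \<theta>) * R\<^sup>2"
  proof -
    define c where "c = q * \<theta>"
    have c: "c > 0" unfolding c_def using q \<theta>0 by simp
    have "0 \<le> (c * N - 2 * R)\<^sup>2 / (2 * c)" using c by simp
    also have "\<dots> = c / 2 * N\<^sup>2 + 2 / c * R\<^sup>2 - 2 * (R * N)"
      using c by (simp add: power2_eq_square field_simps)
    finally show ?thesis unfolding c_def by simp
  qed
  moreover have "2 * decay * (e \<bullet> (Q *v e)) \<le> q * \<theta> / 2 * N\<^sup>2"
  proof -
    have "2 * decay * (e \<bullet> (Q *v e)) \<le> 2 * decay * (nQ * N\<^sup>2)"
      unfolding N_def using form_Q_le decay_pos by (intro mult_left_mono) auto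
    also have "\<dots> = q * \<theta> / 2 * N\<^sup>2" unfolding decay_def using nQ_pos by simp
    finally show ?thesis .
  qed
  ultimately show ?thesis unfolding R_def by linarith
qed

lemma norm_le_sqrt_form_Q: "norm e \<le> sqrt (e \<bullet> (Q *v e)) / sqrt a"
proof -
  have "sqrt a * norm e \<le> sqrt (e \<bullet> (Q *v e))"
    using a by (intro real_le_rsqrt) (simp add: power_mult_distrib)
  then show ?thesis using a(1) by (simp add: field_simps)
qed

lemma sqrt_form_Q_le: "sqrt (e \<bullet> (Q *v e)) \<le> sqrt nQ * norm e"
proof -
  have "sqrt (e \<bullet> (Q *v e)) \<le> sqrt (nQ * (norm e)\<^sup>2)" by (rule real_sqrt_le_mono[OF form_Q_le])
  then show ?thesis by (simp add: real_sqrt_mult)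
qed

end

lemma norm_four_terms: "norm (A - B + C - D) \<le> norm A + norm B + norm C + norm D"
  using norm_triangle_ineq4[of "A - B
      + C" D] norm_triangle_ineq[of "A - B" C] norm_triangle_ineq4[of A B]
  by linarith

section \<open>Small gain between the observer error and the inter-sample error\<close>

context stable_loop
begin

text \<open>A round trip: the quotient by \<open>sqrt a\<close> is the gain from the Lyapunov size
  of the error to the output error accumulated over a sampling interval.
  \<open>norm (Q *v p)\<close> over the other root is the gain back, obtained by solving 2 R^2 / (q
  \<theta>) = 2 (\<open>decay\<close> - \<sigma>) M for sqrt M.\<close>

definition observer_gain :: "real \<Rightarrow> real" where
  "observer_gain \<sigma> = norm (Q *v p) * (T1 * \<theta> * (L
      + \<theta>) * exp (\<sigma> * T1) / sqrt a) / sqrt (q * \<theta> * (decay - \<sigma>))"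

definition obs_err :: "(real \<Rightarrow> 'n rvec) \<Rightarrow> (real \<Rightarrow> 'n rvec) \<Rightarrow> real \<Rightarrow> 'n rvec" where
  "obs_err x z s = z s - x (s - r)"

definition out_err :: "(real \<Rightarrow> 'n rvec) \<Rightarrow> (real \<Rightarrow> real) \<Rightarrow> real \<Rightarrow> real" where
  "out_err x w s = w s - first_unit \<bullet> x (s - r)"

definition obs_size :: "(real \<Rightarrow> 'n rvec) \<Rightarrow> (real \<Rightarrow> 'n rvec) \<Rightarrow> real \<Rightarrow> real" where
  "obs_size x z s = sqrt (Sc (obs_err x z s) \<bullet> (Q *v Sc (obs_err x z s)))"

lemma obs_size_nonneg: "obs_size x z s \<ge> 0"
  unfolding obs_size_def
  by (rule real_sqrt_ge_zero, rule order_trans[OF _ a(2)]) (use a(1) in simp)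

lemma norm_Sc_obs_err: "norm (Sc (obs_err x z s)) \<le> obs_size x z s / sqrt a"
  unfolding obs_size_def by (rule norm_le_sqrt_form_Q)

context
  fixes \<xi> b :: "real \<Rightarrow> real" and d x :: "real \<Rightarrow> 'n rvec" and u :: "real \<Rightarrow> real"
    and z :: "real \<Rightarrow> 'n rvec" and w :: "real \<Rightarrow> real"
  assumes tr: "traj \<xi> b d x u z w"
begin

text \<open>The starting time is \<open>r\<close> because before it the delayed state is the initial
  function, which need not be absolutely continuous. Its input \<open>u (s - hor)\<close> is the one
  fed to the observer and cancels in the error equation.\<close>

lemma delayed_plant_ac: "ac_derivative_on {r..t} (\<lambda>s. x (s - r))
    (\<lambda>s. drift (x (s - r)) + \<delta> d x u (s - r) + u (s - hor) *\<^sub>R last_unit)"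
proof -
  have "ac_derivative_on {0..t-r} x (\<lambda>t. drift (x t) + \<delta> d x u t + u (t - \<tau>) *\<^sub>R last_unit)"
    by (rule ac_derivative_on_subset[OF plant_ac[OF tr]]) auto
  from ac_derivative_on_shift_Icc[OF this, of "-r"] show ?thesis by (simp add: diff_diff_eq)
qed

lemma obs_err_ac: "ac_derivative_on {r..t} (obs_err x z)
    (\<lambda>s. drift (z s) - drift (x (s - r))
        + (first_unit \<bullet> (z s - x (s - r)) - out_err x w s) *\<^sub>R p\<theta> - \<delta> d x u (s - r))"
proof -
  have "ac_derivative_on {r..t} z
   (\<lambda>t. drift (z t) + (first_unit \<bullet> z t - w t) *\<^sub>R p\<theta> + u (t - hor) *\<^sub>R last_unit)"
    by (rule ac_derivative_on_subset[OF observer_ac[OF tr]]) (use delays in auto)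
  from ac_derivative_on_diff[OF this delayed_plant_ac] show ?thesis
    by (rule ac_derivative_on_cong) (auto simp: obs_err_def out_err_def inner_diff_right)
qed

text \<open>Since the last sample, at most \<open>T1\<close> ago because \<open>b\<close> is
  nonnegative, the output error is the measurement error plus an integral of the mismatch between
  predicted and true output derivative. Starting at \<open>r + T1\<close> ensures that this sample
  exists and was taken at or after time \<open>r\<close>.\<close>

lemma out_err_bound:
  assumes dat: "data_bound \<sigma> E t \<xi> d x u z w" and \<sigma>: "0 \<le> \<sigma>" and s: "s \<in> {r + T1..t}"
    and Y: "\<And>v. v \<in> {r..s} \<Longrightarrow> exp (\<sigma> * v) * obs_size x z v \<le> Y"
  shows "exp (\<sigma> * s) * \<bar>out_err x w s\<bar> \<le> T1 * \<theta> * (L + \<theta>) * exp (\<sigma> * T1) / sqrt a * Y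
    + (exp (\<sigma> * T1) + T1 * G * exp (\<sigma> * (T1 + r))) * E"
proof -
  have E0: "E \<ge> 0" by (rule data_bound_nonneg[OF dat])
  have Y0: "Y \<ge> 0"
    by (rule order_trans[OF _ Y[of s]]) (use obs_size_nonneg s T1 in auto)
  note smp = traj_sampling[OF tr]
  have s0: "s \<ge> 0" using s T1 delays by auto
  define i where "i = sample_index T1 b s"
  define v0 where "v0 = sampling_time T1 b i"
  have i: "v0 \<le> s" "s < sampling_time T1 b (Suc i)" "v0 \<ge> 0"
    using sample_index[OF T1 smp(1) s0] sampling_time_nonneg[OF T1] unfolding i_def v0_def by auto
  have step: "sampling_time T1 b (Suc i) \<le> v0 + T1"
    using T1 smp(2)[OF i(3)] unfolding v0_def by simp
  have v0: "s - T1 \<le> v0" "r \<le> v0" using i step s by auto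
  \<comment> \<open>Interval 0 starts from the arbitrary value \<open>w 0\<close> rather than a
    measurement; it ends by \<open>T1\<close>, so \<open>s\<close> lies beyond it.\<close>
  obtain i' where i': "i = Suc i'"
  proof (cases i)
    case 0
    then have "s < T1" using i(2) step unfolding v0_def by simp
    then show ?thesis using s delays by auto
  qed
  define A where "A = exp (\<sigma> * T1) * (Y / sqrt a)"
  define D where "D = exp (\<sigma> * (T1 + r)) * E"
  have A0: "A \<ge> 0" "D \<ge> 0" unfolding A_def D_def using Y0 a E0 by auto
  define h where "h v = first_unit \<bullet> drift (z v) - first_unit \<bullet> (drift (x (v - r))
      + \<delta> d x u (v - r) + u (v - hor) *\<^sub>R last_unit)" for v
  have hb: "norm (h v) \<le> exp (- \<sigma> * s) * (\<theta> * (L + \<theta>) * A + G * D)" if v: "v \<in> {v0..s}" for v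
  proof -
    \<comment> \<open>With at least two coordinates the input does not act on the measured one, so
      the output error is free of \<open>u\<close>.\<close>
    have fl: "first_unit \<bullet> (last_unit :: 'n rvec) = 0"
    proof -
      have "Min UNIV \<noteq> (Max UNIV :: 'n)"
      proof
        assume eq: "Min UNIV = (Max UNIV :: 'n)"
        have "i = Max UNIV" for i :: 'n
          using Min_le[of UNIV i] Max_ge[of UNIV i] eq by (intro antisym) auto
        then have "(UNIV :: 'n set) = {Max UNIV}" by auto
        then have "CARD('n) = 1" by (metis card_1_singleton_iff One_nat_def)
        then show False using n n2 by simp
      qed
      then show ?thesis unfolding first_unit_inner last_unit_def by (simp add: axis_def)
    qed
    have "norm (Sc (z v - x (v - r))) \<le> obs_size x z v / sqrt a"
      using norm_Sc_obs_err[of x z v] unfolding obs_err_def .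
    also have "\<dots> \<le> exp (- \<sigma> * s) * (exp (\<sigma> * T1) * Y) / sqrt a"
      by (intro divide_right_mono exp_window[OF Y]) (use v v0 \<sigma> Y0 a in auto)
    finally have 1: "norm (Sc (z v - x (v - r))) \<le> exp (- \<sigma> * s) * A" unfolding A_def by simp
    have "norm (d (v - r)) \<le> exp (- \<sigma> * s) * (exp (\<sigma> * (T1 + r)) * E)"
      by (rule exp_window[where c = "v - r"])
        (use dat v v0 s \<sigma> E0 delays in \<open>auto simp: data_bound_def\<close>)
    then have "G * norm (d (v - r)) \<le> G * (exp (- \<sigma> * s) * D)"
      unfolding D_def by (rule mult_left_mono[OF _ G_nonneg])
    then have 2: "\<bar>first_unit \<bullet> \<delta> d x u (v - r)\<bar> \<le> G * (exp (- \<sigma> * s) * D)"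
      by (intro order_trans[OF abs_first_unit_inner_le] order_trans[OF g_diag_bound])
    have "h v = first_unit \<bullet> (drift (z v) - drift (x (v - r))) - first_unit \<bullet> \<delta> d x u (v - r)"
      unfolding h_def by (simp add: inner_diff_right inner_add_right fl)
    then have "norm (h v) \<le> \<theta> * (L + \<theta>) * norm (Sc (z v - x (v - r))) + G * (exp (- \<sigma> * s) * D)"
      using first_drift_diff[of "z v" "x (v - r)"] 2 by (simp only: real_norm_def)
    also have "\<dots> \<le> \<theta> * (L + \<theta>) * (exp (- \<sigma> * s) * A) + G * (exp (- \<sigma> * s) * D)"
      using 1 L \<theta>0 by (intro add_right_mono mult_left_mono) auto
    also have "\<dots> = exp (- \<sigma> * s) * (\<theta> * (L + \<theta>) * A + G * D)" by algebra
    finally show ?thesis .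
  qed
  have ac: "ac_derivative_on {r..s} (\<lambda>v. first_unit \<bullet> x (v - r))
      (\<lambda>v. first_unit \<bullet> (drift (x (v - r)) + \<delta> d x u (v - r) + u (v - hor) *\<^sub>R last_unit))"
    by (rule ac_derivative_on_linear[OF delayed_plant_ac bounded_linear_inner_right])
  have v0s: "v0 \<in> {r..s}" "s \<in> {r..s}" using v0 i by auto
  note xs = ac_derivative_onD[OF ac v0s i(1)]
  have ws: "(\<lambda>s. first_unit \<bullet> drift (z s)) integrable_on {v0..s}"
    "w s = w v0 + integral {v0..s} (\<lambda>s. first_unit \<bullet> drift (z s))"
    using w_eq[OF tr, of s i] i unfolding v0_def by auto
  have "w v0 = first_unit \<bullet> x (v0 - r) + \<xi> v0"
    using w_sample[OF tr, of i'] unfolding v0_def i' .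
  then have "out_err x w s = \<xi> v0 + integral {v0..s} h"
    unfolding out_err_def h_def using xs(3) ws by (simp add: integral_diff[OF ws(1) xs(2)])
  moreover have "norm (integral {v0..s} h) \<le> T1 * (exp (- \<sigma> * s) * (\<theta> * (L + \<theta>) * A + G * D))"
  proof -
    have "norm (integral {v0..s} h) \<le> integral {v0..s} (\<lambda>_. exp (- \<sigma> * s) * (\<theta> * (L + \<theta>) * A
        + G * D))"
      by (rule integral_norm_bound_integral)
          (use hb ws xs in \<open>auto simp: h_def[abs_def] intro!: integrable_diff\<close>)
    also have "\<dots> = (s - v0) * (exp (- \<sigma> * s) * (\<theta> * (L + \<theta>) * A + G * D))" using i by simp
    also have "\<dots> \<le> T1 * (exp (- \<sigma> * s) * (\<theta> * (L + \<theta>) * A + G * D))"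
      using v0 A0 L \<theta>0 G_nonneg by (intro mult_right_mono) auto
    finally show ?thesis .
  qed
  moreover have "\<bar>\<xi> v0\<bar> \<le> exp (- \<sigma> * s) * (exp (\<sigma> * T1) * E)"
    by (rule exp_window[where c = v0]) (use dat i v0 s \<sigma> E0 in \<open>auto simp: data_bound_def\<close>)
  ultimately have "\<bar>out_err x w s\<bar> \<le> exp (- \<sigma> * s) * (exp (\<sigma> * T1) * E)
      + T1 * (exp (- \<sigma> * s) * (\<theta> * (L + \<theta>) * A + G * D))"
    using abs_triangle_ineq[of "\<xi> v0" "integral {v0..s} h"] by (simp only: real_norm_def)
  also have "\<dots> = exp (- \<sigma> * s) * (exp (\<sigma> * T1) * E + T1 * (\<theta> * (L + \<theta>) * A + G * D))" by algebra
  finally have "exp (\<sigma> * s) * \<bar>out_err x w s\<bar>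
      \<le> exp (\<sigma> * s) * (exp (- \<sigma> * s) * (exp (\<sigma> * T1) * E + T1 * (\<theta> * (L + \<theta>) * A + G * D)))"
    by (rule mult_left_mono) simp
  also have "\<dots> = exp (\<sigma> * T1) * E + T1 * (\<theta> * (L + \<theta>) * A + G * D)"
    by (simp add: exp_minus)
  also have "\<dots> = T1 * \<theta> * (L + \<theta>) * exp (\<sigma> * T1) / sqrt a * Y
    + (exp (\<sigma> * T1) + T1 * G * exp (\<sigma> * (T1 + r))) * E"
    unfolding A_def D_def by (simp add: algebra_simps add_divide_distrib)
  finally show ?thesis .
qed

end

definition observer_const :: "real \<Rightarrow> real \<Rightarrow> bool" where
  "observer_const \<sigma> C \<longleftrightarrow> C \<ge> 0 \<and> (\<forall>\<xi> b d x u z w E t. traj \<xi> b d x u z w \<longrightarrow>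
     data_bound \<sigma> E t \<xi> d x u z w \<longrightarrow>
     (\<forall>s\<in>{r..t}. exp (\<sigma> * s) * norm (z s - x (s - r)) \<le> C * E) \<and>
     (\<forall>s\<in>{r + T1..t}. exp (\<sigma> * s) * \<bar>w s - first_unit \<bullet> x (s - r)\<bar> \<le> C * E))"

lemma observer_constD:
  assumes "observer_const \<sigma> C" "traj \<xi> b d x u z w" "data_bound \<sigma> E t \<xi> d x u z w"
  shows "s \<in> {r..t} \<Longrightarrow> exp (\<sigma> * s) * norm (z s - x (s - r)) \<le> C * E"
    "s \<in> {r + T1..t} \<Longrightarrow> exp (\<sigma> * s) * \<bar>w s - first_unit \<bullet> x (s - r)\<bar> \<le> C * E"
  using assms unfolding observer_const_def by blast+

text \<open>The small-gain quantity is the weighted Lyapunov size on \<open>{r..t}\<close>. Up to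
  \<open>r + T1\<close> the transient bound covers it; afterwards the Lyapunov inequality applies,
  with the output error bounded by the same supremum times \<open>\<rho>1\<close>.\<close>

lemma observer_const_exists:
  assumes \<sigma>: "0 < \<sigma>" "\<sigma> < decay" and gain: "observer_gain \<sigma> < 1"
  shows "\<exists>C. observer_const \<sigma> C"
proof -
  obtain C0 where tb': "transient_const (r + T1) C0" using transient_const_exists by blast
  then have C0: "C0 \<ge> 0" unfolding transient_const_def by simp
  note tb = transient_constD[OF tb']
  define \<rho>1 where "\<rho>1 = T1 * \<theta> * (L + \<theta>) * exp (\<sigma> * T1) / sqrt a"
  define c1 where "c1 = exp (\<sigma> * T1) + T1 * G * exp (\<sigma> * (T1 + r))"
  define c2 where "c2 = norm (Q *v p) * c1 + nQ * (G * exp (\<sigma> * r))"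
  define D where "D = sqrt (q * \<theta> * (decay - \<sigma>))"
  define cA where "cA = exp (\<sigma> * (r + T1)) * (sqrt nQ * (2 * C0))"
  define \<rho> where "\<rho> = norm (Q *v p) * \<rho>1 / D"
  define cB where "cB = (cA + c2 / D) / (1 - \<rho>)"
  have D: "D > 0" unfolding D_def using q \<theta>0 \<sigma> by simp
  have \<rho>1: "\<rho>1 \<ge> 0" unfolding \<rho>1_def using T1 \<theta>0 L a by simp
  have \<rho>: "\<rho> < 1" using gain unfolding observer_gain_def \<rho>_def \<rho>1_def D_def .
  have \<rho>0: "\<rho> \<ge> 0" unfolding \<rho>_def using \<rho>1 D by simp
  have c1: "c1 \<ge> 0" unfolding c1_def using T1 G_nonneg by simp
  have c2: "c2 \<ge> 0" unfolding c2_def using c1 nQ_pos G_nonneg by simp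
  have cA: "cA \<ge> 0" unfolding cA_def using C0 nQ_pos by simp
  have cB: "cB \<ge> 0" unfolding cB_def using cA c2 D \<rho> by simp
  show ?thesis
    unfolding observer_const_def
  proof (intro exI[of _ "\<theta> ^ n * (cB / sqrt a) + (\<rho>1 * cB + c1)"] conjI allI impI)
    show "0 \<le> \<theta> ^ n * (cB / sqrt a) + (\<rho>1 * cB + c1)"
      using cB c1 \<rho>1 a \<theta>0 by simp
    fix \<xi> b d x u z w E t
    assume tr: "traj \<xi> b d x u z w" and dat: "data_bound \<sigma> E t \<xi> d x u z w"
    have E0: "E \<ge> 0" by (rule data_bound_nonneg[OF dat])
    have dat0: "data_bound 0 E t \<xi> d x u z w" by (rule data_bound_mono[OF dat]) (use \<sigma> in auto)
    define N where "N = obs_size x z"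
    define V where "V s = Sc (obs_err x z s) \<bullet> (Q *v Sc (obs_err x z s))" for s
    have NV: "N s = sqrt (V s)" "V s \<ge> 0" "V s = (N s)\<^sup>2" for s
    proof -
      show "N s = sqrt (V s)" unfolding N_def V_def obs_size_def ..
      show "V s \<ge> 0" unfolding V_def by (rule order_trans[OF _ a(2)]) (use a(1) in simp)
      then show "V s = (N s)\<^sup>2" using \<open>N s = sqrt (V s)\<close> by simp
    qed
    have cerr: "continuous_on {r..t} (\<lambda>s. Sc (obs_err x z s))"
      by (rule ac_derivative_on_continuous[OF ac_derivative_on_linear[OF obs_err_ac[OF tr]
          bounded_linear_Sc]])
    have cV: "continuous_on {r..t} V"
      unfolding V_def
      by (intro continuous_on_inner cerr linear_continuous_on_compose[OF cerr])
        (simp add: matrix_vector_mul_linear)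
    have early: "exp (\<sigma> * s) * N s \<le> cA * E" if s: "s \<in> {r..t}" "s \<le> r + T1" for s
    proof -
      have "norm (z s) \<le> C0 * E" "norm (x (s - r)) \<le> C0 * E"
        using tb[OF tr dat0, of s] tb[OF tr dat0, of "s - r"] s delays T1 by auto
      then have "norm (obs_err x z s) \<le> 2 * C0 * E"
        unfolding obs_err_def using norm_triangle_ineq4[of "z s" "x (s - r)"] by linarith
      then have "norm (Sc (obs_err x z s)) \<le> 2 * C0 * E" using norm_Sc_le order_trans by blast
      then have "N s \<le> sqrt nQ * (2 * C0 * E)"
        unfolding N_def obs_size_def using nQ_pos
        by (intro order_trans[OF sqrt_form_Q_le] mult_left_mono) auto
      moreover have "exp (\<sigma> * s) \<le> exp (\<sigma> * (r + T1))" using s \<sigma> by simp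
      ultimately have "exp (\<sigma> * s) * N s \<le> exp (\<sigma> * (r + T1)) * (sqrt nQ * (2 * C0 * E))"
        unfolding N_def by (intro mult_mono obs_size_nonneg) auto
      then show ?thesis unfolding cA_def by (simp only: mult_ac)
    qed
    have main: "exp (\<sigma> * s) * N s \<le> (cA + c2 / D) * E + \<rho> * Y"
      if Y: "\<And>s. s \<in> {r..t} \<Longrightarrow> exp (\<sigma> * s) * N s \<le> Y" and s: "s \<in> {r..t}" for Y s
    proof (cases "s \<le> r + T1")
      case True
      have "0 \<le> exp (\<sigma> * s) * N s" unfolding N_def by (simp add: obs_size_nonneg)
      then have Y0: "Y \<ge> 0" using Y[OF s] by linarith
      have "0 \<le> c2 / D * E" "0 \<le> \<rho> * Y" using c2 D E0 \<rho>0 Y0 by auto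
      then show ?thesis using early[OF s True] by (simp add: distrib_right)
    next
      case False
      define t1 where "t1 = r + T1"
      have t1: "t1 \<in> {r..t}" "s \<in> {t1..t}" unfolding t1_def using False s T1 by auto
      have Y0: "Y \<ge> 0" by (rule order_trans[OF _ Y[OF s]]) (simp add: N_def obs_size_nonneg)
      define R where "R = norm (Q *v p) * (\<rho>1 * Y) + c2 * E"
      have R0: "R \<ge> 0" unfolding R_def using \<rho>1 Y0 c2 E0 by simp
      \<comment> \<open>The first summand dominates the initial value at \<open>t1\<close> and the
        second the forcing. Squaring their sum covers both, and its root is affine in
        \<open>E\<close> and \<open>Y\<close>.\<close>
      define M where "M = (cA * E + R / D)\<^sup>2"
      define \<eta> where "\<eta> s = Sc (drift (z s) - drift (x (s - r))
          + (first_unit \<bullet> (z s - x (s - r)) - out_err x w s) *\<^sub>R p\<theta> - \<delta> d x u (s - r))" for s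
      have ac: "ac_derivative_on {r..t} (\<lambda>s. Sc (obs_err x z s)) \<eta>"
        unfolding \<eta>_def by (rule ac_derivative_on_linear[OF obs_err_ac[OF tr] bounded_linear_Sc])
      \<comment> \<open>This constant depends on \<open>t\<close>. It only shows that the derivative
        is bounded, as the increment formula for quadratic forms requires, and enters no later
        constant.\<close>
      obtain Ct where tbt': "transient_const t Ct" using transient_const_exists by blast
      then have Ct: "Ct \<ge> 0" unfolding transient_const_def by simp
      note tbt = transient_constD[OF tbt']
      have \<eta>b: "norm (\<eta> v) \<le> L\<^sub>F * (Ct * E) + L\<^sub>F * (Ct * E) + (Ct * E + Ct * E) * norm p\<theta> + G * E"
        if v: "v \<in> {r..t}" for v
      proof -
        have zb: "norm (z v) \<le> Ct * E" "\<bar>w v\<bar> \<le> Ct * E" "norm (x (v - r)) \<le> Ct * E"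
          using tbt[OF tr dat0, of v] tbt[OF tr dat0, of "v - r"] v delays by auto
        have dr: "norm (drift y) \<le> L\<^sub>F * (Ct * E)" if "norm y \<le> Ct * E" for y
          using norm_drift[of y] mult_left_mono[OF that Lambda_nonneg] by linarith
        have "\<bar>first_unit \<bullet> z v - w v\<bar> \<le> Ct * E + Ct * E"
          using zb abs_first_unit_inner_le[of "z v"] by linarith
        then have i: "norm ((first_unit \<bullet> z v - w v) *\<^sub>R p\<theta>) \<le> (Ct * E + Ct * E) * norm p\<theta>"
          unfolding norm_scaleR by (rule mult_right_mono) simp
        have "norm (d (v - r)) \<le> E" using dat0 v delays unfolding data_bound_def by auto
        then have dd: "norm (\<delta> d x u (v - r)) \<le> G * E"
          by (intro order_trans[OF g_diag_bound] mult_left_mono G_nonneg)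
        have "first_unit \<bullet> (z v - x (v - r)) - out_err x w v = first_unit \<bullet> z v - w v"
          unfolding out_err_def by (simp add: inner_diff_right)
        then have "norm (\<eta> v) \<le> norm (drift (z v) - drift (x (v - r))
            + (first_unit \<bullet> z v - w v) *\<^sub>R p\<theta> - \<delta> d x u (v - r))"
          unfolding \<eta>_def using norm_Sc_le by simp
        also have "\<dots> \<le> norm (drift (z v)) + norm (drift (x (v - r)))
            + norm ((first_unit \<bullet> z v - w v) *\<^sub>R p\<theta>) + norm (\<delta> d x u (v - r))"
          by (rule norm_four_terms)
        also have "\<dots> \<le> L\<^sub>F * (Ct * E) + L\<^sub>F * (Ct * E) + (Ct * E + Ct * E) * norm p\<theta> + G * E"
          by (intro add_mono dr zb i dd)
        finally show ?thesis .
      qed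
      have "V s \<le> exp (- 2 * \<sigma> * s) * M"
      proof (rule exponential_comparison[where a = t1 and b = t and \<kappa> = decay
          and B = "2 / (q * \<theta>) * R\<^sup>2"
            and v = "\<lambda>s. 2 * (\<eta> s \<bullet> (Q *v Sc (obs_err x z s)))"])
        show "continuous_on {t1..t} V" by (rule continuous_on_subset[OF cV]) (use t1 in auto)
        show "V t1 \<le> exp (- 2 * \<sigma> * t1) * M"
        proof -
          have "exp (\<sigma> * t1) * N t1 \<le> cA * E + R / D"
            using early[OF t1(1)] R0 D unfolding t1_def by (simp add: add_increasing2)
          then have "(exp (\<sigma> * t1) * N t1)\<^sup>2 \<le> M"
            unfolding M_def N_def by (rule power_mono) (simp add: obs_size_nonneg)
          then have "exp (2 * \<sigma> * t1) * V t1 \<le> M"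
            unfolding NV(3) power_mult_distrib by (simp add: exp_double[symmetric] mult.assoc)
          then show ?thesis using exp_mult_imp_le[of "2 * \<sigma>" t1 "V t1" M] by simp
        qed
        show "(\<lambda>s. 2 * (\<eta> s \<bullet> (Q *v Sc (obs_err x z s)))) integrable_on {s..s'} \<and>
            V s' - V s = integral {s..s'} (\<lambda>s. 2 * (\<eta> s \<bullet> (Q *v Sc (obs_err x z s))))"
          if "t1 \<le> s" "s \<le> s'" "s' \<le> t" for s s'
        proof -
          have sym: "transpose Q = Q" using Q unfolding sym_pos_def_def by simp
          have "ac_derivative_on {s..s'} (\<lambda>s. Sc (obs_err x z s)) \<eta>"
            by (rule ac_derivative_on_subset[OF ac]) (use that t1 in auto)
          from quadratic_form_increment[OF this that(2) \<eta>b matrix_vector_mul_bounded_linear[of Q]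
              symmetric_form[OF sym]]
          show ?thesis unfolding V_def using that t1 by auto
        qed
        show "2 * (\<eta> v \<bullet> (Q *v Sc (obs_err x z v)))
            \<le> - 2 * decay * V v + exp (- 2 * \<sigma> * v) * (2 / (q * \<theta>) * R\<^sup>2)"
          if v: "v \<in> {t1..t}" for v
        proof -
          have vr: "v \<in> {r..t}" using v t1 by auto
          have "exp (\<sigma> * v) * \<bar>out_err x w v\<bar> \<le> \<rho>1 * Y + c1 * E"
            unfolding \<rho>1_def c1_def
            by (rule out_err_bound[OF tr dat]) (use \<sigma> v Y vr in \<open>auto simp: t1_def N_def\<close>)
          then have 1: "\<bar>out_err x w v\<bar> \<le> exp (- \<sigma> * v) * (\<rho>1 * Y + c1 * E)"
              by (rule exp_mult_imp_le)
          have "norm (d (v - r)) \<le> exp (- \<sigma> * v) * (exp (\<sigma> * r) * E)"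
            by (rule exp_window[where c = "v - r"])
                (use dat vr \<sigma> E0 delays in \<open>auto simp: data_bound_def\<close>)
          then have "G * norm (d (v - r)) \<le> G * (exp (- \<sigma> * v) * (exp (\<sigma> * r) * E))"
            by (rule mult_left_mono[OF _ G_nonneg])
          then have 2: "norm (\<delta> d x u (v - r)) \<le> G * (exp (- \<sigma> * v) * (exp (\<sigma> * r) * E))"
            by (intro order_trans[OF g_diag_bound])
          have "norm (Q *v p) * \<bar>out_err x w v\<bar> + nQ * norm (\<delta> d x u (v - r))
            \<le> norm (Q *v p) * (exp (- \<sigma> * v) * (\<rho>1 * Y + c1 * E))
                + nQ * (G * (exp (- \<sigma> * v) * (exp (\<sigma> * r) * E)))"
            by (intro add_mono mult_left_mono 1 2) (use nQ_pos in auto)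
          also have "\<dots> = exp (- \<sigma> * v) * R" unfolding R_def c2_def by algebra
          finally have "(norm (Q *v p) * \<bar>out_err x w v\<bar> + nQ * norm (\<delta> d x u (v - r)))\<^sup>2
              \<le> (exp (- \<sigma> * v) * R)\<^sup>2"
            by (rule power_mono) (use nQ_pos in simp)
          also have "\<dots> = exp (- 2 * \<sigma> * v) * R\<^sup>2"
            by (simp add: power_mult_distrib exp_double[symmetric] mult.assoc)
          finally have "2 / (q * \<theta>) * (norm (Q *v p) * \<bar>out_err x w v\<bar>
              + nQ * norm (\<delta> d x u (v - r)))\<^sup>2
            \<le> 2 / (q * \<theta>) * (exp (- 2 * \<sigma> * v) * R\<^sup>2)"
            by (rule mult_left_mono) (use q \<theta>0 in simp)
          then show ?thesis
            using observer_rate[of "z v" "x (v - r)" "out_err x w v" "\<delta> d x u (v - r)"]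
            unfolding \<eta>_def V_def obs_err_def by (simp add: mult_ac)
        qed
        show "2 / (q * \<theta>) * R\<^sup>2 \<le> 2 * (decay - \<sigma>) * M"
        proof -
          have "R / D \<le> cA * E + R / D" using cA E0 by simp
          then have "(R / D)\<^sup>2 \<le> M" unfolding M_def by (rule power_mono) (use R0 D in simp)
          then have "2 * (decay - \<sigma>) * (R / D)\<^sup>2 \<le> 2 * (decay - \<sigma>) * M"
            by (rule mult_left_mono) (use \<sigma> in simp)
          moreover have "2 * (decay - \<sigma>) * (R / D)\<^sup>2 = 2 / (q * \<theta>) * R\<^sup>2"
          proof -
            have "D\<^sup>2 = q * \<theta> * (decay - \<sigma>)" unfolding D_def using q \<theta>0 \<sigma> by simp
            note D2 = this
            have e: "2 * e * (R\<^sup>2 / (q * \<theta> * e)) = 2 / (q * \<theta>) * R\<^sup>2" if "e \<noteq> 0" for e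
              using that q \<theta>0 by (simp add: field_simps)
            show ?thesis unfolding power_divide D2 by (rule e) (use \<sigma> in simp)
          qed
          ultimately show ?thesis by simp
        qed
      qed (use decay_pos t1 in auto)
      then have "exp (2 * \<sigma> * s) * V s \<le> exp (2 * \<sigma> * s) * (exp (- 2 * \<sigma> * s) * M)"
        by (intro mult_left_mono) auto
      also have "\<dots> = M" by (simp add: exp_minus)
      finally have "(exp (\<sigma> * s) * N s)\<^sup>2 \<le> (cA * E + R / D)\<^sup>2"
        unfolding NV(3) power_mult_distrib M_def by (simp add: exp_double[symmetric] mult.assoc)
      then have "exp (\<sigma> * s) * N s \<le> cA * E + R / D"
        by (rule power2_le_imp_le) (use cA E0 R0 D in simp)
      also have "\<dots> = (cA + c2 / D) * E + \<rho> * Y"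
        unfolding R_def \<rho>_def by (simp add: add_divide_distrib distrib_right)
      finally show ?thesis .
    qed
    have bdd: "bdd_above ((\<lambda>s. exp (\<sigma> * s) * N s) ` {r..t})"
    proof -
      have "continuous_on {r..t} (\<lambda>s. exp (\<sigma> * s) * N s)"
        unfolding NV(1) by (intro continuous_on_mult continuous_intros cV)
      then show ?thesis by (intro bounded_imp_bdd_above compact_imp_bounded
          compact_continuous_image) auto
    qed
    have NB: "exp (\<sigma> * s) * N s \<le> cB * E" if "s \<in> {r..t}" for s
      using small_gain[of "\<lambda>s. exp (\<sigma> * s) * N s", OF bdd \<rho> main that] unfolding cB_def by simp
    show "\<forall>s\<in>{r..t}. exp (\<sigma> * s) * norm (z s - x (s - r))
        \<le> (\<theta> ^ n * (cB / sqrt a) + (\<rho>1 * cB + c1)) * E"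
    proof
      fix s assume s: "s \<in> {r..t}"
      have "norm (z s - x (s - r)) \<le> \<theta> ^ n * (N s / sqrt a)"
        using norm_le_Sc[of "obs_err x z s"] mult_left_mono[OF norm_Sc_obs_err[of x z s], of
            "\<theta> ^ n"] \<theta>0
        unfolding N_def obs_err_def by simp
      then have "exp (\<sigma> * s) * norm (z s - x (s - r)) \<le> exp (\<sigma> * s) * (\<theta> ^ n * (N s / sqrt a))"
        by (rule mult_left_mono) simp
      also have "\<dots> = \<theta> ^ n * ((exp (\<sigma> * s) * N s) / sqrt a)" by simp
      also have "\<dots> \<le> \<theta> ^ n * ((cB * E) / sqrt a)"
        using NB[OF s] \<theta>0 a by (intro mult_left_mono divide_right_mono) auto
      also have "\<dots> \<le> (\<theta> ^ n * (cB / sqrt a) + (\<rho>1 * cB + c1)) * E"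
        using mult_nonneg_nonneg[OF add_nonneg_nonneg[OF mult_nonneg_nonneg[OF \<rho>1 cB] c1] E0]
            by (simp add: distrib_right)
      finally show "exp (\<sigma> * s) * norm (z s - x (s - r))
          \<le> (\<theta> ^ n * (cB / sqrt a) + (\<rho>1 * cB + c1)) * E" .
    qed
    show "\<forall>s\<in>{r + T1..t}. exp (\<sigma> * s) * \<bar>w s - first_unit \<bullet> x (s - r)\<bar>
        \<le> (\<theta> ^ n * (cB / sqrt a) + (\<rho>1 * cB + c1)) * E"
    proof
      fix s assume s: "s \<in> {r + T1..t}"
      have "exp (\<sigma> * s) * \<bar>out_err x w s\<bar> \<le> \<rho>1 * (cB * E) + c1 * E"
        unfolding \<rho>1_def c1_def
        by (rule out_err_bound[OF tr dat _ s]) (use \<sigma> NB s in \<open>auto simp: N_def\<close>)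
      also have "\<dots> \<le> (\<theta> ^ n * (cB / sqrt a) + (\<rho>1 * cB + c1)) * E"
      proof -
        have "0 \<le> \<theta> ^ n * (cB / sqrt a) * E" using \<theta>0 cB a E0 by simp
        then show ?thesis by (simp add: distrib_right)
      qed
      finally show "exp (\<sigma> * s) * \<bar>w s - first_unit \<bullet> x (s - r)\<bar>
          \<le> (\<theta> ^ n * (cB / sqrt a) + (\<rho>1 * cB + c1)) * E"
        unfolding out_err_def .
    qed
  qed
qed

end

section \<open>The controlled state\<close>

lemma ac_derivative_on_combine:
  assumes 1: "ac_derivative_on {a..b} y h" and 2: "ac_derivative_on {b..c} y h"
  shows "ac_derivative_on {a..c} y h"
  unfolding ac_derivative_on_def
proof (intro ballI impI)
  fix s t assume st: "s \<in> {a..c}" "t \<in> {a..c}" "s \<le> t"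
  consider "t \<le> b" | "b \<le> s" | "s \<le> b" "b \<le> t" by linarith
  then show "h absolutely_integrable_on {s..t} \<and> y t = y s + integral {s..t} h"
  proof cases
    case 1
    have "s \<in> {a..b}" "t \<in> {a..b}" using st 1 by auto
    from ac_derivative_onD[OF assms(1) this st(3)] show ?thesis by blast
  next
    case 2
    have "s \<in> {b..c}" "t \<in> {b..c}" using st 2 by auto
    from ac_derivative_onD[OF assms(2) this st(3)] show ?thesis by blast
  next
    case 3
    have m: "s \<in> {a..b}" "b \<in> {a..b}" "b \<in> {b..c}" "t \<in> {b..c}" using st 3 by auto
    note l = ac_derivative_onD[OF assms(1) m(1,2) 3(1)]
        and r = ac_derivative_onD[OF assms(2) m(3,4) 3(2)]
    have i: "h absolutely_integrable_on {s..t}"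
        by (rule absolutely_integrable_on_combine[OF l(1) r(1) 3])
    have "integral {s..b} h + integral {b..t} h = integral {s..t} h"
      by (rule Henstock_Kurzweil_Integration.integral_combine[OF 3
          set_lebesgue_integral_eq_integral(1)[OF i]])
    then have "y t = y s + integral {s..t} h" unfolding r(3) l(3) by simp
    then show ?thesis using i by blast
  qed
qed

context stable_loop
begin

abbreviation "cP \<equiv> (last_unit :: 'n rvec) \<bullet> (P *v last_unit)"

lemma cP_pos: "cP > 0"
proof -
  have "last_unit \<noteq> (0 :: 'n rvec)" using norm_last_unit[where 'a = 'n]
      by (metis norm_zero zero_neq_one)
  then show ?thesis using P unfolding sym_pos_def_def by blast
qed

text \<open>The gain from the control error to the state: the forcing cP Y^2 / (2 \<mu>) is balanced
  against \<mu> M, and K1 converts sqrt M into the norm. Requiring \<sigma> to be at most \<mu> / 2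
  leaves 2 (\<mu> - \<sigma>) \<ge> \<mu> and keeps \<sigma> out of the formula.\<close>

definition state_gain :: real where "state_gain = sqrt (cP / (2 * K1)) / \<mu>"

text \<open>A control error \<open>Y\<close> produces a state of size \<open>state_gain * Y\<close>,
  hence an input of size \<open>(norm k * state_gain + 1) * Y\<close>. State, multiplied by
  \<open>L\<^sub>F\<close>, and input feed the motion during one hold period and the prediction
  error, with total factor \<open>T2 + \<epsilon>\<close>.\<close>

definition control_gain :: "real \<Rightarrow> real" where
  "control_gain \<sigma> = norm k * exp (\<sigma> * (T2 + hor)) * (T2 + \<epsilon>) * ((L\<^sub>F + norm k) * state_gain + 1)"

text \<open>The actual input \<open>c\<close> is split into \<open>k \<bullet> y\<close>, handled by
  the assumption on \<open>P\<close>, and the control error. The latter acts through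
  \<open>y \<bullet> (P *v last_unit)\<close>, which Cauchy-Schwarz for the form \<open>P\<close>
  bounds; Young's inequality spends half of the available decay on it.\<close>

lemma plant_rate:
  "2 * ((drift y + diag (\<chi> i. g i y v) *v dd + c *\<^sub>R last_unit) \<bullet> (P *v y))
    \<le> - 2 * \<mu> * (y \<bullet> (P *v y)) + (2 * \<gamma> * (norm dd)\<^sup>2 + cP / (2 * \<mu>) * (c - k \<bullet> y)\<^sup>2)"
proof -
  have sym: "transpose P = P" using P unfolding sym_pos_def_def by simp
  define X where "X = y \<bullet> (P *v last_unit)"
  define e where "e = c - k \<bullet> y"
  have "y \<bullet> ((P ** (chain + outer last_unit k)) *v y) = y \<bullet> (P *v (chain *v y)) + (k \<bullet> y) * X"
    unfolding X_def matrix_vector_mul_assoc[symmetric] matrix_vector_mult_add_rdistrib outer_mult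
    by (simp add: matrix_vector_right_distrib matrix_vector_mult_scaleR inner_add_right)
  moreover have "(drift y + diag (\<chi> i. g i y v) *v dd + c *\<^sub>R last_unit) \<bullet> (P *v y)
      = y \<bullet> (P *v fvec f y) + y \<bullet> (P *v (chain *v y)) + y \<bullet> (P *v (diag (\<chi> i. g i y v) *v dd))
          + c * X"
    unfolding X_def symmetric_form[OF sym, of _ y] drift_def
    by (simp add: matrix_vector_right_distrib matrix_vector_mult_scaleR inner_add_right)
  ultimately have "(drift y + diag (\<chi> i. g i y v) *v dd + c *\<^sub>R last_unit) \<bullet> (P *v y)
      \<le> - 2 * \<mu> * (y \<bullet> (P *v y)) + \<gamma> * (norm dd)\<^sup>2 + e * X"
    using P_ineq[of y v dd] unfolding e_def by (simp add: left_diff_distrib)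
  moreover have "2 * (e * X) \<le> 2 * \<mu> * (y \<bullet> (P *v y)) + cP / (2 * \<mu>) * e\<^sup>2"
  proof -
    have "X\<^sup>2 / cP \<le> y \<bullet> (P *v y)"
      using form_Cauchy_Schwarz[OF P, of y last_unit] cP_pos unfolding X_def
          by (simp add: pos_divide_le_eq)
    then have "2 * \<mu> * (X\<^sup>2 / cP) \<le> 2 * \<mu> * (y \<bullet> (P *v y))"
      using \<mu> by (intro mult_left_mono) auto
    moreover have "0 \<le> (2 * \<mu> * X - cP * e)\<^sup>2 / (2 * \<mu> * cP)" using \<mu> cP_pos by simp
    moreover have "(2 * \<mu> * X - cP * e)\<^sup>2 / (2 * \<mu> * cP)
        = 2 * \<mu> * (X\<^sup>2 / cP) + cP / (2 * \<mu>) * e\<^sup>2 - 2 * (e * X)"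
    proof -
      have "(2 * \<mu> * X - C * e)\<^sup>2 / (2 * \<mu> * C)
          = 2 * \<mu> * (X\<^sup>2 / C) + C / (2 * \<mu>) * e\<^sup>2 - 2 * (e * X)"
        if "C > 0" for C
        using \<mu> that by (simp add: power2_eq_square field_simps)
      then show ?thesis using cP_pos by blast
    qed
    ultimately show ?thesis by linarith
  qed
  ultimately show ?thesis unfolding e_def by (simp add: algebra_simps)
qed

text \<open>The input on \<open>[0, t]\<close> already determines an undisturbed continuation of the plant up to \<open>t + \<tau>\<close>.
  Comparing \<open>u (s - \<tau>)\<close> with \<open>k \<bullet> y s\<close> along it covers the input up to time \<open>t\<close>.\<close>

lemma plant_continuation:
  assumes tr: "traj \<xi> b d x u z w" and t: "t \<ge> 0"
  shows "\<exists>y. (\<forall>s\<in>{0..t}. y s = x s) \<and> ac_derivative_on {0..t+\<tau>} y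
    (\<lambda>s. drift (y s) + diag (\<chi> i. g i (y s) (u s)) *v (if s
        \<le> t then d s else 0) + u (s - \<tau>) *\<^sub>R last_unit)"
proof -
  have "u absolutely_integrable_on {t - \<tau>..t}" by (rule u_integrable[OF tr]) (use t delays in auto)
  from absolutely_integrable_shift_real[OF this, of "t - \<tau>"]
  have ui: "(\<lambda>s. u (s + (t - \<tau>))) absolutely_integrable_on {0..\<tau>}" by simp
  obtain \<phi> where \<phi>: "nominal_solution f \<tau> (\<lambda>s. u (s + (t - \<tau>))) (x t) \<phi>"
    using nominal_solution_exists[OF delays(2) ui] by blast
  have \<phi>0: "\<phi> 0 = x t" using \<phi> unfolding nominal_solution_def by simp
  have ac\<phi>: "ac_derivative_on {0..\<tau>} \<phi> (\<lambda>s. drift (\<phi> s) + u (s + (t - \<tau>)) *\<^sub>R last_unit)"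
    using \<phi> unfolding nominal_solution_def drift_def by simp
  define y where "y s = (if s \<le> t then x s else \<phi> (s - t))" for s
  define h where "h s = drift (y s) + diag (\<chi> i. g i (y s) (u s)) *v (if s
      \<le> t then d s else 0) + u (s - \<tau>) *\<^sub>R last_unit" for s
  have y1: "ac_derivative_on {0..t} y h"
    by (rule ac_derivative_on_cong[OF ac_derivative_on_subset[OF plant_ac[OF tr]]])
        (auto simp: y_def h_def)
  have yt: "y s = \<phi> (s - t)" if "s \<in> {t..t+\<tau>}" for s
    unfolding y_def using that \<phi>0 by (cases "s = t") auto
  have "ac_derivative_on {t..t+\<tau>} (\<lambda>s. \<phi> (s - t)) (\<lambda>s. drift (\<phi> (s - t)) + u (s - \<tau>) *\<^sub>R last_unit)"
    using ac_derivative_on_shift_Icc[OF ac\<phi>, of "-t"] by (simp add: add.commute)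
  then have "ac_derivative_on {t..t+\<tau>} y (\<lambda>s. drift (\<phi> (s - t)) + u (s - \<tau>) *\<^sub>R last_unit)"
    by (rule ac_derivative_on_cong) (use yt in auto)
  then have y2: "ac_derivative_on {t..t+\<tau>} y h"
    \<comment> \<open>At the junction the combined formula still contains \<open>d t\<close>, a
      discrepancy at one point.\<close>
    by (rule ac_derivative_on_spike[of _ _ _ "{t}"]) (auto simp: h_def yt)
  have "ac_derivative_on {0..t+\<tau>} y h" by (rule ac_derivative_on_combine[OF y1 y2])
  then show ?thesis unfolding h_def by (intro exI[of _ y]) (auto simp: y_def)
qed

text \<open>The input acting at time \<open>s\<close> was computed at a hold instant
  \<open>c\<close> as a prediction of the state at \<open>c + \<tau>\<close>, starting from
  \<open>z c\<close>, an estimate of the state at \<open>c - r\<close>. The control error thus has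
  three sources: the observer error, the inaccuracy of the predictor, and the motion of the state
  from \<open>c + \<tau>\<close> to \<open>s\<close>, a time shorter than \<open>T2\<close>.\<close>

lemma control_bound:
  assumes \<sigma>: "0 < \<sigma>" "\<sigma> < decay" and observer_gain: "observer_gain \<sigma> < 1" and \<sigma>\<mu>: "\<sigma> \<le> \<mu> / 2"
      and control_gain: "control_gain \<sigma> < 1"
    and j: "real j * T2 \<ge> r + T1"
  shows "\<exists>C\<ge>0. \<forall>\<xi> b d x u z w E t. traj \<xi> b d x u z w \<longrightarrow> data_bound \<sigma> E t \<xi> d x u z w \<longrightarrow>
    real j * T2 \<le> t \<longrightarrow> (\<forall>s\<in>{0..t}. exp (\<sigma> * s) * norm (x s) \<le> C * E) \<and>
    (\<forall>s\<in>{-hor..t}. exp (\<sigma> * s) * \<bar>u s\<bar> \<le> C * E)"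
proof -
  define Tj where "Tj = real j * T2"
  \<comment> \<open>For \<open>s\<close> beyond \<open>t2\<close> the time \<open>s - \<tau>\<close>
    is past the hold instant \<open>Tj\<close>, so the last hold instant before it is at least
    \<open>Tj\<close> and hence at least \<open>r\<close>, where the observer estimate
    holds.\<close>
  define t2 where "t2 = Tj + \<tau>"
  have Tj: "Tj \<ge> 0" "r \<le> Tj" using j T1 delays unfolding Tj_def by auto
  have t2: "t2 \<ge> 0" unfolding t2_def using Tj delays by simp
  obtain C0 where tb': "transient_const Tj C0" using transient_const_exists by blast
  then have C0: "C0 \<ge> 0" unfolding transient_const_def by simp
  note tb = transient_constD[OF tb']
  obtain Ce where oe': "observer_const \<sigma> Ce"
      using observer_const_exists[OF \<sigma> observer_gain] by blast
  then have Ce: "Ce \<ge> 0" unfolding observer_const_def by simp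
  note oe = observer_constD[OF oe']
  define B0 where "B0 = (1 + (G + C0) * t2) * exp (L\<^sub>F * t2)"
  define g' where "g' = sqrt (cP / 2) / \<mu>"
  \<comment> \<open>The first summand dominates the disturbance forcing, the second the Lyapunov
    function at \<open>t2\<close>.\<close>
  define \<alpha> where "\<alpha> = sqrt (2 * \<gamma> / \<mu>) + exp (\<sigma> * t2) * (sqrt K2 * B0)"
  define \<alpha>1 where "\<alpha>1 = \<alpha> / sqrt K1 + exp (\<sigma> * t2) * B0"
  define \<eta> where "\<eta> = exp (\<sigma> * (T2 + hor))"
  \<comment> \<open>Contributions of \<open>E\<close> to one prediction: the observer error in the
    size of the starting point, the observer error and the disturbance over the horizon via
    Gronwall, and the disturbance during one hold period.\<close>
  define c3 where "c3 = \<epsilon> * Ce + (Ce + G * hor) * exp (L\<^sub>F * hor) + T2 * G"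
  define c4 where "c4 = norm k * \<eta> * ((T2 + \<epsilon>) * ((L\<^sub>F + norm k) * \<alpha>1 + exp (\<sigma> * t2) * C0) + c3)"
  define cV where "cV = c4 / (1 - control_gain \<sigma>)"
  define C1 where "C1 = \<alpha>1 + state_gain * cV"
  have B0: "B0 \<ge> 0" unfolding B0_def using G_nonneg C0 t2 by simp
  have g'0: "g' \<ge> 0" unfolding g'_def using cP_pos \<mu> by simp
  have g10: "state_gain \<ge> 0" unfolding state_gain_def using cP_pos \<mu> K1 by simp
  have \<alpha>0: "\<alpha> \<ge> 0" unfolding \<alpha>_def using B0 \<mu> \<gamma> K2 by simp
  have \<alpha>1: "\<alpha>1 \<ge> 0" unfolding \<alpha>1_def using B0 \<alpha>0 K1 by simp
  have c3: "c3 \<ge> 0" unfolding c3_def using eps_nonneg Ce G_nonneg delays T2 by simp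
  have \<eta>: "\<eta> \<ge> 0" unfolding \<eta>_def by simp
  have c4: "c4 \<ge> 0" unfolding c4_def using \<eta> T2 eps_nonneg L \<alpha>1 C0 c3 by simp
  have cV: "cV \<ge> 0" unfolding cV_def using c4 control_gain by simp
  have C1: "C1 \<ge> 0" unfolding C1_def using \<alpha>1 g10 cV by simp
  have state_gain': "state_gain = g' / sqrt K1"
    unfolding state_gain_def g'_def using K1 \<mu> by (simp add: real_sqrt_divide real_sqrt_mult)
  show ?thesis
  proof (intro exI[of _ "C1 + (exp (\<sigma> * Tj) * C0 + (norm k * C1 + cV))"] conjI allI impI)
    show "0 \<le> C1 + (exp (\<sigma> * Tj) * C0 + (norm k * C1 + cV))" using C1 cV C0 by simp
    fix \<xi> b d x u z w E t
    assume tr: "traj \<xi> b d x u z w" and dat: "data_bound \<sigma> E t \<xi> d x u z w"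
        and Tjt: "real j * T2 \<le> t"
    have E0: "E \<ge> 0" by (rule data_bound_nonneg[OF dat])
    have dat0: "data_bound 0 E t \<xi> d x u z w" by (rule data_bound_mono[OF dat]) (use \<sigma> in auto)
    have Tt: "Tj \<le> t" "t \<ge> 0" using Tjt Tj unfolding Tj_def by auto
    define Th where "Th = t + \<tau>"
    have Th: "t2 \<le> Th" unfolding Th_def t2_def using Tt by simp
    obtain y where yx: "\<And>s. s \<in> {0..t} \<Longrightarrow> y s = x s" and yac0: "ac_derivative_on {0..t+\<tau>} y
      (\<lambda>s. drift (y s) + diag (\<chi> i. g i (y s) (u s)) *v (if s
          \<le> t then d s else 0) + u (s - \<tau>) *\<^sub>R last_unit)"
      using plant_continuation[OF tr Tt(2)] by blast
    define db where "db s = (if s \<le> t then d s else 0)" for s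
    define dd where "dd s = diag (\<chi> i. g i (y s) (u s)) *v db s" for s
    have yac: "ac_derivative_on {0..Th} y (\<lambda>s. drift (y s) + dd s + u (s - \<tau>) *\<^sub>R last_unit)"
      using yac0 unfolding dd_def db_def Th_def .
    have dbE: "exp (\<sigma> * s) * norm (db s) \<le> E" "norm (db s) \<le> E" if "s \<ge> 0" for s
      using dat dat0 that E0 unfolding data_bound_def db_def by auto
    have ddb: "norm (dd s) \<le> G * norm (db s)" for s unfolding dd_def by (rule g_diag_bound)
    have ddE: "norm (dd s) \<le> G * E" if "s \<ge> 0" for s
      using order_trans[OF ddb mult_left_mono[OF dbE(2)[OF that] G_nonneg]] .
    have u_early: "\<bar>u s\<bar> \<le> C0 * E" if "-hor \<le> s" "s \<le> Tj" for s
      using tb[OF tr dat0, of s] that Tt by auto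
    have y_early: "norm (y s) \<le> B0 * E" if s: "s \<in> {0..t2}" for s
    proof -
      have "ac_derivative_on {0..t2} y (\<lambda>s. drift (y s) + dd s + u (s - \<tau>) *\<^sub>R last_unit)"
        by (rule ac_derivative_on_subset[OF yac]) (use Th in auto)
      then have "norm (y s) \<le> (norm (y 0) + (G * E + C0 * E) * (t2 - 0)) * exp (L\<^sub>F * (t2 - 0))"
      proof (rule ac_derivative_on_gronwall[OF _ Lambda_nonneg _ _ s])
        fix v assume v: "v \<in> {0..t2}"
        have "norm (u (v - \<tau>) *\<^sub>R last_unit :: 'n rvec) \<le> C0 * E"
          using u_early[of "v - \<tau>"] v delays by (simp add: t2_def)
        moreover have "norm (drift (y v) + dd v + u (v - \<tau>) *\<^sub>R last_unit)
            \<le> norm (drift (y v)) + norm (dd v) + norm (u (v - \<tau>) *\<^sub>R last_unit :: 'n rvec)"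
          by (intro norm_triangle_le add_mono) auto
        ultimately show "norm (drift (y v) + dd v + u (v - \<tau>) *\<^sub>R last_unit)
            \<le> L\<^sub>F * norm (y v) + (G * E + C0 * E)"
          using norm_drift[of "y v"] ddE[of v] v by simp
      qed (use G_nonneg C0 E0 in simp)
      also have "\<dots> \<le> (E + (G * E + C0 * E) * t2) * exp (L\<^sub>F * t2)"
        unfolding diff_zero using yx[of 0] Tt data_boundD(3)[OF dat0, of 0] delays
            by (intro mult_right_mono) auto
      also have "\<dots> = B0 * E" unfolding B0_def by algebra
      finally show ?thesis .
    qed
    define v where "v s = u (s - \<tau>) - k \<bullet> y s" for s
    have cy: "continuous_on {0..Th} y" by (rule ac_derivative_on_continuous[OF yac])
    \<comment> \<open>\<open>By\<close>, and \<open>Ct\<close> below, depend on the horizon; they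
      only provide finiteness for the increment formula and for the supremum in the small-gain
      step.\<close>
    have "bounded (y ` {0..Th})" by (intro compact_imp_bounded compact_continuous_image cy) auto
    then obtain By where By: "\<forall>s\<in>{0..Th}. norm (y s) \<le> By" unfolding bounded_iff by auto
    obtain Ct where tbt': "transient_const t Ct" using transient_const_exists by blast
    then have Ct: "Ct \<ge> 0" unfolding transient_const_def by simp
    note tbt = transient_constD[OF tbt']
    have ut: "\<bar>u (s - \<tau>)\<bar> \<le> Ct * E" if "s \<in> {0..Th}" for s
      using tbt[OF tr dat0, of "s - \<tau>"] that delays unfolding Th_def by auto
    have yb: "exp (\<sigma> * s) * norm (y s) \<le> \<alpha>1 * E + state_gain * Y"
      if Y: "\<And>s. s \<in> {t2..Th} \<Longrightarrow> exp (\<sigma> * s) * \<bar>v s\<bar> \<le> Y" and s: "s \<in> {0..Th}" for Y s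
    proof -
      have Y0: "Y \<ge> 0" by (rule order_trans[OF _ Y[of t2]]) (use Th in auto)
      show ?thesis
      proof (cases "s \<le> t2")
        case True
        have "exp (\<sigma> * s) * norm (y s) \<le> exp (\<sigma> * t2) * (B0 * E)"
          using True s \<sigma> y_early[of s] by (intro mult_mono) auto
        moreover have "0 \<le> \<alpha> / sqrt K1 * E" "0 \<le> state_gain * Y" using \<alpha>0 K1 E0 g10 Y0 by auto
        ultimately show ?thesis unfolding \<alpha>1_def by (simp add: distrib_right)
      next
        case False
        define W where "W s = y s \<bullet> (P *v y s)" for s
        define M where "M = (\<alpha> * E + g' * Y)\<^sup>2"
        have M: "(\<alpha> * E)\<^sup>2 + (g' * Y)\<^sup>2 \<le> M"
        proof -
          have "A\<^sup>2 + B\<^sup>2 \<le> (A + B)\<^sup>2" if "0 \<le> A" "0 \<le> B" for A B :: real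
            using that by (simp add: power2_sum)
          then show ?thesis unfolding M_def using \<alpha>0 E0 g'0 Y0 by simp
        qed
        have "W s \<le> exp (- 2 * \<sigma> * s) * M"
        proof (rule exponential_comparison[where a = t2 and b = Th and \<kappa> = \<mu>
              and B = "2 * \<gamma> * E\<^sup>2 + cP / (2 * \<mu>) * Y\<^sup>2"
              and v = "\<lambda>s. 2 * ((drift (y s) + dd s + u (s - \<tau>) *\<^sub>R last_unit) \<bullet> (P *v y s))"])
          have c2: "continuous_on {t2..Th} y" by (rule continuous_on_subset[OF cy]) (use t2 in auto)
          show "continuous_on {t2..Th} W"
            unfolding W_def
            by (intro continuous_on_inner c2 linear_continuous_on_compose[OF c2])
              (simp add: matrix_vector_mul_linear)
          show "W t2 \<le> exp (- 2 * \<sigma> * t2) * M"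
          proof -
            have "W t2 \<le> K2 * (norm (y t2))\<^sup>2" unfolding W_def by (rule K2(2))
            also have "\<dots> \<le> K2 * (B0 * E)\<^sup>2"
              using K2(1) y_early[of t2] t2 by (intro mult_left_mono power_mono) auto
            also have "\<dots> = (sqrt K2 * B0 * E)\<^sup>2" using K2(1) by (simp add: power_mult_distrib)
            finally have "exp (2 * \<sigma> * t2) * W t2 \<le> exp (2 * \<sigma> * t2) * (sqrt K2 * B0 * E)\<^sup>2"
              by (rule mult_left_mono) simp
            also have "\<dots> = (exp (\<sigma> * t2) * (sqrt K2 * B0) * E)\<^sup>2"
              by (simp add: power_mult_distrib exp_double[symmetric] mult.assoc)
            also have "\<dots> \<le> (\<alpha> * E)\<^sup>2"
              unfolding \<alpha>_def using B0 K2 E0 \<mu> \<gamma> by (intro power_mono mult_right_mono) auto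
            also have "\<dots> \<le> M" using M zero_le_power2[of "g' * Y"] by linarith
            finally show ?thesis using exp_mult_imp_le[of "2 * \<sigma>" t2 "W t2" M] by simp
          qed
          show "(\<lambda>s. 2 * ((drift (y s) + dd s
              + u (s - \<tau>) *\<^sub>R last_unit) \<bullet> (P *v y s))) integrable_on {s..s'} \<and>
              W s' - W s = integral {s..s'} (\<lambda>s. 2 * ((drift (y s) + dd s
                  + u (s - \<tau>) *\<^sub>R last_unit) \<bullet> (P *v y s)))"
            if "t2 \<le> s" "s \<le> s'" "s' \<le> Th" for s s'
          proof -
            have sym: "transpose P = P" using P unfolding sym_pos_def_def by simp
            have ac: "ac_derivative_on {s..s'} y (\<lambda>s. drift (y s) + dd s + u (s - \<tau>) *\<^sub>R last_unit)"
              by (rule ac_derivative_on_subset[OF yac]) (use that t2 in auto)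
            have hb: "norm (drift (y c) + dd c + u (c - \<tau>) *\<^sub>R last_unit)
                \<le> L\<^sub>F * By + G * E + Ct * E"
              if "c \<in> {s..s'}" for c
            proof -
              have c: "c \<in> {0..Th}" using that \<open>t2 \<le> s\<close> \<open>s' \<le> Th\<close> t2 by auto
              have "norm (drift (y c)) \<le> L\<^sub>F * By"
                using norm_drift[of "y c"] mult_left_mono[OF _ Lambda_nonneg, of
                    "norm (y c)" By] By c by force
              moreover have "norm (u (c - \<tau>) *\<^sub>R last_unit :: 'n rvec) \<le> Ct * E"
                  using ut[OF c] by simp
              ultimately show ?thesis
                using ddE[of c] c by (intro norm_triangle_le add_mono) auto
            qed
            show ?thesis unfolding W_def
              using quadratic_form_increment[OF ac that(2) hb matrix_vector_mul_bounded_linear[of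
                  P] symmetric_form[OF sym]]
              by auto
          qed
          show "2 * ((drift (y c) + dd c + u (c - \<tau>) *\<^sub>R last_unit) \<bullet> (P *v y c))
              \<le> - 2 * \<mu> * W c + exp (- 2 * \<sigma> * c) * (2 * \<gamma> * E\<^sup>2 + cP / (2 * \<mu>) * Y\<^sup>2)"
            if c: "c \<in> {t2..Th}" for c
          proof -
            have sq: "A\<^sup>2 \<le> exp (- 2 * \<sigma> * c) * B\<^sup>2" if "0 \<le> A" "exp (\<sigma> * c) * A \<le> B" for A B
            proof -
              have "A\<^sup>2 \<le> (exp (- \<sigma> * c) * B)\<^sup>2"
                by (rule power_mono[OF exp_mult_imp_le[OF that(2)] that(1)])
              then show ?thesis by (simp add: power_mult_distrib exp_double[symmetric] mult.assoc)
            qed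
            have "2 * \<gamma> * (norm (db c))\<^sup>2 \<le> 2 * \<gamma> * (exp (- 2 * \<sigma> * c) * E\<^sup>2)"
              using dbE(1)[of c] c t2 \<gamma> by (intro mult_left_mono sq) auto
            moreover have "cP / (2 * \<mu>) * (u (c - \<tau>) - k \<bullet> y c)\<^sup>2
                \<le> cP / (2 * \<mu>) * (exp (- 2 * \<sigma> * c) * Y\<^sup>2)"
            proof (rule mult_left_mono)
              show "(u (c - \<tau>) - k \<bullet> y c)\<^sup>2 \<le> exp (- 2 * \<sigma> * c) * Y\<^sup>2"
                using sq[of "\<bar>v c\<bar>" Y] Y[OF c] unfolding v_def by simp
            qed (use cP_pos \<mu> in simp)
            ultimately show ?thesis
              using plant_rate[of "y c" "u c" "db c" "u (c - \<tau>)"]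
              unfolding W_def dd_def by (simp add: algebra_simps)
          qed
          show "2 * \<gamma> * E\<^sup>2 + cP / (2 * \<mu>) * Y\<^sup>2 \<le> 2 * (\<mu> - \<sigma>) * M"
          proof -
            have "sqrt (2 * \<gamma> / \<mu>) \<le> \<alpha>" unfolding \<alpha>_def using B0 K2 by simp
            then have "(sqrt (2 * \<gamma> / \<mu>))\<^sup>2 \<le> \<alpha>\<^sup>2" using \<gamma> \<mu> by (intro power_mono) auto
            then have "2 * \<gamma> / \<mu> \<le> \<alpha>\<^sup>2" using \<gamma> \<mu> by simp
            then have "2 * \<gamma> \<le> \<mu> * \<alpha>\<^sup>2" using \<mu> by (simp add: pos_divide_le_eq mult.commute)
            then have "2 * \<gamma> * E\<^sup>2 \<le> \<mu> * \<alpha>\<^sup>2 * E\<^sup>2" by (rule mult_right_mono) simp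
            moreover have "cP / (2 * \<mu>) * Y\<^sup>2 = \<mu> * (g' * Y)\<^sup>2"
              unfolding g'_def using cP_pos \<mu> by (simp add: power_mult_distrib power_divide
                  power2_eq_square field_simps)
            ultimately have "2 * \<gamma> * E\<^sup>2 + cP / (2 * \<mu>) * Y\<^sup>2 \<le> \<mu> * ((\<alpha> * E)\<^sup>2 + (g' * Y)\<^sup>2)"
              by (simp add: power_mult_distrib distrib_left mult.assoc)
            also have "\<dots> \<le> \<mu> * M" using M \<mu> by (intro mult_left_mono) auto
            also have "\<dots> \<le> 2 * (\<mu> - \<sigma>) * M"
              using \<sigma>\<mu> by (intro mult_right_mono) (auto simp: M_def)
            finally show ?thesis .
          qed
          show "s \<in> {t2..Th}" using False s by auto
          show "0 \<le> \<mu>" using \<mu> by simp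
        qed
        then have "exp (2 * \<sigma> * s) * W s \<le> exp (2 * \<sigma> * s) * (exp (- 2 * \<sigma> * s) * M)"
          by (intro mult_left_mono) auto
        also have "\<dots> = M" by (simp add: exp_minus)
        finally have W: "exp (2 * \<sigma> * s) * W s \<le> M" .
        have "(sqrt K1 * (exp (\<sigma> * s) * norm (y s)))\<^sup>2 = exp (2 * \<sigma> * s) * (K1 * (norm (y s))\<^sup>2)"
          using K1(1) by (simp add: power_mult_distrib exp_double[symmetric] mult.assoc)
        also have "\<dots> \<le> exp (2 * \<sigma> * s) * W s" unfolding W_def by (intro mult_left_mono K1(2)) simp
        finally have "(sqrt K1 * (exp (\<sigma> * s) * norm (y s)))\<^sup>2 \<le> (\<alpha> * E + g' * Y)\<^sup>2"
          using W unfolding M_def by linarith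
        then have "sqrt K1 * (exp (\<sigma> * s) * norm (y s)) \<le> \<alpha> * E + g' * Y"
          by (rule power2_le_imp_le) (use \<alpha>0 E0 g'0 Y0 in simp)
        then have "exp (\<sigma> * s) * norm (y s) \<le> (\<alpha> * E + g' * Y) / sqrt K1"
          using K1(1) by (simp add: pos_le_divide_eq mult.commute)
        also have "\<dots> = \<alpha> / sqrt K1 * E + state_gain * Y" unfolding state_gain'
            by (simp add: add_divide_distrib)
        also have "\<dots> \<le> \<alpha>1 * E + state_gain * Y"
          unfolding \<alpha>1_def using B0 E0 by (intro add_right_mono mult_right_mono) auto
        finally show ?thesis .
      qed
    qed
    have ub: "exp (\<sigma> * s) * \<bar>u (s - \<tau>)\<bar>
        \<le> exp (\<sigma> * t2) * C0 * E + norm k * (\<alpha>1 * E + state_gain * Y) + Y"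
      if Y: "\<And>s. s \<in> {t2..Th} \<Longrightarrow> exp (\<sigma> * s) * \<bar>v s\<bar> \<le> Y" and s: "s \<in> {0..Th}" for Y s
    proof -
      have Y0: "Y \<ge> 0" by (rule order_trans[OF _ Y[of t2]]) (use Th in auto)
      show ?thesis
      proof (cases "s < t2")
        case True
        have "exp (\<sigma> * s) * \<bar>u (s - \<tau>)\<bar> \<le> exp (\<sigma> * t2) * (C0 * E)"
          using True s \<sigma> u_early[of "s - \<tau>"] delays unfolding t2_def by (intro mult_mono) auto
        moreover have "0 \<le> norm k * (\<alpha>1 * E + state_gain * Y)" using \<alpha>1 E0 g10 Y0 by simp
        ultimately show ?thesis using Y0 by (simp add: mult.assoc)
      next
        case False
        have "\<bar>u (s - \<tau>)\<bar> \<le> norm k * norm (y s) + \<bar>v s\<bar>"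
          using Cauchy_Schwarz_ineq2[of k "y s"] unfolding v_def by linarith
        then have "exp (\<sigma> * s) * \<bar>u (s - \<tau>)\<bar> \<le> exp (\<sigma> * s) * (norm k * norm (y s) + \<bar>v s\<bar>)"
          by (rule mult_left_mono) simp
        also have "\<dots> = norm k * (exp (\<sigma> * s) * norm (y s)) + exp (\<sigma> * s) * \<bar>v s\<bar>" by algebra
        also have "\<dots> \<le> norm k * (\<alpha>1 * E + state_gain * Y) + Y"
          using yb[OF Y s] Y[of s] s False by (intro add_mono mult_left_mono) auto
        also have "\<dots> \<le> exp (\<sigma> * t2) * C0 * E + norm k * (\<alpha>1 * E + state_gain * Y) + Y"
          using C0 E0 by simp
        finally show ?thesis .
      qed
    qed
    have main: "exp (\<sigma> * s) * \<bar>v s\<bar> \<le> c4 * E + control_gain \<sigma> * Y"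
      if Y: "\<And>s. s \<in> {t2..Th} \<Longrightarrow> exp (\<sigma> * s) * \<bar>v s\<bar> \<le> Y" and s: "s \<in> {t2..Th}" for Y s
    proof -
      have Y0: "Y \<ge> 0" by (rule order_trans[OF _ Y[OF s]]) simp
      define Xb where "Xb = \<alpha>1 * E + state_gain * Y"
      define Ub where "Ub = exp (\<sigma> * t2) * C0 * E + norm k * Xb + Y"
      have Xb0: "Xb \<ge> 0" unfolding Xb_def using \<alpha>1 E0 g10 Y0 by simp
      have Ub0: "Ub \<ge> 0" unfolding Ub_def using C0 E0 Xb0 Y0 by simp
      define F where "F = exp (- \<sigma> * s) * \<eta>"
      have F0: "F \<ge> 0" unfolding F_def using \<eta> by simp
      define i where "i = hold_index (s - \<tau>)"
      define c where "c = real i * T2"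
      have s\<tau>: "s - \<tau> \<ge> Tj" using s unfolding t2_def by auto
      have c: "c \<le> s - \<tau>" "s - \<tau> < c + T2"
        using hold_index[of "s - \<tau>"] s\<tau> Tj unfolding c_def i_def by (auto simp: algebra_simps)
      have "j \<le> i"
      proof -
        have "real j * T2 < real (Suc i) * T2"
            using c s\<tau> unfolding Tj_def c_def by (simp add: algebra_simps)
        then show ?thesis using T2 by simp
      qed
      then have cT: "Tj \<le> c" unfolding c_def Tj_def using T2 by (intro mult_right_mono) auto
      have ct: "c \<le> t" "r \<le> c" using c s cT Tj unfolding Th_def by auto
      \<comment> \<open>The computation looks back by \<open>r\<close> from \<open>c\<close>, and
        \<open>c\<close> precedes \<open>s\<close> by less than \<open>T2 + \<tau>\<close>; this
        gives the exponent in \<open>\<eta>\<close>.\<close>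
      have win: "s - (T2 + hor) \<le> c'" if "c - r \<le> c'" for c' using that c by auto
      have Xv: "norm (y c') \<le> F * Xb" if "c' \<in> {c - r..s}" for c'
      proof -
        have "norm (y c') \<le> exp (- \<sigma> * s) * (exp (\<sigma> * (T2 + hor)) * Xb)"
          by (rule exp_window[OF _ win]) (use yb[OF Y, of c'] that ct s \<sigma> Xb0 in \<open>auto simp:
              Xb_def\<close>)
        then show ?thesis unfolding F_def \<eta>_def by (simp only: mult.assoc)
      qed
      have Uv: "\<bar>u (c' - \<tau>)\<bar> \<le> F * Ub" if "c' \<in> {c - r..s}" for c'
      proof -
        have "\<bar>u (c' - \<tau>)\<bar> \<le> exp (- \<sigma> * s) * (exp (\<sigma> * (T2 + hor)) * Ub)"
          by (rule exp_window[OF _ win]) (use ub[OF Y, of c'] that ct s \<sigma> Ub0 in \<open>auto simp: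
              Ub_def Xb_def\<close>)
        then show ?thesis unfolding F_def \<eta>_def by (simp only: mult.assoc)
      qed
      have Dv: "norm (dd c') \<le> F * (G * E)" if "c' \<in> {c - r..s}" for c'
      proof -
        have "norm (db c') \<le> exp (- \<sigma> * s) * (exp (\<sigma> * (T2 + hor)) * E)"
          by (rule exp_window[OF dbE(1) win]) (use that ct \<sigma> E0 in auto)
        then have "G * norm (db c') \<le> G * (F * E)"
          unfolding F_def \<eta>_def by (intro mult_left_mono G_nonneg) (simp only: mult.assoc)
        then show ?thesis using ddb[of c'] by (simp add: mult_ac)
      qed
      have ec: "norm (z c - y (c - r)) \<le> F * (Ce * E)"
      proof -
        have "exp (\<sigma> * c) * norm (z c - x (c - r)) \<le> Ce * E"
          using oe[OF tr dat] ct by auto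
        then have "norm (z c - x (c - r)) \<le> exp (- \<sigma> * s) * (exp (\<sigma> * (T2 + hor)) * (Ce * E))"
          by (rule exp_window) (use c delays \<sigma> Ce E0 in auto)
        then show ?thesis using yx[of "c - r"] ct delays unfolding F_def \<eta>_def
            by (simp add: mult.assoc)
      qed
      have zc: "norm (z c) \<le> F * Xb + F * (Ce * E)"
        using norm_triangle_ineq[of "y (c - r)" "z c - y (c - r)"] ec Xv[of "c - r"] c delays
            by auto
      \<comment> \<open>The predictor is compared with \<open>y\<close> on
        \<open>{c - r..c + \<tau>}\<close>. The stored inputs on the window before \<open>c\<close>
        are exactly those that drive \<open>y\<close> there.\<close>
      have ph: "norm (Phi_pred f l m hor (z c) (shift c u) - y (c - r + hor))
        \<le> \<epsilon> * ((F * Xb + F * (Ce * E)) + F * Ub) + (F * (Ce * E)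
            + F * (G * E) * hor) * exp (L\<^sub>F * hor)"
      proof -
        have acs: "ac_derivative_on {c - r..c + \<tau>} y (\<lambda>s. drift (y s) + dd s
            + u (s - \<tau>) *\<^sub>R last_unit)"
          by (rule ac_derivative_on_subset[OF yac]) (use ct c s in auto)
        have su: "shift c u (t' - hor) = u (t' + (c - r) - \<tau>)" for t' unfolding shift_def
            by (simp add: algebra_simps)
        have ac': "ac_derivative_on {0..hor} (\<lambda>t'. y (t' + (c - r)))
            (\<lambda>t'. drift (y (t' + (c - r))) + shift c u (t' - hor) *\<^sub>R last_unit + dd (t'
                + (c - r)))"
          using ac_derivative_on_shift_Icc[OF acs, of "c - r"] unfolding su by (simp add: add_ac)
        have "u absolutely_integrable_on {c - hor..c}"
            by (rule u_integrable[OF tr]) (use Tj cT in auto)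
        from absolutely_integrable_shift_real[OF this, of c]
        have ui: "shift c u absolutely_integrable_on {-hor..0}" unfolding shift_def
            by (simp add: add.commute)
        have "norm (Phi_pred f l m hor (z c) (shift c u) - y (hor + (c - r)))
          \<le> K * ((L\<^sub>F * (hor / real m)) ^ (l + 1) / (1 - L\<^sub>F * (hor / real m))) * (norm (z c)
              + F * Ub)
            + (norm (z c - y (0 + (c - r))) + F * (G * E) * hor) * exp (L\<^sub>F * hor)"
        proof (rule Phi_pred_error[OF K delays(3) l contraction ui _ ac'])
          show "\<bar>shift c u s'\<bar> \<le> F * Ub" if "s' \<in> {-hor..<0}" for s'
            using Uv[of "c + s' + \<tau>"] that c delays unfolding shift_def by auto
          show "norm (dd (t' + (c - r))) \<le> F * (G * E)" if "t' \<in> {0..<hor}" for t'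
            by (rule Dv) (use that c in auto)
        qed
        also have "\<dots> \<le> \<epsilon> * ((F * Xb + F * (Ce * E)) + F * Ub) + (F * (Ce * E)
            + F * (G * E) * hor) * exp (L\<^sub>F * hor)"
          unfolding \<epsilon>_def[symmetric] add_0 using zc ec eps_nonneg
          by (intro order_refl add_mono mult_left_mono mult_right_mono) auto
        finally show ?thesis by (simp add: add.commute)
      qed
      have inc: "norm (y s - y (c + \<tau>)) \<le> (L\<^sub>F * (F * Xb) + F * (G * E) + F * Ub) * T2"
      proof -
        have "norm (y s - y (c + \<tau>)) \<le> (L\<^sub>F * (F * Xb) + F * (G * E) + F * Ub) * (s - (c + \<tau>))"
        proof (rule ac_derivative_on_increment_bound[OF yac])
          fix c' assume "c' \<in> {c + \<tau>..s}"
          then have c': "c' \<in> {c - r..s}" using delays by auto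
          have "norm (drift (y c')) \<le> L\<^sub>F * (F * Xb)"
            using norm_drift[of "y c'"] mult_left_mono[OF Xv[OF c'] Lambda_nonneg] by linarith
          moreover have "norm (u (c' - \<tau>) *\<^sub>R last_unit :: 'n rvec) \<le> F * Ub"
              using Uv[OF c'] by simp
          ultimately show "norm (drift (y c') + dd c' + u (c' - \<tau>) *\<^sub>R last_unit)
              \<le> L\<^sub>F * (F * Xb) + F * (G * E) + F * Ub"
            using Dv[OF c'] by (intro norm_triangle_le add_mono) auto
        qed (use c ct s Tj cT delays in auto)
        also have "\<dots> \<le> (L\<^sub>F * (F * Xb) + F * (G * E) + F * Ub) * T2"
          using c F0 Xb0 Ub0 G_nonneg E0 L by (intro mult_left_mono) auto
        finally show ?thesis .
      qed
      have "u (s - \<tau>) = k \<bullet> Phi_pred f l m hor (z c) (shift c u)"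
        unfolding c_def by (rule u_held[OF tr]) (use c in \<open>auto simp: c_def algebra_simps\<close>)
      then have "v s = k \<bullet> ((Phi_pred f l m hor (z c) (shift c u) - y (c - r + hor)) - (y s - y (c
          + \<tau>)))"
        unfolding v_def by (simp add: inner_diff_right)
      then have "\<bar>v s\<bar> \<le> norm k * norm ((Phi_pred f l m hor (z c) (shift c u) - y (c - r
          + hor)) - (y s - y (c + \<tau>)))"
        using Cauchy_Schwarz_ineq2 by metis
      also have "\<dots> \<le> norm k * ((\<epsilon> * ((F * Xb + F * (Ce * E)) + F * Ub) + (F * (Ce * E)
          + F * (G * E) * hor) * exp (L\<^sub>F * hor))
          + (L\<^sub>F * (F * Xb) + F * (G * E) + F * Ub) * T2)"
        by (intro mult_left_mono order_trans[OF norm_triangle_ineq4] add_mono ph inc) simp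
      also have "\<dots> = exp (- \<sigma> * s) * (norm k * \<eta> * (\<epsilon> * (Xb + Ub) + T2 * (L\<^sub>F * Xb + Ub) + c3 * E))"
        unfolding F_def c3_def by algebra
      finally have "\<bar>v s\<bar> \<le> exp (- \<sigma> * s) * (norm k * \<eta> * (\<epsilon> * (Xb + Ub) + T2 * (L\<^sub>F * Xb + Ub)
          + c3 * E))" .
      then have "exp (\<sigma> * s) * \<bar>v s\<bar> \<le> exp (\<sigma> * s) * (exp (- \<sigma> * s) * (norm k * \<eta> * (\<epsilon> * (Xb + Ub)
          + T2 * (L\<^sub>F * Xb + Ub) + c3 * E)))"
        by (rule mult_left_mono) simp
      also have "\<dots> = norm k * \<eta> * (\<epsilon> * (Xb + Ub) + T2 * (L\<^sub>F * Xb + Ub) + c3 * E)"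
          by (simp add: exp_minus)
      \<comment> \<open>Enlarging \<open>Xb\<close> to \<open>L\<^sub>F * Xb\<close> in the
        prediction term gives both terms a common factor, so that \<open>T2\<close> and
        \<open>\<epsilon>\<close> appear only through their sum.\<close>
      also have "\<dots> \<le> norm k * \<eta> * (\<epsilon> * (L\<^sub>F * Xb + Ub) + T2 * (L\<^sub>F * Xb + Ub) + c3 * E)"
      proof -
        have "Xb \<le> L\<^sub>F * Xb" using mult_right_mono[OF Lambda_ge_1 Xb0] by simp
        then show ?thesis using eps_nonneg \<eta> by (intro mult_left_mono add_right_mono) auto
      qed
      also have "\<dots> = c4 * E + control_gain \<sigma> * Y"
        unfolding c4_def control_gain_def \<eta>_def[symmetric] Ub_def Xb_def by algebra
      finally show ?thesis .
    qed
    have bdd: "bdd_above ((\<lambda>s. exp (\<sigma> * s) * \<bar>v s\<bar>) ` {t2..Th})"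
    proof (rule bdd_aboveI2)
      fix s assume s: "s \<in> {t2..Th}"
      have "\<bar>v s\<bar> \<le> Ct * E + norm k * By"
      proof -
        have s0: "s \<in> {0..Th}" using s t2 by auto
        have "\<bar>k \<bullet> y s\<bar> \<le> norm k * norm (y s)" by (rule Cauchy_Schwarz_ineq2)
        also have "\<dots> \<le> norm k * By" using By s0 by (intro mult_left_mono) auto
        finally show ?thesis using ut[OF s0] unfolding v_def by linarith
      qed
      then show "exp (\<sigma> * s) * \<bar>v s\<bar> \<le> exp (\<sigma> * Th) * (Ct * E + norm k * By)"
        using s \<sigma> by (intro mult_mono) auto
    qed
    have vB: "exp (\<sigma> * s) * \<bar>v s\<bar> \<le> cV * E" if "s \<in> {t2..Th}" for s
      using small_gain[of "\<lambda>s. exp (\<sigma> * s) * \<bar>v s\<bar>", OF bdd control_gain main that] unfolding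
          cV_def by simp
    have yB: "exp (\<sigma> * s) * norm (y s) \<le> C1 * E" if "s \<in> {0..Th}" for s
      using yb[OF vB that] unfolding C1_def by (simp add: distrib_right mult.assoc)
    show "\<forall>s\<in>{0..t}. exp (\<sigma> * s) * norm (x s) \<le> (C1 + (exp (\<sigma> * Tj) * C0 + (norm k * C1 + cV))) * E"
    proof
      fix s assume s: "s \<in> {0..t}"
      have "exp (\<sigma> * s) * norm (x s) \<le> C1 * E"
        using yB[of s] yx[OF s] s delays unfolding Th_def by simp
      also have "\<dots> \<le> (C1 + (exp (\<sigma> * Tj) * C0 + (norm k * C1 + cV))) * E"
        using C0 C1 cV E0 by (intro mult_right_mono) auto
      finally show "exp (\<sigma> * s) * norm (x s)
          \<le> (C1 + (exp (\<sigma> * Tj) * C0 + (norm k * C1 + cV))) * E" .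
    qed
    show "\<forall>s\<in>{-hor..t}. exp (\<sigma> * s) * \<bar>u s\<bar> \<le> (C1 + (exp (\<sigma> * Tj) * C0 + (norm k * C1 + cV))) * E"
    proof
      fix s assume s: "s \<in> {-hor..t}"
      have "exp (\<sigma> * s) * \<bar>u s\<bar> \<le> (exp (\<sigma> * Tj) * C0 + (norm k * C1 + cV)) * E"
      proof (cases "s \<le> Tj")
        case True
        have "exp (\<sigma> * s) * \<bar>u s\<bar> \<le> exp (\<sigma> * Tj) * (C0 * E)"
          using True s \<sigma> u_early[of s] by (intro mult_mono) auto
        moreover have "0 \<le> (norm k * C1 + cV) * E" using C1 cV E0 by simp
        ultimately show ?thesis by (simp add: distrib_right mult.assoc)
      next
        case False
        \<comment> \<open>The input at \<open>s\<close> enters the control error at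
          \<open>s + \<tau>\<close>, possibly later than \<open>t\<close>; here the continuation of
          the plant beyond \<open>t\<close> is needed.\<close>
        define s' where "s' = s + \<tau>"
        have s': "s' \<in> {t2..Th}" "s' \<in> {0..Th}" "s' - \<tau> = s" "s \<le> s'"
          unfolding s'_def t2_def Th_def using False s delays Tj by auto
        have "\<bar>u s\<bar> \<le> norm k * norm (y s') + \<bar>v s'\<bar>"
          using Cauchy_Schwarz_ineq2[of k "y s'"] s'(3) unfolding v_def by simp
        then have "exp (\<sigma> * s) * \<bar>u s\<bar> \<le> exp (\<sigma> * s') * (norm k * norm (y s') + \<bar>v s'\<bar>)"
          using s' \<sigma> by (intro mult_mono) auto
        also have "\<dots> = norm k * (exp (\<sigma> * s') * norm (y s')) + exp (\<sigma> * s') * \<bar>v s'\<bar>" by algebra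
        also have "\<dots> \<le> norm k * (C1 * E) + cV * E"
          using yB[OF s'(2)] vB[OF s'(1)] by (intro add_mono mult_left_mono) auto
        also have "\<dots> \<le> (exp (\<sigma> * Tj) * C0 + (norm k * C1 + cV)) * E"
          using C0 E0 by (simp add: distrib_right)
        finally show ?thesis .
      qed
      also have "\<dots> \<le> (C1 + (exp (\<sigma> * Tj) * C0 + (norm k * C1 + cV))) * E"
        using C1 E0 by (intro mult_right_mono) auto
      finally show "exp (\<sigma> * s) * \<bar>u s\<bar> \<le> (C1 + (exp (\<sigma> * Tj) * C0 + (norm k * C1 + cV))) * E" .
    qed
  qed
qed

end

section \<open>Closing the estimate\<close>

context stable_loop
begin

lemma observer_gain_0: "observer_gain 0 < 1"
proof -
  have D: "sqrt (q * \<theta> * (decay - 0)) = q * \<theta> / (2 * sqrt nQ)"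
  proof -
    have "q * \<theta> * (decay - 0) = (q * \<theta>)\<^sup>2 / (4 * nQ)"
      unfolding decay_def by (simp add: power2_eq_square)
    also have "sqrt \<dots> = q * \<theta> / (2 * sqrt nQ)"
      using q \<theta>0 by (simp add: real_sqrt_divide real_sqrt_mult)
    finally show ?thesis .
  qed
  have "observer_gain 0 = norm (Q *v p) * (T1 * \<theta> * (L + \<theta>) / sqrt a) / (q * \<theta> / (2 * sqrt nQ))"
    unfolding observer_gain_def D by (simp only: mult_zero_left exp_zero mult_1_right)
  also have "\<dots> = 2 * norm (Q *v p) * (L + \<theta>) * T1 * (sqrt nQ / sqrt a) / q"
  proof -
    have "N * (T1 * \<theta> * X / c) / (q * \<theta> / (2 * e)) = 2 * N * X * T1 * (e / c) / q"
      if "e > 0" "c > 0" for N X c e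
      using q \<theta>0 that by (simp add: field_simps)
    then show ?thesis using nQ_pos a by (meson real_sqrt_gt_zero)
  qed
  also have "\<dots> = 4 * norm (Q *v p) * (L + \<theta>) * T1 * sqrt (nQ / a) / q / 2"
  proof -
    have "2 * A * B * D * e / q = 4 * A * B * D * e / q / 2" for A B D e :: real by simp
    then show ?thesis unfolding real_sqrt_divide .
  qed
  also have "\<dots> < 1"
  proof -
    have "X / q / 2 < 1" if "X < q" for X using that q by (simp add: divide_less_eq)
    then show ?thesis using T1_small by blast
  qed
  finally show ?thesis .
qed

lemma control_gain_0: "control_gain 0 < 1"
proof -
  have "control_gain 0 = ((L\<^sub>F + norm k) * sqrt (cP / (2 * K1)) + \<mu>) * norm k * (T2 + \<epsilon>) / \<mu>"
    unfolding control_gain_def state_gain_def using \<mu> by (simp add: field_simps)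
  also have "\<dots> < 1" using T2_small \<mu> by (simp add: divide_less_eq)
  finally show ?thesis .
qed

lemma decay_rate_exists:
  "\<exists>\<sigma>>0. \<sigma> < decay \<and> observer_gain \<sigma> < 1 \<and> \<sigma> \<le> \<mu> / 2 \<and> control_gain \<sigma> < 1"
proof -
  have "isCont observer_gain 0"
    unfolding observer_gain_def using q \<theta>0 decay_pos a by (intro continuous_intros) auto
  then have "(observer_gain \<longlongrightarrow> observer_gain 0) (at_right 0)" 
    unfolding isCont_def by (rule tendsto_within_subset) simp
  then have 1: "eventually (\<lambda>\<sigma>. observer_gain \<sigma> < 1) (at_right 0)"
      by (rule order_tendstoD(2)[OF _ observer_gain_0])
  have "isCont control_gain 0" unfolding control_gain_def by (intro continuous_intros)
  then have "(control_gain \<longlongrightarrow> control_gain 0) (at_right 0)" 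
    unfolding isCont_def by (rule tendsto_within_subset) simp
  then have 2: "eventually (\<lambda>\<sigma>. control_gain \<sigma> < 1) (at_right 0)"
      by (rule order_tendstoD(2)[OF _ control_gain_0])
  have 3: "eventually (\<lambda>\<sigma>. \<sigma> \<in> {0<..<min decay (\<mu> / 2)}) (at_right 0)"
    by (rule eventually_at_right_real) (use decay_pos \<mu> in simp)
  have "eventually (\<lambda>\<sigma>. \<sigma> > 0 \<and> \<sigma> < decay \<and> observer_gain \<sigma> < 1 \<and> \<sigma> \<le> \<mu> / 2 \<and>
      control_gain \<sigma> < 1) (at_right 0)"
    using 1 2 3 by eventually_elim auto
  then show ?thesis using eventually_happens'[OF trivial_limit_at_right_real] by blast
qed

text \<open>Up to \<open>Tj\<close> the transient bound suffices, at the cost of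
  \<open>exp (\<sigma> * Tj)\<close>. Later the observer estimate reduces \<open>z t\<close> and
  \<open>w t\<close> to the delayed state, so the factor 4 counts the two suprema and two
  occurrences of \<open>x (t - r)\<close>, and the factor 2 the two observer errors.\<close>

lemma exponential_bound:
  assumes j: "real j * T2 \<ge> r + T1"
  shows "\<exists>\<sigma>>0. \<exists>C>0. \<forall>\<xi> b d x u z w E t. traj \<xi> b d x u z w \<longrightarrow> data_bound \<sigma> E t \<xi> d x u z w \<longrightarrow> 0 \<le> t \<longrightarrow>
    norm (z t) + \<bar>w t\<bar> + sup_on {t-r..t} x + sup_on {t-hor..<t} u \<le> exp (- \<sigma> * t) * (C * E)"
proof -
  define Tj where "Tj = real j * T2"
  obtain \<sigma> where \<sigma>: "0 < \<sigma>" "\<sigma> < decay" and state_gain: "observer_gain \<sigma> < 1" and \<sigma>\<mu>: "\<sigma> \<le> \<mu> / 2"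
      and g2: "control_gain \<sigma> < 1"
    using decay_rate_exists by blast
  obtain C0 where tb': "transient_const Tj C0" using transient_const_exists by blast
  then have C0: "C0 \<ge> 0" unfolding transient_const_def by simp
  note tb = transient_constD[OF tb']
  obtain Ce where oe': "observer_const \<sigma> Ce" using observer_const_exists[OF \<sigma> state_gain] by blast
  then have Ce: "Ce \<ge> 0" unfolding observer_const_def by simp
  note oe = observer_constD[OF oe']
  obtain C1 where C1: "C1 \<ge> 0" and cb: "\<forall>\<xi> b d x u z w E t. traj \<xi> b d x u z w \<longrightarrow>
      data_bound \<sigma> E t \<xi> d x u z w \<longrightarrow>
    real j * T2 \<le> t \<longrightarrow> (\<forall>s\<in>{0..t}. exp (\<sigma> * s) * norm (x s) \<le> C1 * E) \<and>
    (\<forall>s\<in>{-hor..t}. exp (\<sigma> * s) * \<bar>u s\<bar> \<le> C1 * E)"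
    using control_bound[OF \<sigma> state_gain \<sigma>\<mu> g2 j] by (elim exE conjE) (rule that)
  define \<eta> where "\<eta> = exp (\<sigma> * hor)"
  define C where "C = exp (\<sigma> * Tj) * (4 * C0) + (4 * (\<eta> * C1) + 2 * Ce) + 1"
  have parts: "0 \<le> exp (\<sigma> * Tj) * (4 * C0)" "0 \<le> 4 * (\<eta> * C1) + 2 * Ce"
    unfolding \<eta>_def using C0 C1 Ce by auto
  show ?thesis
  proof (rule exI[of _ \<sigma>], rule conjI[OF \<sigma>(1)], rule exI[of _ C], intro conjI allI impI)
    show "C > 0" unfolding C_def using parts by linarith
    fix \<xi> b d x u z w E t
    assume tr: "traj \<xi> b d x u z w" and dat: "data_bound \<sigma> E t \<xi> d x u z w" and t: "0 \<le> t"
    have E0: "E \<ge> 0" by (rule data_bound_nonneg[OF dat])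
    have dat0: "data_bound 0 E t \<xi> d x u z w" by (rule data_bound_mono[OF dat]) (use \<sigma> in auto)
    have le_C: "exp (- \<sigma> * t) * (D * E) \<le> exp (- \<sigma> * t) * (C * E)"
      if "D \<le> C" for D
      using that E0 by (intro mult_left_mono mult_right_mono) auto
    show "norm (z t) + \<bar>w t\<bar> + sup_on {t-r..t} x + sup_on {t-hor..<t} u \<le> exp (- \<sigma> * t) * (C * E)"
    proof (cases "t \<le> Tj")
      case True
      have "sup_on {t-r..t} x \<le> C0 * E"
        using tb[OF tr dat0] True t delays by (intro sup_on_le) auto
      moreover have "sup_on {t-hor..<t} u \<le> C0 * E"
        using tb[OF tr dat0] True t delays by (intro sup_on_le) auto
      ultimately have "norm (z t) + \<bar>w t\<bar> + sup_on {t-r..t} x + sup_on {t-hor..<t} u \<le> 4 * C0 * E"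
        using tb[OF tr dat0, of t] True t by linarith
      also have "\<dots> \<le> exp (- \<sigma> * t) * (exp (\<sigma> * Tj) * (4 * C0 * E))"
        by (rule exp_window[where c = 0]) (use True \<sigma> C0 E0 in auto)
      also have "\<dots> = exp (- \<sigma> * t) * ((exp (\<sigma> * Tj) * (4 * C0)) * E)" by (simp only: mult.assoc)
      also have "\<dots> \<le> exp (- \<sigma> * t) * (C * E)" by (rule le_C) (use parts in \<open>simp add: C_def\<close>)
      finally show ?thesis .
    next
      case False
      then have t': "real j * T2 \<le> t" "r + T1 \<le> t" "r \<le> t" using j T1 unfolding Tj_def by auto
      have xb: "norm (x s) \<le> exp (- \<sigma> * t) * (\<eta> * (C1 * E))" if "s \<in> {t-r..t}" for s
        unfolding \<eta>_def
        by (rule exp_window[where c = s])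
          (use that cb[rule_format, OF tr dat t'(1)] t' delays \<sigma> C1 E0 in auto)
      have ub: "\<bar>u s\<bar> \<le> exp (- \<sigma> * t) * (\<eta> * (C1 * E))" if "s \<in> {t-hor..<t}" for s
        unfolding \<eta>_def
        by (rule exp_window[where c = s])
          (use that cb[rule_format, OF tr dat t'(1)] t delays \<sigma> C1 E0 in auto)
      have "sup_on {t-r..t} x \<le> exp (- \<sigma> * t) * (\<eta> * (C1 * E))"
        using xb delays by (intro sup_on_le) auto
      moreover have "sup_on {t-hor..<t} u \<le> exp (- \<sigma> * t) * (\<eta> * (C1 * E))"
        using ub delays by (intro sup_on_le) auto
      moreover have "norm (z t - x (t - r)) \<le> exp (- \<sigma> * t) * (Ce * E)"
        by (rule exp_mult_imp_le) (use oe[OF tr dat] t' in auto)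
      moreover have "\<bar>w t - first_unit \<bullet> x (t - r)\<bar> \<le> exp (- \<sigma> * t) * (Ce * E)"
        by (rule exp_mult_imp_le) (use oe[OF tr dat] t' in auto)
      moreover have "norm (x (t - r)) \<le> exp (- \<sigma> * t) * (\<eta> * (C1 * E))"
        by (rule xb) (use delays in auto)
      ultimately have "norm (z t) + \<bar>w t\<bar> + sup_on {t-r..t} x + sup_on {t-hor..<t} u
        \<le> 4 * (exp (- \<sigma> * t) * (\<eta> * (C1 * E))) + 2 * (exp (- \<sigma> * t) * (Ce * E))"
        using norm_triangle_ineq[of "x (t - r)" "z t - x (t - r)"]
          abs_first_unit_inner_le[of "x (t - r)"]
              by (simp only: add_diff_cancel_left' diff_add_cancel add_diff_eq)
      also have "\<dots> = exp (- \<sigma> * t) * ((4 * (\<eta> * C1) + 2 * Ce) * E)" by algebra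
      also have "\<dots> \<le> exp (- \<sigma> * t) * (C * E)" by (rule le_C) (use parts in \<open>simp add: C_def\<close>)
      finally show ?thesis .
    qed
  qed
qed

lemma closed_loop_traj:
  assumes "closed_loop_solution f g r \<tau> p \<theta> T1 T2 l m k x0 u0 z0 w0 \<xi> b d x u z w"
    and x0: "continuous_on {-r..0} x0" and u0: "L_inf {-r-\<tau>..<0} u0"
    and "L_inf_loc {0..} b" "\<forall>s\<ge>0. b s \<ge> 0" "L_inf_loc {0..} d"
  shows "traj \<xi> b d x u z w"
proof -
  have eq: "- r - \<tau> = - hor" by simp
  have xx0: "\<And>s. s \<in> {-r..0} \<Longrightarrow> x s = x0 s" and uu0: "\<And>s. s \<in> {-hor..<0} \<Longrightarrow> u s = u0 s"
    using assms(1) unfolding closed_loop_solution_def eq by auto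
  have "continuous_on {-r..0} x" by (rule continuous_on_eq[OF x0 xx0[symmetric]])
  moreover have "L_inf {-hor..<0} u"
  proof -
    obtain B where B: "\<forall>s\<in>{-hor..<0}. norm (u0 s) \<le> B" using L_infD(2)[OF u0] unfolding eq by blast
    have "u absolutely_integrable_on {-hor..0}"
      by (rule absolutely_integrable_spike[OF L_infD(1)[OF u0, unfolded eq], of
          "{0}"]) (use uu0 in auto)
    then show ?thesis by (rule L_inf_Ico) (use B uu0 in auto)
  qed
  ultimately show ?thesis
    using assms unfolding traj_def closed_loop_solution_def by simp
qed

end

text \<open>Converts the fading-memory supremum of the final estimate into the weight at time
  \<open>s\<close> used in \<open>data_bound\<close>. Local boundedness makes the \<open>SUP\<close>
  a genuine upper bound.\<close>

lemma weighted_sup: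
  fixes h :: "real \<Rightarrow> 'a::euclidean_space"
  assumes h: "L_inf_loc {0..} h" and \<sigma>: "\<sigma> \<ge> 0" and s: "s \<in> {0..t}"
  shows "exp (\<sigma> * s) * norm (h s) \<le> exp (\<sigma> * t) * (SUP s\<in>{0..t}. exp (- \<sigma> * (t - s)) * norm (h s))"
proof -
  obtain B where B: "B \<ge> 0" "\<And>s. s \<in> {0..t} \<Longrightarrow> norm (h s) \<le> B"
      using L_inf_locD(2)[OF h, of t] by blast
  have bdd: "bdd_above ((\<lambda>s. exp (- \<sigma> * (t - s)) * norm (h s)) ` {0..t})"
  proof (rule bdd_aboveI2)
    fix s assume s: "s \<in> {0..t}"
    have "exp (- \<sigma> * (t - s)) * norm (h s) \<le> 1 * B"
      using \<sigma> s B by (intro mult_mono) auto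
    then show "exp (- \<sigma> * (t - s)) * norm (h s) \<le> B" by simp
  qed
  have "exp (\<sigma> * s) = exp (\<sigma> * t) * exp (- \<sigma> * (t - s))"
    unfolding exp_add[symmetric] by (simp add: algebra_simps)
  then have "exp (\<sigma> * s) * norm (h s) = exp (\<sigma> * t) * (exp (- \<sigma> * (t - s)) * norm (h s))"
    by (simp only: mult.assoc)
  also have "\<dots> \<le> exp (\<sigma> * t) * (SUP s\<in>{0..t}. exp (- \<sigma> * (t - s)) * norm (h s))"
    by (intro mult_left_mono cSUP_upper[OF s bdd]) simp
  finally show ?thesis .
qed

theorem theorem3p2:
  fixes f :: "'n::{finite,linorder} \<Rightarrow> 'n rvec \<Rightarrow> real"
    and g :: "'n \<Rightarrow> 'n rvec \<Rightarrow> real \<Rightarrow> real"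
    and P Q :: "'n rmat"
    and p k :: "'n rvec"
    and L G r \<tau> q \<mu> \<gamma> T \<theta> T1 T2 a K1 K2 K \<omega> \<Gamma> \<beta> :: real
    and n l m j :: nat
    and M :: "real \<Rightarrow> real"
  assumes n: "n = CARD('n)" "n \<ge> 2"
    and delays: "r \<ge> 0" "\<tau> \<ge> 0" "r + \<tau> > 0"
    and f_zero: "\<And>i. f i 0 = 0"
    and L: "L \<ge> 0"
    and f_Lipschitz: "\<And>i x z.
          \<bar>f i (head i x) - f i (head i z)\<bar> \<le> L * norm (head i x - head i z)"
    and g_Lipschitz: "\<And>i. locally_Lipschitz (\<lambda>(x, u). g i x u)"
    and G: "G \<ge> 0"
    and g_bounded: "\<And>i x u. \<bar>g i x u\<bar> \<le> G"
    and Q: "sym_pos_def Q"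
    and q: "q > 0"
    and Q_ineq: "neg_semidef (Q ** (chain + outer p first_unit)
          + (transpose chain + outer first_unit p) ** Q + (2 * q) *\<^sub>R mat 1)"
    and P: "sym_pos_def P"
    and \<mu>\<gamma>: "\<mu> > 0" "\<gamma> > 0"
    and P_ineq: "\<And>x d u. x \<bullet> ((P ** (chain + outer last_unit k)) *v x) + x \<bullet> (P *v fvec f x)
          + x \<bullet> (P *v (diag (\<chi> i. g i x u) *v d))
          \<le> - 2 * \<mu> * (x \<bullet> (P *v x)) + \<gamma> * (norm d)\<^sup>2"
    and lm: "l \<ge> 1" "m \<ge> 1"
    and T: "T = (r + \<tau>) / real m" "(real n * L + 1) * T < 1"
    and T1T2: "T1 > 0" "T2 > 0"
    and a: "a > 0" "\<And>x. a * (norm x)\<^sup>2 \<le> x \<bullet> (Q *v x)"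
    and K12: "0 < K1" "K1 \<le> K2"
      "\<And>x. K1 * (norm x)\<^sup>2 \<le> x \<bullet> (P *v x)" "\<And>x. x \<bullet> (P *v x) \<le> K2 * (norm x)\<^sup>2"
    and K: "predictor_accuracy_constant f L m (r + \<tau>) K"
    and T1_small: "4 * norm (Q *v p) * (L + \<theta>) * T1 * sqrt (matrix_norm Q / a) < q"
    and \<theta>_large: "\<theta> \<ge> max 1 (2 * matrix_norm Q * L * sqrt (real n) / q)"
    and T2_small: "((real n * L + 1 + norm k)
            * sqrt ((last_unit \<bullet> (P *v last_unit)) / (2 * K1)) + \<mu>) * norm k
          * (T2 + K * (((real n * L + 1) * T) ^ (l + 1) / (1 - (real n * L + 1) * T))) < \<mu>"
    and j: "j = (LEAST j::nat. real j * T2 \<ge> r + T1)"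
    and \<omega>: "\<omega> = 1 / 2 * max
          (L * (real n + 1) + 2 + 2 * real n * (MAX i. \<theta> ^ (2 * idx i) * (p $ i)\<^sup>2))
          (1 + L\<^sup>2)"
    and \<Gamma>: "\<Gamma> = K * (((real n * L + 1) * T) ^ (l + 1) / (1 - (real n * L + 1) * T))
          + exp (((real n + 1) * L + 3) / 2 * (r + \<tau>))"
    and \<beta>: "\<beta> = \<omega> + ((real n + 1) * L + 3) / 2"
    and M: "\<And>\<rho>. \<rho> \<ge> 0 \<Longrightarrow> M \<rho> =
          (7 * (1 + \<Gamma>) * exp (\<beta> * T2) / sqrt (1 - exp (- 2 * \<omega> * T1 * exp (- \<rho>))))
            ^ least_nat (real j + \<tau> / T2)"
  shows "\<exists>\<Theta>1>0. \<exists>\<Theta>2>0. \<exists>\<Theta>3>0. \<exists>\<Theta>4>0. \<exists>\<Theta>5>0. \<exists>\<Theta>6>0. \<exists>\<sigma>>0.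
    \<forall>(x0 :: real \<Rightarrow> 'n rvec) (u0 :: real \<Rightarrow> real) (z0 :: 'n rvec) (w0 :: real)
      (\<xi> :: real \<Rightarrow> real) (b :: real \<Rightarrow> real) (d :: real \<Rightarrow> 'n rvec).
      continuous_on {-r..0} x0 \<longrightarrow> L_inf {-r-\<tau>..<0} u0 \<longrightarrow>
      L_inf_loc {0..} \<xi> \<longrightarrow> L_inf_loc {0..} b \<longrightarrow> (\<forall>s\<ge>0. b s \<ge> 0) \<longrightarrow> L_inf_loc {0..} d \<longrightarrow>
      (\<exists>x u z w. closed_loop_solution f g r \<tau> p \<theta> T1 T2 l m k x0 u0 z0 w0 \<xi> b d x u z w) \<and>
      (\<forall>x u z w. closed_loop_solution f g r \<tau> p \<theta> T1 T2 l m k x0 u0 z0 w0 \<xi> b d x u z w \<longrightarrow>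
        (\<forall>t\<ge>0.
          norm (z t) + \<bar>w t\<bar> + sup_on {t-r..t} x + sup_on {t-r-\<tau>..<t} u
          \<le> exp (- \<sigma> * t) * M (SUP s\<in>{0..real j * T2 + \<tau>}. b s)
              * (\<Theta>1 * norm z0 + \<Theta>2 * \<bar>w0\<bar> + \<Theta>3 * sup_on {-r..0} x0 + \<Theta>4 * sup_on {-r-\<tau>..<0} u0)
            + M (SUP s\<in>{0..real j * T2 + \<tau>}. b s) * \<Theta>5
              * (SUP s\<in>{0..t}. exp (- \<sigma> * (t - s)) * \<bar>\<xi> s\<bar>)
            + M (SUP s\<in>{0..real j * T2 + \<tau>}. b s) * \<Theta>6
              * (SUP s\<in>{0..t}. exp (- \<sigma> * (t - s)) * norm (d s))))"
proof -
  have TT: "(r + \<tau>) / real m = T" using T(1) by simp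
  interpret predictor_loop f L n g G r \<tau> \<theta> T1 T2 p k l m K
    by unfold_locales (use assms in \<open>auto simp: TT\<close>)
  have eps: "\<epsilon> = K * (((real n * L + 1) * T) ^ (l + 1) / (1 - (real n * L + 1) * T))"
    unfolding \<epsilon>_def TT ..
  interpret stable_loop f L n g G r \<tau> \<theta> T1 T2 p k l m K Q P q \<mu> \<gamma> a K1 K2
    by unfold_locales (use assms(11-) K12 in \<open>auto simp: eps\<close>)
  have ex: "\<exists>j::nat. real j * T2 \<ge> r + T1"
      using hold_intervals_cover[of "r + T1"] less_imp_le by blast
  have jT: "real j * T2 \<ge> r + T1" unfolding j by (rule LeastI_ex[OF ex])
  \<comment> \<open>The base of the power is at least 1: its numerator is at least 1 and the root in
    its denominator lies in (0, 1], since \<omega> is positive.\<close>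
  have M1: "M \<rho> \<ge> 1" if "\<rho> \<ge> 0" for \<rho>
  proof -
    define y where "y = 2 * \<omega> * T1 * exp (- \<rho>)"
    have om: "\<omega> \<ge> 1 / 2"
      unfolding \<omega> by (simp add: le_max_iff_disj)
    have y: "y > 0" unfolding y_def using om T1T2 by simp
    have den: "0 < sqrt (1 - exp (- y))" "sqrt (1 - exp (- y)) \<le> 1" using y by auto
    have "\<Gamma> \<ge> 0" unfolding \<Gamma> using eps eps_nonneg by simp
    moreover have "\<beta> \<ge> 0" unfolding \<beta> using om L by simp
    ultimately have num: "1 * 1 \<le> (7 * (1 + \<Gamma>)) * exp (\<beta> * T2)"
      using T1T2 by (intro mult_mono) auto
    have "1 \<le> 7 * (1 + \<Gamma>) * exp (\<beta> * T2) / sqrt (1 - exp (- y))"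
      unfolding le_divide_eq_1_pos[OF den(1)] using num den(2) by linarith
    then have "1 \<le> (7 * (1 + \<Gamma>) * exp (\<beta> * T2) / sqrt (1 - exp (- y))) ^ least_nat (real j
        + \<tau> / T2)"
      by (rule one_le_power)
    then show ?thesis unfolding M[OF that] y_def by simp
  qed
  obtain \<sigma> C where \<sigma>: "\<sigma> > 0" and C: "C > 0" and bound: "\<forall>\<xi> b d x u z w E t. traj \<xi> b d x u z w \<longrightarrow>
    data_bound \<sigma> E t \<xi> d x u z w \<longrightarrow> 0 \<le> t \<longrightarrow>
    norm (z t) + \<bar>w t\<bar> + sup_on {t-r..t} x + sup_on {t-(r+\<tau>)..<t} u \<le> exp (- \<sigma> * t) * (C * E)"
    using exponential_bound[OF jT] by (elim exE conjE) (rule that)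
  show ?thesis
  \<comment> \<open>A single constant \<open>C\<close> serves as all six gains, because
    \<open>E\<close> below weighs all data equally.\<close>
  proof (rule exI[of _ C], rule conjI[OF C], rule exI[of _ C], rule conjI[OF C],
      rule exI[of _ C], rule conjI[OF C], rule exI[of _ C], rule conjI[OF C],
      rule exI[of _ C], rule conjI[OF C], rule exI[of _ C], rule conjI[OF C],
      rule exI[of _ \<sigma>], rule conjI[OF \<sigma>], intro conjI allI impI)
    fix x0 :: "real \<Rightarrow> 'n rvec" and u0 :: "real \<Rightarrow> real" and z0 :: "'n rvec"
      and w0 :: real and \<xi> b :: "real \<Rightarrow> real" and d :: "real \<Rightarrow> 'n rvec"
    assume x0: "continuous_on {-r..0} x0" and u0: "L_inf {-r-\<tau>..<0} u0" and \<xi>: "L_inf_loc {0..} \<xi>"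
      and b': "L_inf_loc {0..} b" "\<forall>s\<ge>0. b s \<ge> 0" and d: "L_inf_loc {0..} d"
    interpret loop_data f L n g G r \<tau> \<theta> T1 T2 p k l m x0 u0 z0 w0 \<xi> b d
      by unfold_locales (use x0 u0 \<xi> b' d in auto)
    show "\<exists>x u z w. closed_loop_solution f g r \<tau> p \<theta> T1 T2 l m k x0 u0 z0 w0 \<xi> b d x u z w"
      by (rule closed_loop_exists)
    fix x :: "real \<Rightarrow> 'n rvec" and u z w and t :: real
    assume sol: "closed_loop_solution f g r \<tau> p \<theta> T1 T2 l m k x0 u0 z0 w0 \<xi> b d x u z w"
        and t: "0 \<le> t"
    have tr: "traj \<xi> b d x u z w" by (rule closed_loop_traj[OF sol x0 u0 b' d])
    define S\<xi> where "S\<xi> = (SUP s\<in>{0..t}. exp (- \<sigma> * (t - s)) * \<bar>\<xi> s\<bar>)"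
    define Sd where "Sd = (SUP s\<in>{0..t}. exp (- \<sigma> * (t - s)) * norm (d s))"
    define I where "I = norm z0 + \<bar>w0\<bar> + sup_on {-r..0} x0 + sup_on {-r-\<tau>..<0} u0"
    \<comment> \<open>The factor \<open>exp (\<sigma> * t)\<close> compensates the decay in the
      bound, so that the inputs reappear through their fading-memory suprema while the initial data
      keep the decaying factor.\<close>
    define E where "E = I + exp (\<sigma> * t) * (S\<xi> + Sd)"
    have \<xi>b: "exp (\<sigma> * s) * \<bar>\<xi> s\<bar> \<le> exp (\<sigma> * t) * S\<xi>" if "s \<in> {0..t}" for s
      using weighted_sup[OF \<xi> less_imp_le[OF \<sigma>] that] unfolding S\<xi>_def real_norm_def .
    have db: "exp (\<sigma> * s) * norm (d s) \<le> exp (\<sigma> * t) * Sd" if "s \<in> {0..t}" for s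
      using weighted_sup[OF d less_imp_le[OF \<sigma>] that] unfolding Sd_def .
    have x0b: "norm (x0 s) \<le> sup_on {-r..0} x0" if "s \<in> {-r..0}" for s
      by (rule norm_le_sup_on[OF that]) (intro compact_imp_bounded compact_continuous_image x0
          compact_Icc)
    have u0b: "\<bar>u0 s\<bar> \<le> sup_on {-r-\<tau>..<0} u0" if "s \<in> {-r-\<tau>..<0}" for s
      using norm_le_sup_on[OF that, of u0] u0 unfolding L_inf_def by simp
    have nn: "0 \<le> exp (\<sigma> * t) * S\<xi>" "0 \<le> exp (\<sigma> * t) * Sd" "0 \<le> sup_on {-r..0} x0" "0
        \<le> sup_on {-r-\<tau>..<0} u0"
    proof -
      show "0 \<le> exp (\<sigma> * t) * S\<xi>" by (rule order_trans[OF _ \<xi>b[of 0]]) (use t in auto)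
      show "0 \<le> exp (\<sigma> * t) * Sd" by (rule order_trans[OF _ db[of 0]]) (use t in auto)
      show "0 \<le> sup_on {-r..0} x0" by (rule order_trans[OF norm_ge_zero x0b[of 0]])
          (use delays in auto)
      show "0 \<le> sup_on {-r-\<tau>..<0} u0" by (rule order_trans[OF abs_ge_zero u0b[of
          "-r-\<tau>"]]) (use delays in auto)
    qed
    have S0: "0 \<le> S\<xi>" "0 \<le> Sd" using nn(1,2) by (simp_all add: zero_le_mult_iff)
    have I0: "0 \<le> I" unfolding I_def using nn by simp
    have "data_bound \<sigma> E t \<xi> d x u z w"
      unfolding data_bound_def
    proof (intro conjI ballI)
      have init: "\<And>s. s \<in> {-r..0} \<Longrightarrow> x s = x0 s" "\<And>s. s \<in> {-r-\<tau>..<0} \<Longrightarrow>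
          u s = u0 s" "z 0 = z0" "w 0 = w0"
        using sol unfolding closed_loop_solution_def by auto
      have "I \<le> E" unfolding E_def using S0 by simp
      then have EI: "sup_on {-r..0} x0 \<le> E" "sup_on {-r-\<tau>..<0} u0 \<le> E" "norm z0 \<le> E" "\<bar>w0\<bar> \<le> E"
        using nn norm_ge_zero[of z0] abs_ge_zero[of w0] unfolding I_def by linarith+
      show "exp (\<sigma> * s) * \<bar>\<xi> s\<bar> \<le> E" if "s \<in> {0..t}" for s
        using \<xi>b[OF that] nn I0 unfolding E_def by (simp add: distrib_left)
      show "exp (\<sigma> * s) * norm (d s) \<le> E" if "s \<in> {0..t}" for s
        using db[OF that] nn I0 unfolding E_def by (simp add: distrib_left)
      show "norm (x s) \<le> E" if "s \<in> {-r..0}" for s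
        using x0b[OF that] init(1)[OF that] EI(1) by simp
      show "\<bar>u s\<bar> \<le> E" if "s \<in> {-(r + \<tau>)..<0}" for s
        using u0b[of s] init(2)[of s] that EI(2) by simp
      show "norm (z 0) \<le> E" "\<bar>w 0\<bar> \<le> E" using init EI by auto
    qed
    then have "norm (z t) + \<bar>w t\<bar> + sup_on {t-r..t} x + sup_on {t-(r+\<tau>)..<t} u
        \<le> exp (- \<sigma> * t) * (C * E)"
      using bound tr t by blast
    also have "\<dots> = exp (- \<sigma> * t) * (C * I) + (exp (- \<sigma> * t) * exp (\<sigma> * t)) * (C * (S\<xi> + Sd))"
      unfolding E_def by algebra
    also have "exp (- \<sigma> * t) * exp (\<sigma> * t) = 1" by (simp add: exp_minus)
    also have "exp (- \<sigma> * t) * (C * I) + 1 * (C * (S\<xi> + Sd))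
        = 1 * (exp (- \<sigma> * t) * (C * I) + C * (S\<xi> + Sd))" by simp
    also have "\<dots> \<le> M (SUP s\<in>{0..real j * T2 + \<tau>}. b s) * (exp (- \<sigma> * t) * (C * I) + C * (S\<xi> + Sd))"
    proof (rule mult_right_mono[OF M1])
      have J0: "0 \<in> {0..real j * T2 + \<tau>}" using T1T2 delays by auto
      obtain B where "\<forall>s\<in>{0..real j * T2 + \<tau>}. norm (b s) \<le> B"
          using L_inf_locD(2)[OF b'(1)] by blast
      then have "bdd_above (b ` {0..real j * T2 + \<tau>})" 
        by (intro bdd_aboveI2[of _ _ B]) (auto dest: bspec abs_le_D1)
      from cSUP_upper[OF J0 this] show "0 \<le> (SUP s\<in>{0..real j * T2 + \<tau>}. b s)"
        using b'(2) by (meson order_refl order_trans)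
      show "0 \<le> exp (- \<sigma> * t) * (C * I) + C * (S\<xi> + Sd)" using C I0 S0 by simp
    qed
    also have "\<dots> = exp (- \<sigma> * t) * M (SUP s\<in>{0..real j * T2 + \<tau>}. b s)
              * (C * norm z0 + C * \<bar>w0\<bar> + C * sup_on {-r..0} x0 + C * sup_on {-r-\<tau>..<0} u0)
            + M (SUP s\<in>{0..real j * T2 + \<tau>}. b s) * C * S\<xi>
            + M (SUP s\<in>{0..real j * T2 + \<tau>}. b s) * C * Sd"
      unfolding I_def by algebra
    finally show "norm (z t) + \<bar>w t\<bar> + sup_on {t-r..t} x + sup_on {t-r-\<tau>..<t} u
          \<le> exp (- \<sigma> * t) * M (SUP s\<in>{0..real j * T2 + \<tau>}. b s)
              * (C * norm z0 + C * \<bar>w0\<bar> + C * sup_on {-r..0} x0 + C * sup_on {-r-\<tau>..<0} u0)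
            + M (SUP s\<in>{0..real j * T2 + \<tau>}. b s) * C
              * (SUP s\<in>{0..t}. exp (- \<sigma> * (t - s)) * \<bar>\<xi> s\<bar>)
            + M (SUP s\<in>{0..real j * T2 + \<tau>}. b s) * C
              * (SUP s\<in>{0..t}. exp (- \<sigma> * (t - s)) * norm (d s))"
      unfolding S\<xi>_def Sd_def diff_diff_eq .
  qed
qed

end
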